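(* Let $K$ be an algebraically closed field of characteristic zero and $S=K[x_1,\ldots,x_5]$. If $I=(f_1,f_2,\ldots,f_5)\subset S$ is an ideal generated by a generic (regular) sequence of homogeneous polynomials of degree $2$, or if $f_1,f_2,\ldots,f_5$ is a regular sequence of homogeneous polynomials of degree $2$ with $f_i\in K[x_i,\ldots,x_5]$ for $i=1,\ldots,5$ and $I=(f_1,\ldots,f_5)$, then the generic initial ideal $J=\operatorname{Gin}(I)$ of $I$ with respect to the reverse lexicographic order is $$J=(x_1^2,\ x_1x_2,\ x_2^2,\ x_1x_3,\ x_2x_3,\ x_3^3,\ x_3^2x_4,\ x_1x_4^2,\ x_2x_4^2,\ x_3x_4^2,\ x_4^3,$$ $$x_3^2x_5^2,\ x_1x_4x_5^2,\ x_2x_4x_5^2,\ x_3x_4x_5^2,\ x_4^2x_5^2,\ x_5^4x_1,\ x_5^4x_2,\ x_5^4x_3,\ x_5^4x_4,\ x_5^6).$$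
   Context: The generic initial ideal $\operatorname{Gin}(I)$ is the common initial ideal, with respect to the graded reverse lexicographic order with $x_1>\cdots>x_5$, of $\alpha I$ for all $\alpha$ in a nonempty Zariski open subset of $GL_5(K)$ acting by linear changes of coordinates. A property holds for a generic sequence of five homogeneous polynomials of degree $2$ if there is a nonempty Zariski open subset $U\subset (S_2)^5$ such that it holds for every $(f_1,\ldots,f_5)\in U$. *)

theory Defs
  imports
    "HOL-Analysis.Determinants"
    "HOL-Computational_Algebra.Polynomial"
    "HOL-Library.Poly_Mapping"
    "HOL-Library.Numeral_Type"
begin

section \<open>Multivariate polynomials\<close>

text \<open>Polynomials with coefficients in \<open>'k\<close> and variables indexed by \<open>'i\<close>; the ring structure
  is the convolution product that \<open>HOL-Library.Poly_Mapping\<close> puts on this type.\<close>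

type_synonym 'i monom = "'i \<Rightarrow>\<^sub>0 nat"
type_synonym ('i, 'k) mpol = "'i monom \<Rightarrow>\<^sub>0 'k"

definition monomial :: "'i monom \<Rightarrow> ('i, 'k::comm_semiring_1) mpol" where
  "monomial m = Poly_Mapping.single m 1"

definition Const :: "'k::comm_semiring_1 \<Rightarrow> ('i, 'k) mpol" where
  "Const c = Poly_Mapping.single 0 c"

definition Var :: "'i \<Rightarrow> ('i, 'k::comm_semiring_1) mpol" where
  "Var i = monomial (Poly_Mapping.single i 1)"

text \<open>Substitution of \<open>g i\<close> for the variable \<open>i\<close>, the coefficients being mapped along \<open>c\<close>.\<close>

definition poly_subst ::
    "('k \<Rightarrow> 'b) \<Rightarrow> ('i \<Rightarrow> 'b) \<Rightarrow> ('i, 'k::comm_semiring_1) mpol \<Rightarrow> 'b::comm_semiring_1" where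
  "poly_subst c g p = (\<Sum>m\<in>Poly_Mapping.keys p. c (Poly_Mapping.lookup p m) *
     (\<Prod>i\<in>Poly_Mapping.keys m. g i ^ Poly_Mapping.lookup m i))"

definition poly_eval :: "('i \<Rightarrow> 'k) \<Rightarrow> ('i, 'k) mpol \<Rightarrow> 'k::comm_semiring_1" where
  "poly_eval v p = poly_subst (\<lambda>c. c) v p"

definition mon_deg :: "'i monom \<Rightarrow> nat" where
  "mon_deg m = (\<Sum>i\<in>Poly_Mapping.keys m. Poly_Mapping.lookup m i)"

definition homogeneous :: "nat \<Rightarrow> ('i, 'k::zero) mpol \<Rightarrow> bool" where
  "homogeneous d p \<longleftrightarrow> (\<forall>m\<in>Poly_Mapping.keys p. mon_deg m = d)"

definition polys_in :: "'i set \<Rightarrow> ('i, 'k::zero) mpol set" where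
  "polys_in V = {p. \<forall>m\<in>Poly_Mapping.keys p. Poly_Mapping.keys m \<subseteq> V}"

section \<open>Ideals and regular sequences\<close>

definition ideal_of :: "'a::comm_ring_1 set \<Rightarrow> 'a set" where
  "ideal_of B = module.span (*) B"

definition regular_sequence :: "('r::linorder \<Rightarrow> 'a::comm_ring_1) \<Rightarrow> bool" where
  "regular_sequence f \<longleftrightarrow>
     (\<forall>i g. f i * g \<in> ideal_of (f ` {..<i}) \<longrightarrow> g \<in> ideal_of (f ` {..<i})) \<and>
     ideal_of (f ` UNIV) \<noteq> UNIV"

section \<open>Graded reverse lexicographic order and initial ideals\<close>

text \<open>Smaller indices denote larger variables. In equal degree, the smaller monomial is the one
  with the larger exponent at the last variable where the two differ.\<close>

definition revlex_less :: "'i::linorder monom \<Rightarrow> 'i monom \<Rightarrow> bool" where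
  "revlex_less a b \<longleftrightarrow> mon_deg a < mon_deg b \<or>
     mon_deg a = mon_deg b \<and>
     (\<exists>i. Poly_Mapping.lookup a i > Poly_Mapping.lookup b i \<and>
          (\<forall>j>i. Poly_Mapping.lookup a j = Poly_Mapping.lookup b j))"

definition is_initial_monom :: "('i::linorder, 'k::zero) mpol \<Rightarrow> 'i monom \<Rightarrow> bool" where
  "is_initial_monom p m \<longleftrightarrow> m \<in> Poly_Mapping.keys p \<and>
     (\<forall>m'\<in>Poly_Mapping.keys p. m' \<noteq> m \<longrightarrow> revlex_less m' m)"

definition initial_ideal :: "('i::linorder, 'k::comm_ring_1) mpol set \<Rightarrow> ('i, 'k) mpol set" where
  "initial_ideal I = ideal_of {monomial m |m. \<exists>p\<in>I. is_initial_monom p m}"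

section \<open>Zariski open sets, generic sequences and generic initial ideals\<close>

text \<open>\<open>U\<close> is Zariski open in \<open>A\<close>, where the points \<open>a\<close> of \<open>A\<close> have affine coordinates \<open>x a\<close>.\<close>

definition zariski_open_in ::
    "('a \<Rightarrow> 'c \<Rightarrow> 'k::comm_ring_1) \<Rightarrow> 'a set \<Rightarrow> 'a set \<Rightarrow> bool" where
  "zariski_open_in x A U \<longleftrightarrow>
     (\<exists>P :: ('c, 'k) mpol set. U = {a \<in> A. \<exists>p\<in>P. poly_eval (x a) p \<noteq> 0})"

text \<open>The coordinates on tuples of forms of degree \<open>d\<close> are their coefficients. There is a
  coordinate for every monomial, but those of monomials of degree other than \<open>d\<close> vanish
  identically on such tuples, so they have no influence on the topology.\<close>

definition for_generic_forms ::
    "nat \<Rightarrow> (('r \<Rightarrow> ('i, 'k::comm_ring_1) mpol) \<Rightarrow> bool) \<Rightarrow> bool" where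
  "for_generic_forms d Q \<longleftrightarrow>
     (\<exists>U. U \<noteq> {} \<and>
          zariski_open_in (\<lambda>f (r, m). Poly_Mapping.lookup (f r) m) {f. \<forall>r. homogeneous d (f r)} U \<and>
          (\<forall>f\<in>U. Q f))"

definition lin_change :: "'k^'n^'n \<Rightarrow> ('n::finite, 'k::comm_ring_1) mpol \<Rightarrow> ('n, 'k) mpol" where
  "lin_change A p = poly_subst Const (\<lambda>j. \<Sum>i\<in>UNIV. Const (A $ i $ j) * Var i) p"

text \<open>\<open>is_gin I J\<close> reads ``\<open>J\<close> is the generic initial ideal of \<open>I\<close>''. Over an infinite field
  there is at most one such \<open>J\<close>, as nonempty open subsets of the general linear group meet.\<close>

definition is_gin ::
    "('n::{finite,linorder}, 'k::comm_ring_1) mpol set \<Rightarrow> ('n, 'k) mpol set \<Rightarrow> bool" where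
  "is_gin I J \<longleftrightarrow>
     (\<exists>U. U \<noteq> {} \<and>
          zariski_open_in (\<lambda>A (i, j). A $ i $ j) {A. invertible A} U \<and>
          (\<forall>A\<in>U. initial_ideal (lin_change A ` I) = J))"

section \<open>Five variables\<close>

text \<open>The elements of the index type \<open>5\<close> are \<open>0 < 1 < 2 < 3 < 4\<close> (and \<open>5 = 0\<close>), hence the shift.\<close>

abbreviation x1 :: "(5, 'k::comm_semiring_1) mpol" (\<open>x\<^sub>1\<close>) where "x\<^sub>1 \<equiv> Var 0"
abbreviation x2 :: "(5, 'k::comm_semiring_1) mpol" (\<open>x\<^sub>2\<close>) where "x\<^sub>2 \<equiv> Var 1"
abbreviation x3 :: "(5, 'k::comm_semiring_1) mpol" (\<open>x\<^sub>3\<close>) where "x\<^sub>3 \<equiv> Var 2"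
abbreviation x4 :: "(5, 'k::comm_semiring_1) mpol" (\<open>x\<^sub>4\<close>) where "x\<^sub>4 \<equiv> Var 3"
abbreviation x5 :: "(5, 'k::comm_semiring_1) mpol" (\<open>x\<^sub>5\<close>) where "x\<^sub>5 \<equiv> Var 4"

end

theory Submission
  imports Defs
begin

text \<open>
  In every degree \<open>d\<close> the monomials outside \<open>J\<close> are the last \<open>1, 5, 10, 10, 5, 1, 0, 0, \<dots>\<close> monomials in the
  graded reverse lexicographic order; call them standard. The numbers are the values of the Hilbert
  function of a complete intersection of five quadrics in five variables. Let \<open>g\<close> be five quadrics
  with the property \<open>spanning\<close>: modulo the ideal \<open>(g)\<close>, every nonstandard monomial of degree at most \<open>6\<close> is a
  combination of standard ones. As the standard monomials of a degree are smaller than the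
  nonstandard ones, every generator of \<open>J\<close> is then an initial monomial of \<open>(g)\<close>. Conversely no standard
  monomial is one, by a dimension count: in degree \<open>e + 2\<close>, the space of coefficient vectors
  \<open>(q\<^sub>1, \<dots>, q\<^sub>5)\<close> of degree \<open>e\<close> is exhausted by preimages of the nonstandard monomials together with the
  Koszul syzygies, which are independent when there are no syzygies of degree \<open>e - 2\<close>. So a combination
  \<open>q\<^sub>1 g\<^sub>1 + \<dots> + q\<^sub>5 g\<^sub>5\<close> of standard monomials vanishes, and the initial ideal of \<open>(g)\<close> is exactly \<open>J\<close>
  (\<open>initial_ideal_spanning\<close>).

  The property \<open>spanning\<close> is open: where a family of quadrics with polynomial coefficients is spanning
  at one parameter, it is spanning wherever some polynomial function that does not vanish at that
  parameter is nonzero (\<open>spanning_open\<close>). Hence, for a single ideal, one coordinate change with spanning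
  image determines the generic initial ideal (\<open>is_gin_if_spanning\<close>).

  The quadrics \<open>x\<^sub>1\<^sup>2, \<dots>, x\<^sub>5\<^sup>2\<close> become spanning in suitable coordinates (\<open>spanning_base\<close>). There \<open>x\<^sub>5\<close>
  is the sum of the five forms that are squared, and the claim in degrees \<open>3\<close> to \<open>6\<close> is the strong Lefschetz
  property of \<open>K[x\<^sub>1, \<dots>, x\<^sub>5]/(x\<^sub>1\<^sup>2, \<dots>, x\<^sub>5\<^sup>2)\<close>, which symmetric functions make explicit;
  degree \<open>2\<close> is a calculation. Openness in the coefficients of the quadrics yields the statement on
  generic sequences. For a triangular regular sequence, \<open>x\<^sub>i\<^sup>2\<close> occurs in \<open>f\<^sub>i\<close>
  (\<open>regular_triangular_diagonal\<close>): otherwise, for the last \<open>i\<close> where it does not, a power of \<open>f\<^sub>i\<close> lies in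
  \<open>(f\<^sub>i\<^sub>+\<^sub>1, \<dots>, f\<^sub>5)\<close>, although \<open>f\<^sub>i\<close> is a nonzerodivisor modulo all the other members. Diagonal coordinate
  changes then degenerate the ideal to \<open>(x\<^sub>1\<^sup>2, \<dots>, x\<^sub>5\<^sup>2)\<close>, and openness along this curve carries \<open>spanning\<close>
  over to \<open>f\<close>.
\<close>

abbreviation "lookup \<equiv> Poly_Mapping.lookup"
abbreviation "keys \<equiv> Poly_Mapping.keys"

section \<open>Polynomials, substitutions and ideals\<close>

lemma Const_0 [simp]: "Const 0 = 0"
  and Const_1 [simp]: "Const 1 = 1"
  and Const_add: "Const (a + b) = Const a + Const b"
  and Const_mult: "Const (a * b) = Const a * Const b"
  by (simp_all add: Const_def single_add mult_single)

lemma Const_uminus: "Const (- a) = - Const (a::'k::comm_ring_1)"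
  by (simp add: Const_def single_uminus)

lemma Const_sum: "Const (sum h S) = (\<Sum>i\<in>S. Const (h i))"
  by (induction S rule: infinite_finite_induct) (simp_all add: Const_add)

lemma Const_numeral: "Const (numeral n) = numeral n"
  by (simp add: Const_def)

lemma monomial_0 [simp]: "monomial 0 = 1"
  by (simp add: monomial_def)

lemma monomial_add: "monomial (a + b) = monomial a * monomial b"
  by (simp add: monomial_def mult_single)

lemma lookup_monomial: "lookup (monomial m) n = (if m = n then 1 else 0)"
  by (simp add: monomial_def lookup_single when_def)

lemma keys_monomial [simp]: "keys (monomial m :: ('i, 'k::comm_semiring_1) mpol) = {m}"
  by (simp add: monomial_def)

lemma lookup_Const_mult: "lookup (Const c * p) m = c * lookup p m"
proof -
  have "Const c * p = Poly_Mapping.map ((*) c) p"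
    by (simp add: Const_def mult_map_scale_conv_mult)
  then show ?thesis
    by (simp add: Poly_Mapping.map.rep_eq when_def)
qed

lemma keys_Const_mult: "keys (Const c * p) \<subseteq> keys p"
  by (auto simp: in_keys_iff lookup_Const_mult)

lemma mpol_expand_superset:
  assumes "finite A" "keys p \<subseteq> A"
  shows "p = (\<Sum>m\<in>A. Const (lookup p m) * monomial m)"
proof (rule poly_mapping_eqI)
  fix n
  have "lookup (\<Sum>m\<in>A. Const (lookup p m) * monomial m) n
      = (\<Sum>m\<in>A. if m = n then lookup p m else 0)"
    by (simp add: lookup_sum lookup_Const_mult lookup_monomial if_distrib cong: if_cong)
  also have "\<dots> = lookup p n"
    using assms by (auto simp: sum.delta' in_keys_iff)
  finally show "lookup p n = lookup (\<Sum>m\<in>A. Const (lookup p m) * monomial m) n" ..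
qed

lemma mpol_expand: "p = (\<Sum>m\<in>keys p. Const (lookup p m) * monomial m)"
  by (rule mpol_expand_superset) auto

text \<open>A property that is closed under linear combinations holds for \<open>p\<close> if it holds for the monomials
  of \<open>p\<close>.\<close>

lemma mpol_linear_induct:
  assumes "P 0" and "\<And>p q. P p \<Longrightarrow> P q \<Longrightarrow> P (p + q)" and "\<And>c p. P p \<Longrightarrow> P (Const c * p)"
    and "\<And>m. m \<in> keys p \<Longrightarrow> P (monomial m)"
  shows "P p"
proof -
  have "P (\<Sum>m\<in>A. Const (lookup p m) * monomial m)" if "finite A" "A \<subseteq> keys p" for A
    using that by (induction A) (auto intro: assms)
  from this[of "keys p"] show ?thesis
    using mpol_expand[of p] by simp
qed

lemma lookup_monomial_mult:
  fixes p :: "('i, 'k::comm_semiring_1) mpol"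
  shows "lookup (monomial a * p) (a + m) = lookup p m"
proof (induction p rule: mpol_linear_induct)
  case (4 n)
  then show ?case by (simp flip: monomial_add add: lookup_monomial)
next
  case (3 c p)
  have "monomial a * (Const c * p) = Const c * (monomial a * p)" by (simp add: ac_simps)
  then show ?case using 3 by (simp add: lookup_Const_mult)
qed (simp_all add: algebra_simps lookup_add)

lemma lookup_mult_sum:
  fixes p q :: "('i, 'k::comm_semiring_1) mpol"
  assumes "finite D" "D = {(u, v). u + v = m}"
  shows "lookup (p * q) m = (\<Sum>(u, v)\<in>D. lookup p u * lookup q v)"
proof (induction p rule: mpol_linear_induct)
  case (2 p p')
  then show ?case
    by (simp add: algebra_simps lookup_add sum.distrib case_prod_unfold)
next
  case (3 c p)
  then show ?case
    by (simp add: mult.assoc lookup_Const_mult sum_distrib_left case_prod_unfold)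
next
  case (4 a)
  show ?case
  proof (cases "\<exists>v. m = a + v")
    case True
    then obtain v where v: "m = a + v" by auto
    have "(\<Sum>(u, v)\<in>D. lookup (monomial a :: ('i, 'k) mpol) u * lookup q v)
        = (\<Sum>(u, v)\<in>{(a, v)}. lookup (monomial a :: ('i, 'k) mpol) u * lookup q v)"
      by (rule sum.mono_neutral_right) (use assms v in \<open>auto simp: lookup_monomial split: if_splits\<close>)
    then show ?thesis using v by (simp add: lookup_monomial_mult) (simp add: lookup_monomial)
  next
    case False
    have "m \<notin> keys (monomial a * q)"
      using keys_mult[of "monomial a" q] False by auto
    moreover have "(\<Sum>(u, v)\<in>D. lookup (monomial a :: ('i, 'k) mpol) u * lookup q v) = 0"
      by (rule sum.neutral) (use assms False in \<open>auto simp: lookup_monomial\<close>)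
    ultimately show ?thesis by (simp add: in_keys_iff)
  qed
qed simp

subsection \<open>Degrees and homogeneous components\<close>

lemma mon_deg_UNIV: "mon_deg (m :: 'i::finite monom) = (\<Sum>i\<in>UNIV. lookup m i)"
  unfolding mon_deg_def by (rule sum.mono_neutral_left) (auto simp: in_keys_iff)

lemma mon_deg_add: "mon_deg (a + b :: 'i::finite monom) = mon_deg a + mon_deg b"
  by (simp add: mon_deg_UNIV lookup_add sum.distrib)

lemma mon_deg_0 [simp]: "mon_deg 0 = 0"
  by (simp add: mon_deg_def)

lemma mon_deg_single [simp]: "mon_deg (Poly_Mapping.single i k) = k"
  by (simp add: mon_deg_def)

lemma finite_mon_deg_le: "finite {m :: 'i::finite monom. mon_deg m \<le> d}"
proof -
  have "lookup ` {m :: 'i monom. mon_deg m \<le> d} \<subseteq> {f. \<forall>i. f i \<in> {..d}}"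
  proof clarsimp
    fix m :: "'i monom" and i assume "mon_deg m \<le> d"
    moreover have "lookup m i \<le> mon_deg m"
      unfolding mon_deg_UNIV by (rule member_le_sum) auto
    ultimately show "lookup m i \<le> d" by simp
  qed
  moreover have "finite {f :: 'i \<Rightarrow> nat. \<forall>i. f i \<in> {..d}}"
    using finite_PiE[of "UNIV :: 'i set" "\<lambda>_. {..d}"] by (simp add: PiE_def Pi_def)
  ultimately have "finite (lookup ` {m :: 'i monom. mon_deg m \<le> d})"
    by (rule finite_subset)
  then show ?thesis
    by (rule finite_imageD) (auto simp: inj_on_def)
qed

lemma finite_mon_deg: "finite {m :: 'i::finite monom. mon_deg m = d}"
  by (rule finite_subset[OF _ finite_mon_deg_le[of d]]) auto

lemma finite_antidiagonal: "finite {(u, v). u + v = (m :: 'i::finite monom)}"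
proof (rule finite_subset)
  let ?S = "{n :: 'i monom. mon_deg n \<le> mon_deg m}"
  show "{(u, v). u + v = m} \<subseteq> ?S \<times> ?S" by (auto simp: mon_deg_add)
  show "finite (?S \<times> ?S)" using finite_mon_deg_le by blast
qed

lemma lookup_mult_antidiagonal:
  fixes p q :: "('i::finite, 'k::comm_semiring_1) mpol"
  shows "lookup (p * q) m = (\<Sum>(u, v) | u + v = m. lookup p u * lookup q v)"
  using lookup_mult_sum[OF finite_antidiagonal refl] .

lemma homogeneous_0 [simp]: "homogeneous d 0"
  by (simp add: homogeneous_def)

lemma homogeneous_add: "homogeneous d p \<Longrightarrow> homogeneous d q \<Longrightarrow> homogeneous d (p + q)"
  using keys_add[of p q] by (auto simp: homogeneous_def)

lemma homogeneous_uminus: "homogeneous d p \<Longrightarrow> homogeneous d (- p)"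
  for p :: "('i, 'k::comm_ring_1) mpol"
  by (simp add: homogeneous_def in_keys_iff)

lemma homogeneous_diff: "homogeneous d p \<Longrightarrow> homogeneous d q \<Longrightarrow> homogeneous d (p - q)"
  for p q :: "('i, 'k::comm_ring_1) mpol"
  using homogeneous_add[of d p "- q"] homogeneous_uminus[of d q] by simp

lemma homogeneous_sum: "(\<And>x. x \<in> A \<Longrightarrow> homogeneous d (f x)) \<Longrightarrow> homogeneous d (sum f A)"
  by (induction A rule: infinite_finite_induct) (auto intro: homogeneous_add)

lemma homogeneous_mult:
  fixes p q :: "('i::finite, 'k::comm_semiring_1) mpol"
  shows "homogeneous d p \<Longrightarrow> homogeneous e q \<Longrightarrow> homogeneous (d + e) (p * q)"
  using keys_mult[of p q] by (fastforce simp: homogeneous_def mon_deg_add)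

lemma homogeneous_Const: "homogeneous 0 (Const c)"
  by (simp add: homogeneous_def Const_def)

lemma homogeneous_Const_mult: "homogeneous d p \<Longrightarrow> homogeneous d (Const c * p)"
  using keys_Const_mult[of c p] by (auto simp: homogeneous_def)

lemma homogeneous_monomial: "homogeneous (mon_deg m) (monomial m)"
  by (simp add: homogeneous_def monomial_def)

lemma homogeneous_Var: "homogeneous 1 (Var i)"
  using homogeneous_monomial[of "Poly_Mapping.single i 1"] by (simp add: Var_def)

lemma homogeneous_power:
  fixes p :: "('i::finite, 'k::comm_semiring_1) mpol"
  shows "homogeneous d p \<Longrightarrow> homogeneous (n * d) (p ^ n)"
proof (induction n)
  case 0 then show ?case using homogeneous_Const[of 1] by simp
qed (auto intro: homogeneous_mult)

lemma homogeneous_prod: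
  fixes p :: "'a \<Rightarrow> ('i::finite, 'k::comm_semiring_1) mpol"
  shows "(\<And>x. x \<in> A \<Longrightarrow> homogeneous (d x) (p x)) \<Longrightarrow> homogeneous (sum d A) (prod p A)"
proof (induction A rule: infinite_finite_induct)
  case (insert x F)
  then show ?case by (auto intro!: homogeneous_mult)
qed (use homogeneous_Const[of 1] in auto)

text \<open>The homogeneous component of degree \<open>d\<close>.\<close>

definition hom_comp :: "nat \<Rightarrow> ('i, 'k::comm_semiring_1) mpol \<Rightarrow> ('i, 'k) mpol" where
  "hom_comp d p = (\<Sum>m\<in>{m \<in> keys p. mon_deg m = d}. Const (lookup p m) * monomial m)"

lemma lookup_hom_comp: "lookup (hom_comp d p) m = (if mon_deg m = d then lookup p m else 0)"
proof -
  have "lookup (hom_comp d p) m = (\<Sum>n\<in>{n \<in> keys p. mon_deg n = d}. if n = m then lookup p n else 0)"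
    unfolding hom_comp_def
    by (simp add: lookup_sum lookup_Const_mult lookup_monomial if_distrib cong: if_cong)
  then show ?thesis by (auto simp: sum.delta' in_keys_iff)
qed

lemma homogeneous_hom_comp: "homogeneous d (hom_comp d p)"
  by (auto simp: homogeneous_def in_keys_iff lookup_hom_comp split: if_splits)

lemma hom_comp_homogeneous: "homogeneous e p \<Longrightarrow> hom_comp d p = (if d = e then p else 0)"
  by (rule poly_mapping_eqI) (auto simp: lookup_hom_comp homogeneous_def in_keys_iff)

lemma hom_comp_add: "hom_comp d (p + q) = hom_comp d p + hom_comp d q"
  by (rule poly_mapping_eqI) (simp add: lookup_hom_comp lookup_add)

lemma hom_comp_diff: "hom_comp d (p - q) = hom_comp d p - hom_comp d q"
  for p q :: "('i, 'k::comm_ring_1) mpol"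
  by (rule poly_mapping_eqI) (simp add: lookup_hom_comp lookup_minus)

lemma hom_comp_sum: "hom_comp d (sum p A) = (\<Sum>x\<in>A. hom_comp d (p x))"
  by (rule poly_mapping_eqI) (simp add: lookup_hom_comp lookup_sum)

lemma hom_comp_Const_mult: "hom_comp d (Const c * p) = Const c * hom_comp d p"
  by (rule poly_mapping_eqI) (simp add: lookup_hom_comp lookup_Const_mult)

lemma hom_comp_0 [simp]: "hom_comp d 0 = 0"
  by (rule poly_mapping_eqI) (simp add: lookup_hom_comp)

lemma hom_comp_mult_homogeneous:
  fixes p q :: "('i::finite, 'k::comm_semiring_1) mpol"
  assumes "homogeneous e q"
  shows "hom_comp d (p * q) = (if e \<le> d then hom_comp (d - e) p * q else 0)"
proof (induction p rule: mpol_linear_induct)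
  case (4 m)
  have m: "hom_comp d (monomial m :: ('i, 'k) mpol) = (if d = mon_deg m then monomial m else 0)" for d
    by (rule hom_comp_homogeneous[OF homogeneous_monomial])
  have "homogeneous (mon_deg m + e) (monomial m * q)"
    by (intro homogeneous_mult homogeneous_monomial assms)
  then show ?case
    by (auto simp: m hom_comp_homogeneous[of "mon_deg m + e"])
next
  case (3 c p)
  then show ?case by (simp add: hom_comp_Const_mult mult.assoc)
qed (simp_all add: hom_comp_add algebra_simps)

subsection \<open>Substitution homomorphisms\<close>

lemma poly_subst_superset:
  assumes "finite A" "keys p \<subseteq> A" "c 0 = 0"
  shows "poly_subst c g p = (\<Sum>m\<in>A. c (lookup p m) * (\<Prod>i\<in>keys m. g i ^ lookup m i))"
  unfolding poly_subst_def using assms by (intro sum.mono_neutral_left) (auto simp: in_keys_iff)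

lemma prod_keys_superset:
  "finite B \<Longrightarrow> keys m \<subseteq> B \<Longrightarrow> (\<Prod>i\<in>keys m. g i ^ lookup m i) = (\<Prod>i\<in>B. g i ^ lookup m i)"
  by (rule prod.mono_neutral_left) (auto simp: in_keys_iff)

text \<open>Substitution along a homomorphism \<open>c\<close> of coefficients is a ring homomorphism. Evaluation and linear
  changes of coordinates are the two instances.\<close>

locale subst_hom =
  fixes c :: "'k::comm_semiring_1 \<Rightarrow> 'b::comm_semiring_1"
  assumes c0: "c 0 = 0" and c1: "c 1 = 1"
    and c_add: "c (a + b) = c a + c b" and c_mult: "c (a * b) = c a * c b"
begin

context
  fixes g :: "'i \<Rightarrow> 'b"
begin

lemma add: "poly_subst c g (p + q) = poly_subst c g p + poly_subst c g q"
proof -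
  have "keys (p + q) \<subseteq> keys p \<union> keys q" by (rule keys_add)
  then show ?thesis
    by (simp add: poly_subst_superset[of "keys p \<union> keys q"] c0 lookup_add c_add
        algebra_simps sum.distrib)
qed

lemma zero [simp]: "poly_subst c g 0 = 0"
  by (simp add: poly_subst_def)

lemma sum: "poly_subst c g (sum p A) = (\<Sum>x\<in>A. poly_subst c g (p x))"
  by (induction A rule: infinite_finite_induct) (simp_all add: add)

lemma Const_mult: "poly_subst c g (Const a * p) = c a * poly_subst c g p"
proof -
  have "keys (Const a * p) \<subseteq> keys p" by (rule keys_Const_mult)
  then show ?thesis
    by (simp add: poly_subst_superset[of "keys p"] c0 lookup_Const_mult c_mult
        sum_distrib_left mult.assoc)
qed

lemma monomial: "poly_subst c g (monomial m) = (\<Prod>i\<in>keys m. g i ^ lookup m i)"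
  by (subst poly_subst_superset[of "{m}"]) (auto simp: c0 c1 lookup_monomial)

lemma one [simp]: "poly_subst c g 1 = 1"
  using monomial[of 0] by simp

lemma Const [simp]: "poly_subst c g (Const a) = c a"
  using Const_mult[of a 1] by simp

lemma Var [simp]: "poly_subst c g (Var i) = g i"
  by (simp add: Var_def monomial)

lemma mult: "poly_subst c g (p * q) = poly_subst c g p * poly_subst c g q"
proof (induction p rule: mpol_linear_induct)
  case (4 m)
  show ?case
  proof (induction q rule: mpol_linear_induct)
    case (4 n)
    let ?B = "keys m \<union> keys n"
    have "poly_subst c g (monomial (m + n)) = (\<Prod>i\<in>?B. g i ^ lookup (m + n) i)"
      unfolding monomial by (rule prod_keys_superset) (simp_all add: keys_add)
    also have "\<dots> = (\<Prod>i\<in>?B. g i ^ lookup m i) * (\<Prod>i\<in>?B. g i ^ lookup n i)"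
      by (simp add: lookup_add power_add prod.distrib)
    also have "\<dots> = poly_subst c g (monomial m) * poly_subst c g (monomial n)"
      by (simp add: monomial prod_keys_superset[of ?B])
    finally show ?case by (simp add: monomial_add)
  next
    case (3 a p)
    have "monomial m * (Const a * p) = Const a * (monomial m * p)" by (simp add: ac_simps)
    then show ?case using 3 by (simp add: Const_mult mult.left_commute)
  qed (simp_all add: add distrib_left)
next
  case (3 a p)
  then show ?case by (simp add: Const_mult mult.assoc)
qed (simp_all add: add distrib_right)

lemma power: "poly_subst c g (p ^ n) = poly_subst c g p ^ n"
  by (induction n) (simp_all add: mult)

end

end

lemma Var_power: "Var i ^ n = (monomial (Poly_Mapping.single i n) :: ('i, 'k::comm_semiring_1) mpol)"
proof (induction n)
  case (Suc n)
  have "Poly_Mapping.single i (Suc n) = Poly_Mapping.single i 1 + Poly_Mapping.single i n"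
    by (simp flip: single_add)
  then show ?case using Suc by (simp add: monomial_add Var_def)
qed simp

lemma monomial_prod_Var:
  "monomial m = (\<Prod>i\<in>UNIV. Var i ^ lookup m i :: ('i::finite, 'k::comm_semiring_1) mpol)"
proof -
  have "finite A \<Longrightarrow> monomial (\<Sum>i\<in>A. Poly_Mapping.single i (lookup m i))
      = (\<Prod>i\<in>A. Var i ^ lookup m i :: ('i, 'k) mpol)" for A
    by (induction A rule: finite_induct) (simp_all add: monomial_add Var_power)
  moreover have "(\<Sum>i\<in>UNIV. Poly_Mapping.single i (lookup m i)) = m"
    by (rule poly_mapping_eqI) (simp add: lookup_sum lookup_single when_def)
  ultimately show ?thesis by (metis finite)
qed

lemma subst_hom_eval: "subst_hom (\<lambda>c. c :: 'k::comm_semiring_1)"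
  by unfold_locales simp_all

lemma subst_hom_lin: "subst_hom (Const :: 'k::comm_ring_1 \<Rightarrow> ('n, 'k) mpol)"
  by unfold_locales (simp_all add: Const_add Const_mult)

lemmas poly_eval_add = subst_hom.add[OF subst_hom_eval, folded poly_eval_def]
  and poly_eval_mult = subst_hom.mult[OF subst_hom_eval, folded poly_eval_def]
  and poly_eval_Const [simp] = subst_hom.Const[OF subst_hom_eval, folded poly_eval_def]
  and poly_eval_Var [simp] = subst_hom.Var[OF subst_hom_eval, folded poly_eval_def]

context
  fixes A :: "'k::comm_ring_1^'n::finite^'n"
begin

lemma lin_change_add: "lin_change A (p + q) = lin_change A p + lin_change A q"
  and lin_change_mult: "lin_change A (p * q) = lin_change A p * lin_change A q"
  and lin_change_power: "lin_change A (p ^ n) = lin_change A p ^ n"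
  and lin_change_sum: "lin_change A (sum h S) = (\<Sum>x\<in>S. lin_change A (h x))"
  and lin_change_Const_mult: "lin_change A (Const c * p) = Const c * lin_change A p"
  and lin_change_0 [simp]: "lin_change A 0 = 0"
  and lin_change_1 [simp]: "lin_change A 1 = 1"
  and lin_change_Var: "lin_change A (Var j) = (\<Sum>i\<in>UNIV. Const (A $ i $ j) * Var i)"
  unfolding lin_change_def
  by (simp_all only: subst_hom.add[OF subst_hom_lin] subst_hom.mult[OF subst_hom_lin]
      subst_hom.Const[OF subst_hom_lin]
      subst_hom.power[OF subst_hom_lin] subst_hom.sum[OF subst_hom_lin]
      subst_hom.Const_mult[OF subst_hom_lin] subst_hom.zero[OF subst_hom_lin]
      subst_hom.one[OF subst_hom_lin] subst_hom.Var[OF subst_hom_lin])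

end

lemma lin_change_monomial:
  "lin_change A (monomial m) = (\<Prod>j\<in>UNIV. lin_change A (Var j) ^ lookup m j)"
  unfolding lin_change_def subst_hom.monomial[OF subst_hom_lin] subst_hom.Var[OF subst_hom_lin]
  by (rule prod_keys_superset) auto

lemma lin_change_lin_change:
  fixes p :: "('n::finite, 'k::comm_ring_1) mpol"
  shows "lin_change A (lin_change B p) = lin_change (A ** B) p"
proof (induction p rule: mpol_linear_induct)
  case (4 m)
  have Var: "lin_change A (lin_change B (Var j)) = lin_change (A ** B) (Var j)" for j
  proof -
    have "lin_change A (lin_change B (Var j))
        = (\<Sum>i\<in>UNIV. \<Sum>k\<in>UNIV. Const (B $ i $ j) * (Const (A $ k $ i) * Var k))"
      by (simp add: lin_change_Var lin_change_sum lin_change_Const_mult sum_distrib_left)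
    also have "\<dots> = (\<Sum>k\<in>UNIV. \<Sum>i\<in>UNIV. Const (B $ i $ j) * (Const (A $ k $ i) * Var k))"
      by (rule sum.swap)
    also have "\<dots> = (\<Sum>k\<in>UNIV. Const (\<Sum>i\<in>UNIV. A $ k $ i * B $ i $ j) * Var k)"
      by (simp add: Const_sum sum_distrib_left sum_distrib_right Const_mult ac_simps)
    finally show ?thesis by (simp add: lin_change_Var matrix_matrix_mult_def)
  qed
  have P: "lin_change A (prod h S) = (\<Prod>i\<in>S. lin_change A (h i))" for h :: "'n \<Rightarrow> ('n, 'k) mpol" and S
    by (induction S rule: infinite_finite_induct) (simp_all add: lin_change_mult)
  show ?case
    unfolding lin_change_monomial P lin_change_power Var by (simp only: P lin_change_power Var lin_change_monomial)
qed (simp_all add: lin_change_add lin_change_Const_mult)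

lemma lin_change_id: "lin_change (mat 1) p = p"
  for p :: "('n::finite, 'k::comm_ring_1) mpol"
proof (induction p rule: mpol_linear_induct)
  case (4 m)
  have "lin_change (mat 1) (Var j :: ('n, 'k) mpol) = Var j" for j
  proof -
    have "lin_change (mat 1) (Var j :: ('n, 'k) mpol) = (\<Sum>i\<in>UNIV. if i = j then Var i else 0)"
      unfolding lin_change_Var by (intro sum.cong) (auto simp: mat_def)
    then show ?thesis by simp
  qed
  then show ?case by (simp add: lin_change_monomial flip: monomial_prod_Var)
qed (simp_all add: lin_change_add lin_change_Const_mult)

lemma homogeneous_lin_change:
  fixes p :: "('n::finite, 'k::comm_ring_1) mpol"
  assumes d: "homogeneous d p"
  shows "homogeneous d (lin_change A p)"
proof -
  have Var: "homogeneous 1 (lin_change A (Var j))" for j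
    unfolding lin_change_Var by (intro homogeneous_sum homogeneous_Const_mult homogeneous_Var)
  have mono: "homogeneous (mon_deg m) (lin_change A (monomial m))" for m
    unfolding lin_change_monomial mon_deg_UNIV
  proof (rule homogeneous_prod)
    fix j
    show "homogeneous (lookup m j) (lin_change A (Var j) ^ lookup m j)"
      using homogeneous_power[OF Var[of j], of "lookup m j"] by simp
  qed
  show ?thesis
  proof (induction p rule: mpol_linear_induct)
    case (4 m)
    then show ?case using mono[of m] d by (simp add: homogeneous_def)
  qed (simp_all add: lin_change_add lin_change_Const_mult homogeneous_add homogeneous_Const_mult)
qed

subsection \<open>Ideals\<close>

lemma module_mult: "module ((*) :: 'a::comm_ring_1 \<Rightarrow> 'a \<Rightarrow> 'a)"
  by unfold_locales (simp_all add: algebra_simps)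

lemma ideal_of_base: "x \<in> B \<Longrightarrow> x \<in> ideal_of B"
  and ideal_of_0 [simp]: "0 \<in> ideal_of B"
  and ideal_of_add: "x \<in> ideal_of B \<Longrightarrow> y \<in> ideal_of B \<Longrightarrow> x + y \<in> ideal_of B"
  and ideal_of_mult: "x \<in> ideal_of B \<Longrightarrow> c * x \<in> ideal_of B"
  and ideal_of_sum: "(\<And>a. a \<in> A \<Longrightarrow> f a \<in> ideal_of B) \<Longrightarrow> sum f A \<in> ideal_of B"
  and ideal_of_mono: "B \<subseteq> C \<Longrightarrow> ideal_of B \<subseteq> ideal_of C"
  for B :: "'a::comm_ring_1 set"
  unfolding ideal_of_def
  by (simp_all add: module.span_base[OF module_mult] module.span_zero[OF module_mult]
      module.span_add[OF module_mult] module.span_scale[OF module_mult]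
      module.span_sum[OF module_mult] module.span_mono[OF module_mult])

lemma ideal_of_mult_right: "x \<in> ideal_of B \<Longrightarrow> x * c \<in> ideal_of B"
  using ideal_of_mult[of x B c] by (simp add: mult.commute)

lemma ideal_of_subset: "B \<subseteq> ideal_of C \<Longrightarrow> ideal_of B \<subseteq> ideal_of C"
  unfolding ideal_of_def by (metis module.span_mono[OF module_mult] module.span_span[OF module_mult])

lemma ideal_of_insertE:
  assumes "x \<in> ideal_of (insert a B)"
  obtains c where "x - c * a \<in> ideal_of B"
  using assms unfolding ideal_of_def module.span_insert[OF module_mult] by auto

lemma ideal_of_image:
  fixes g :: "'r::finite \<Rightarrow> 'a::comm_ring_1"
  shows "x \<in> ideal_of (g ` UNIV) \<longleftrightarrow> (\<exists>h. x = (\<Sum>i\<in>UNIV. h i * g i))"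
proof
  assume "x \<in> ideal_of (g ` UNIV)"
  then show "\<exists>h. x = (\<Sum>i\<in>UNIV. h i * g i)"
    unfolding ideal_of_def
  proof (induction rule: module.span_induct_alt[OF module_mult, consumes 1, case_names base step])
    case base
    show ?case by (rule exI[of _ "\<lambda>_. 0"]) simp
  next
    case (step c x y)
    then obtain j h where "x = g j" "y = (\<Sum>i\<in>UNIV. h i * g i)" by auto
    then have "c * x + y = (\<Sum>i\<in>UNIV. ((if i = j then c else 0) + h i) * g i)"
      by (simp add: distrib_right sum.distrib if_distrib[of "\<lambda>c. c * _"] cong: if_cong)
    then show ?case by (rule exI[of _ "\<lambda>i. (if i = j then c else 0) + h i"])
  qed
next
  assume "\<exists>h. x = (\<Sum>i\<in>UNIV. h i * g i)"
  then show "x \<in> ideal_of (g ` UNIV)"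
    by (elim exE) (simp add: ideal_of_sum ideal_of_mult ideal_of_base)
qed

lemma ideal_of_imageI: "(\<Sum>i\<in>UNIV. h i * g i) \<in> ideal_of (g ` UNIV)"
  for g :: "'r::finite \<Rightarrow> 'a::comm_ring_1"
  by (simp add: ideal_of_sum ideal_of_mult ideal_of_base)

lemma lin_change_ideal_of:
  fixes f :: "'r::finite \<Rightarrow> ('n::finite, 'k::field) mpol"
  assumes "invertible A"
  shows "lin_change A ` ideal_of (f ` UNIV) = ideal_of ((\<lambda>i. lin_change A (f i)) ` UNIV)"
proof -
  obtain B where B: "A ** B = mat 1"
    using assms by (auto simp: invertible_def)
  have surj: "lin_change A (lin_change B p) = p" for p :: "('n, 'k) mpol"
    by (simp add: lin_change_lin_change B lin_change_id)
  show ?thesis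
  proof (intro equalityI subsetI)
    fix x assume "x \<in> lin_change A ` ideal_of (f ` UNIV)"
    then obtain h where "x = lin_change A (\<Sum>i\<in>UNIV. h i * f i)"
      by (auto simp: ideal_of_image)
    then have "x = (\<Sum>i\<in>UNIV. lin_change A (h i) * lin_change A (f i))"
      by (simp add: lin_change_sum lin_change_mult)
    then show "x \<in> ideal_of ((\<lambda>i. lin_change A (f i)) ` UNIV)"
      using ideal_of_imageI[of "\<lambda>i. lin_change A (h i)" "\<lambda>i. lin_change A (f i)"] by simp
  next
    fix x assume "x \<in> ideal_of ((\<lambda>i. lin_change A (f i)) ` UNIV)"
    then obtain h where "x = (\<Sum>i\<in>UNIV. h i * lin_change A (f i))"
      unfolding ideal_of_image by blast
    then have "x = lin_change A (\<Sum>i\<in>UNIV. lin_change B (h i) * f i)"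
      by (simp add: lin_change_sum lin_change_mult surj)
    then show "x \<in> lin_change A ` ideal_of (f ` UNIV)"
      using ideal_of_imageI[of "\<lambda>i. lin_change B (h i)" f] by blast
  qed
qed

text \<open>In an ideal generated by forms of degree \<open>e\<close>, the component of degree \<open>d\<close> of an element is again a
  combination of the generators, with coefficients of degree \<open>d - e\<close>; it is zero if \<open>d < e\<close>.\<close>

lemma hom_comp_ideal_of:
  fixes g :: "'r::finite \<Rightarrow> ('i::finite, 'k::comm_ring_1) mpol"
  assumes "p \<in> ideal_of (g ` UNIV)" and "\<And>i. homogeneous e (g i)"
  obtains h where "\<And>i. homogeneous (d - e) (h i)" and "d < e \<Longrightarrow> h = (\<lambda>_. 0)"
    and "hom_comp d p = (\<Sum>i\<in>UNIV. h i * g i)"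
proof -
  obtain h where p: "p = (\<Sum>i\<in>UNIV. h i * g i)"
    using assms(1) unfolding ideal_of_image by blast
  have "hom_comp d p = (\<Sum>i\<in>UNIV. (if e \<le> d then hom_comp (d - e) (h i) else 0) * g i)"
    unfolding p hom_comp_sum
    by (intro sum.cong refl) (auto simp: hom_comp_mult_homogeneous[OF assms(2)])
  then show ?thesis
    by (intro that[of "\<lambda>i. if e \<le> d then hom_comp (d - e) (h i) else 0"])
      (auto simp: homogeneous_hom_comp)
qed

section \<open>The target ideal and its standard monomials\<close>

lemma exhaust_5: "i = 0 \<or> i = 1 \<or> i = 2 \<or> i = 3 \<or> i = (4 :: 5)"
proof (induct i)
  case (of_int z)
  then have "z = 0 \<or> z = 1 \<or> z = 2 \<or> z = 3 \<or> z = 4" by fastforce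
  then show ?case by auto
qed

lemma UNIV_5: "UNIV = {0, 1, 2, 3, 4 :: 5}"
  using exhaust_5 by auto

lemma forall_5: "(\<forall>i::5. P i) \<longleftrightarrow> P 0 \<and> P 1 \<and> P 2 \<and> P 3 \<and> P 4"
  by (metis exhaust_5)

lemma sum_5: "sum f (UNIV :: 5 set) = f 0 + f 1 + f 2 + f 3 + f 4"
  unfolding UNIV_5 by (simp add: ac_simps)

lemma less_5_iff:
  "i < j \<longleftrightarrow> i = 0 \<and> j \<noteq> 0 \<or> i = 1 \<and> (j = 2 \<or> j = 3 \<or> j = 4) \<or> i = 2 \<and> (j = 3 \<or> j = 4) \<or>
    i = 3 \<and> j = (4 :: 5)"
proof -
  have "(0::5) < 1" "(1::5) < 2" "(2::5) < 3" "(3::5) < 4"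
    by (simp_all add: less_bit1_def bit1.Rep_0 bit1.Rep_1 bit1.Rep_numeral)
  then show ?thesis
    using exhaust_5[of i] exhaust_5[of j] by (smt (verit) order.strict_trans order.asym less_irrefl)
qed

text \<open>The monomials outside the target ideal. In every degree they are the smallest ones in the
  graded reverse lexicographic order: \<open>1, 5, 10, 10, 5, 1\<close> of them in degrees \<open>0, \<dots>, 5\<close>, none in higher
  degrees. The variables \<open>x\<^sub>3, x\<^sub>4, x\<^sub>5\<close> have the indices \<open>2, 3, 4\<close>.\<close>

definition standard :: "5 monom \<Rightarrow> bool" where
  "standard m \<longleftrightarrow> mon_deg m \<le> 1 \<or>
     mon_deg m = 2 \<and> (lookup m 4 \<ge> 1 \<or> lookup m 3 \<ge> 1 \<or> lookup m 2 = 2) \<or>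
     mon_deg m = 3 \<and> (lookup m 4 \<ge> 2 \<or> lookup m 4 = 1 \<and> (lookup m 3 \<ge> 1 \<or> lookup m 2 = 2)) \<or>
     mon_deg m = 4 \<and> lookup m 4 \<ge> 3 \<or>
     mon_deg m = 5 \<and> lookup m 4 = 5"

lemma mon_deg_5: "mon_deg (m :: 5 monom) = lookup m 0 + lookup m 1 + lookup m 2 + lookup m 3 + lookup m 4"
  by (simp add: mon_deg_UNIV sum_5)

lemma nonstandardD:
  assumes "\<not> standard m"
  shows "mon_deg m \<ge> 2"
    and "mon_deg m = 2 \<Longrightarrow> lookup m 4 = 0 \<and> lookup m 3 = 0 \<and> lookup m 2 \<le> 1"
    and "mon_deg m = 3 \<Longrightarrow> lookup m 4 = 0 \<or> lookup m 4 = 1 \<and> lookup m 3 = 0 \<and> lookup m 2 \<le> 1"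
    and "mon_deg m = 4 \<Longrightarrow> lookup m 4 \<le> 2"
    and "mon_deg m = 5 \<Longrightarrow> lookup m 4 \<le> 4"
proof -
  show "mon_deg m \<ge> 2" using assms by (simp add: standard_def)
  show "lookup m 4 = 0 \<and> lookup m 3 = 0 \<and> lookup m 2 \<le> 1" if "mon_deg m = 2"
  proof -
    have "lookup m 4 = 0" "lookup m 3 = 0" "lookup m 2 \<noteq> 2"
      using assms that by (simp_all add: standard_def)
    then show ?thesis using that by (simp add: mon_deg_5)
  qed
  show "lookup m 4 = 0 \<or> lookup m 4 = 1 \<and> lookup m 3 = 0 \<and> lookup m 2 \<le> 1" if "mon_deg m = 3"
  proof -
    have "\<not> lookup m 4 \<ge> 2" "lookup m 4 = 1 \<Longrightarrow> lookup m 3 = 0" "lookup m 4 = 1 \<Longrightarrow> lookup m 2 \<noteq> 2"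
      using assms that by (simp_all add: standard_def)
    moreover have "lookup m 4 + lookup m 3 + lookup m 2 \<le> 3"
      using that by (simp add: mon_deg_5)
    ultimately show ?thesis by linarith
  qed
  show "lookup m 4 \<le> 2" if "mon_deg m = 4"
    using assms that by (simp add: standard_def)
  show "lookup m 4 \<le> 4" if "mon_deg m = 5"
  proof -
    have "lookup m 4 \<noteq> 5" using assms that by (simp add: standard_def)
    then show ?thesis using that by (simp add: mon_deg_5)
  qed
qed

lemma revlex_less_standard:
  assumes m: "\<not> standard m" and n: "standard n" and deg: "mon_deg m = mon_deg n"
  shows "revlex_less n m"
proof -
  have "lookup n 4 > lookup m 4 \<or> lookup n 4 = lookup m 4 \<and> lookup n 3 > lookup m 3 \<or>
    lookup n 4 = lookup m 4 \<and> lookup n 3 = lookup m 3 \<and> lookup n 2 > lookup m 2"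
    using n unfolding standard_def
  proof (elim disjE conjE)
    assume "mon_deg n \<le> 1"
    then show ?thesis using nonstandardD(1)[OF m] deg by simp
  qed (use nonstandardD[OF m] deg in \<open>auto simp: not_le not_less\<close>)
  then have "\<exists>i. lookup n i > lookup m i \<and> (\<forall>j>i. lookup n j = lookup m j)"
    by (elim disjE; intro exI[of _ 4] exI[of _ 3] exI[of _ 2]) (auto simp: less_5_iff)
  then show ?thesis
    using deg by (simp add: revlex_less_def)
qed

lemma revlex_less_asym: "revlex_less a b \<Longrightarrow> \<not> revlex_less b a"
  unfolding revlex_less_def by (metis less_irrefl less_asym linorder_neqE)

text \<open>The exponents of the generators of the target ideal.\<close>

definition gin_gens :: "5 monom set" where
  "gin_gens = (let x = Poly_Mapping.single in
    {x 0 2, x 0 1 + x 1 1, x 1 2, x 0 1 + x 2 1, x 1 1 + x 2 1, x 2 3, x 2 2 + x 3 1,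
     x 0 1 + x 3 2, x 1 1 + x 3 2, x 2 1 + x 3 2, x 3 3,
     x 2 2 + x 4 2, x 0 1 + x 3 1 + x 4 2, x 1 1 + x 3 1 + x 4 2, x 2 1 + x 3 1 + x 4 2, x 3 2 + x 4 2,
     x 4 4 + x 0 1, x 4 4 + x 1 1, x 4 4 + x 2 1, x 4 4 + x 3 1, x 4 6})"

lemma gin_gens_nonstandard: "m \<in> gin_gens \<Longrightarrow> \<not> standard m \<and> mon_deg m \<le> 6"
  unfolding gin_gens_def Let_def
  by (elim insertE emptyE; simp del: single_numeral single_one add: standard_def mon_deg_5 lookup_add lookup_single)

lemma divides_mpol: 
  assumes "\<And>i. lookup g i \<le> lookup m i"
  shows "\<exists>a. m = a + (g :: 'i monom)"
  by (rule exI[of _ "m - g"], rule poly_mapping_eqI) (simp add: lookup_add lookup_minus assms)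

text \<open>Every nonstandard monomial is a multiple of a generator: the negation bounds all exponents, and
  the finitely many remaining cases are standard.\<close>

lemma nonstandard_divisible:
  assumes "\<not> standard m"
  shows "\<exists>g\<in>gin_gens. \<exists>a. m = a + g"
proof -
  define a b c d e where "a = lookup m 0" and "b = lookup m 1" and "c = lookup m 2"
    and "d = lookup m 3" and "e = lookup m 4"
  note defs = this
  have "a \<ge> 2 \<or> a \<ge> 1 \<and> b \<ge> 1 \<or> b \<ge> 2 \<or> a \<ge> 1 \<and> c \<ge> 1 \<or> b \<ge> 1 \<and> c \<ge> 1 \<or> c \<ge> 3 \<or> c \<ge> 2 \<and> d \<ge> 1 \<or>
     a \<ge> 1 \<and> d \<ge> 2 \<or> b \<ge> 1 \<and> d \<ge> 2 \<or> c \<ge> 1 \<and> d \<ge> 2 \<or> d \<ge> 3 \<or>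
     c \<ge> 2 \<and> e \<ge> 2 \<or> a \<ge> 1 \<and> d \<ge> 1 \<and> e \<ge> 2 \<or> b \<ge> 1 \<and> d \<ge> 1 \<and> e \<ge> 2 \<or> c \<ge> 1 \<and> d \<ge> 1 \<and> e \<ge> 2 \<or>
     d \<ge> 2 \<and> e \<ge> 2 \<or> a \<ge> 1 \<and> e \<ge> 4 \<or> b \<ge> 1 \<and> e \<ge> 4 \<or> c \<ge> 1 \<and> e \<ge> 4 \<or> d \<ge> 1 \<and> e \<ge> 4 \<or> e \<ge> 6" (is ?D)
  proof (rule ccontr)
    assume D: "\<not> ?D"
    \<comment> \<open>The first two variables play the same role, so only their total exponent matters.\<close>
    define u where "u = a + b"
    have "\<not> a \<ge> 2" "\<not> (a \<ge> 1 \<and> b \<ge> 1)" "\<not> b \<ge> 2" "\<not> (a \<ge> 1 \<and> c \<ge> 1)" "\<not> (b \<ge> 1 \<and> c \<ge> 1)"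
      using D by (simp_all only: de_Morgan_disj simp_thms)
    then have u: "u \<le> 1" "u = 1 \<Longrightarrow> c = 0"
      unfolding u_def by linarith+
    have "\<not> c \<ge> 3" "\<not> (c \<ge> 2 \<and> d \<ge> 1)" "\<not> (c \<ge> 2 \<and> e \<ge> 2)"
      using D by (simp_all only: de_Morgan_disj simp_thms)
    then have c: "c \<le> 2" "c = 2 \<Longrightarrow> d = 0" "c = 2 \<Longrightarrow> e \<le> 1"
      by linarith+
    have "\<not> (a \<ge> 1 \<and> d \<ge> 2)" "\<not> (b \<ge> 1 \<and> d \<ge> 2)" "\<not> (c \<ge> 1 \<and> d \<ge> 2)" "\<not> d \<ge> 3" "\<not> (d \<ge> 2 \<and> e \<ge> 2)"
      using D by (simp_all only: de_Morgan_disj simp_thms)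
    then have d: "d \<le> 2" "u \<ge> 1 \<or> c \<ge> 1 \<Longrightarrow> d \<le> 1" "d = 2 \<Longrightarrow> e \<le> 1"
      unfolding u_def by linarith+
    have "\<not> (a \<ge> 1 \<and> d \<ge> 1 \<and> e \<ge> 2)" "\<not> (b \<ge> 1 \<and> d \<ge> 1 \<and> e \<ge> 2)" "\<not> (c \<ge> 1 \<and> d \<ge> 1 \<and> e \<ge> 2)"
      using D by (simp_all only: de_Morgan_disj simp_thms)
    then have de: "d \<ge> 1 \<Longrightarrow> u \<ge> 1 \<or> c \<ge> 1 \<Longrightarrow> e \<le> 1"
      unfolding u_def by linarith
    have "\<not> (a \<ge> 1 \<and> e \<ge> 4)" "\<not> (b \<ge> 1 \<and> e \<ge> 4)" "\<not> (c \<ge> 1 \<and> e \<ge> 4)" "\<not> (d \<ge> 1 \<and> e \<ge> 4)" "\<not> e \<ge> 6"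
      using D by (simp_all only: de_Morgan_disj simp_thms)
    then have e: "e \<le> 5" "u \<ge> 1 \<or> c \<ge> 1 \<or> d \<ge> 1 \<Longrightarrow> e \<le> 3"
      unfolding u_def by linarith+
    have "u = 0 \<or> u = 1" "c = 0 \<or> c = 1 \<or> c = 2" "d = 0 \<or> d = 1 \<or> d = 2"
      "e = 0 \<or> e = 1 \<or> e = 2 \<or> e = 3 \<or> e = 4 \<or> e = 5"
      using u(1) c(1) d(1) e(1) by linarith+
    moreover have "\<not> (a + b + c + d + e \<le> 1 \<or>
       a + b + c + d + e = 2 \<and> (e \<ge> 1 \<or> d \<ge> 1 \<or> c = 2) \<or>
       a + b + c + d + e = 3 \<and> (e \<ge> 2 \<or> e = 1 \<and> (d \<ge> 1 \<or> c = 2)) \<or>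
       a + b + c + d + e = 4 \<and> e \<ge> 3 \<or> a + b + c + d + e = 5 \<and> e = 5)"
      using assms unfolding standard_def mon_deg_5 defs .
    ultimately show False
      unfolding u_def[symmetric] using u c d de e by (elim disjE; simp)
  qed
  then have "\<exists>g\<in>gin_gens. \<forall>i. lookup g i \<le> lookup m i"
    unfolding gin_gens_def Let_def forall_5 lookup_add lookup_single defs
    by (simp del: single_numeral single_one add: lookup_add lookup_single numeral_2_eq_2)
  then show ?thesis using divides_mpol by blast
qed

definition gin_ideal :: "(5, 'k::comm_ring_1) mpol set" where
  "gin_ideal = ideal_of (monomial ` gin_gens)"

lemma gin_ideal_eq: "gin_ideal = ideal_of
      {x\<^sub>1^2, x\<^sub>1 * x\<^sub>2, x\<^sub>2^2, x\<^sub>1 * x\<^sub>3, x\<^sub>2 * x\<^sub>3, x\<^sub>3^3, x\<^sub>3^2 * x\<^sub>4,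
       x\<^sub>1 * x\<^sub>4^2, x\<^sub>2 * x\<^sub>4^2, x\<^sub>3 * x\<^sub>4^2, x\<^sub>4^3,
       x\<^sub>3^2 * x\<^sub>5^2, x\<^sub>1 * x\<^sub>4 * x\<^sub>5^2, x\<^sub>2 * x\<^sub>4 * x\<^sub>5^2, x\<^sub>3 * x\<^sub>4 * x\<^sub>5^2, x\<^sub>4^2 * x\<^sub>5^2,
       x\<^sub>5^4 * x\<^sub>1, x\<^sub>5^4 * x\<^sub>2, x\<^sub>5^4 * x\<^sub>3, x\<^sub>5^4 * x\<^sub>4, x\<^sub>5^6}"
  unfolding gin_ideal_def gin_gens_def Let_def Var_power
  by (simp del: single_numeral single_one add: monomial_add Var_def)

lemma monomial_in_gin_ideal: "\<not> standard m \<Longrightarrow> monomial m \<in> gin_ideal"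
proof -
  assume "\<not> standard m"
  then obtain g a where "g \<in> gin_gens" "m = a + g" using nonstandard_divisible by blast
  then show ?thesis
    unfolding gin_ideal_def by (simp add: monomial_add ideal_of_mult ideal_of_base)
qed

subsection \<open>Counting monomials in five variables\<close>

lemma card_mon_deg: "card {m :: 5 monom. mon_deg m = d} = (d + 4) choose d"
proof -
  define L where "L m = map (lookup m) [0, 1, 2, 3, 4]" for m :: "5 monom"
  define R where "R l = ((\<Sum>i<5. Poly_Mapping.single (of_nat i) (l ! i)) :: 5 monom)" for l
  have "bij_betw L {m. mon_deg m = d} {l. length l = 5 \<and> sum_list l = d}"
  proof (rule bij_betwI[where g = R])
    show "L \<in> {m. mon_deg m = d} \<rightarrow> {l. length l = 5 \<and> sum_list l = d}"
      by (auto simp: L_def mon_deg_5)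
    have R: "R l = Poly_Mapping.single 0 (l ! 0) + Poly_Mapping.single 1 (l ! 1) +
      Poly_Mapping.single 2 (l ! 2) + Poly_Mapping.single 3 (l ! 3) + Poly_Mapping.single 4 (l ! 4)" for l
      unfolding R_def by (simp add: eval_nat_numeral lessThan_Suc ac_simps)
    have lookup_R: "lookup (R l) 0 = l ! 0" "lookup (R l) 1 = l ! 1" "lookup (R l) 2 = l ! 2"
      "lookup (R l) 3 = l ! 3" "lookup (R l) 4 = l ! 4" for l
      by (simp_all add: R lookup_add lookup_single)
    have list5: "l = [l ! 0, l ! 1, l ! 2, l ! 3, l ! 4]" if "length l = 5" for l :: "nat list"
      using that by (intro nth_equalityI) (auto simp: less_Suc_eq eval_nat_numeral)
    show "R \<in> {l. length l = 5 \<and> sum_list l = d} \<rightarrow> {m. mon_deg m = d}"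
    proof clarsimp
      fix l :: "nat list" assume "length l = 5"
      then have "sum_list l = sum_list [l ! 0, l ! 1, l ! 2, l ! 3, l ! 4]"
        using list5 by metis
      then show "mon_deg (R l) = sum_list l"
        by (simp add: mon_deg_5 lookup_R)
    qed
    show "R (L m) = m" for m
    proof (rule poly_mapping_eqI)
      fix i show "lookup (R (L m)) i = lookup m i"
        using exhaust_5[of i] by (auto simp: lookup_R L_def)
    qed
    show "L (R l) = l" if "l \<in> {l. length l = 5 \<and> sum_list l = d}" for l
      using that list5[of l] by (simp add: L_def lookup_R)
  qed
  then have "card {m :: 5 monom. mon_deg m = d} = card {l :: nat list. length l = 5 \<and> sum_list l = d}"
    by (rule bij_betw_same_card)
  then show ?thesis by (simp add: card_length_sum_list add.commute)
qed

lemma mon_deg_split: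
  fixes m :: "'i::finite monom"
  assumes "lookup m i \<ge> k"
  obtains a where "m = a + Poly_Mapping.single i k" "mon_deg m = mon_deg a + k"
proof -
  have "lookup (Poly_Mapping.single i k) j \<le> lookup m j" for j
    using assms by (auto simp: lookup_single when_def)
  then obtain a where "m = a + Poly_Mapping.single i k" using divides_mpol by blast
  then show ?thesis using that by (simp add: mon_deg_add)
qed

lemma mon_deg_eq_0: "mon_deg m = 0 \<longleftrightarrow> m = (0 :: 'i::finite monom)"
  by (auto simp: mon_deg_UNIV intro: poly_mapping_eqI)

lemma mon_deg_eq_1:
  assumes "mon_deg (m :: 'i::finite monom) = 1"
  shows "\<exists>i. m = Poly_Mapping.single i 1"
proof -
  have "\<exists>i. lookup m i \<noteq> 0"
  proof (rule ccontr)
    assume "\<nexists>i. lookup m i \<noteq> 0"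
    then show False using assms by (simp add: mon_deg_UNIV)
  qed
  then obtain i where "lookup m i \<ge> 1" by (auto simp: Suc_le_eq)
  then obtain a where "m = a + Poly_Mapping.single i 1" "mon_deg m = mon_deg a + 1"
    using mon_deg_split by blast
  then show ?thesis using assms by (auto simp: mon_deg_eq_0)
qed

lemma card_standard:
  "card {m. mon_deg m = 2 \<and> standard m} \<le> 10" (is "card ?S2 \<le> _")
  "card {m. mon_deg m = 3 \<and> standard m} \<le> 10" (is "card ?S3 \<le> _")
  "card {m. mon_deg m = 4 \<and> standard m} \<le> 5" (is "card ?S4 \<le> _")
  "card {m. mon_deg m = 5 \<and> standard m} \<le> 1" (is "card ?S5 \<le> _")
proof -
  let ?x = "Poly_Mapping.single :: 5 \<Rightarrow> nat \<Rightarrow> 5 monom"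
  have c4: "card {0, 1, 2, 3 :: 5} = 4" by simp
  have not4: "i \<in> {0, 1, 2, 3}" if "i \<noteq> 4" for i :: 5
    using exhaust_5[of i] that by auto
  have bound: "card S \<le> 10"
    if "S \<subseteq> (\<lambda>i. ?x i 1 + u) ` UNIV \<union> (\<lambda>i. ?x i 1 + v) ` {0, 1, 2, 3} \<union> {w}" for S u v w
  proof -
    let ?T = "(\<lambda>i. ?x i 1 + u) ` UNIV \<union> (\<lambda>i. ?x i 1 + v) ` {0, 1, 2, 3} \<union> {w}"
    have "card S \<le> card ?T" using that by (intro card_mono) auto
    also have "\<dots> \<le> card ((\<lambda>i. ?x i 1 + u) ` UNIV) + card ((\<lambda>i. ?x i 1 + v) ` {0, 1, 2, 3}) + card {w}"
      by (intro order_trans[OF card_Un_le] add_mono card_Un_le order_refl)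
    also have "\<dots> \<le> 5 + 4 + 1"
      using card_image_le[of "UNIV :: 5 set" "\<lambda>i. ?x i 1 + u"]
        card_image_le[of "{0, 1, 2, 3}" "\<lambda>i. ?x i 1 + v"] unfolding c4 
      by (intro add_mono) simp_all
    finally show ?thesis by simp
  qed
  show "card ?S2 \<le> 10"
  proof (rule bound[of _ "?x 4 1" "?x 3 1" "?x 2 2"], rule subsetI)
    fix m assume m: "m \<in> ?S2"
    have "lookup m 4 \<ge> 1 \<or> lookup m 4 = 0 \<and> lookup m 3 \<ge> 1 \<or> lookup m 2 \<ge> 2"
      using m by (auto simp: standard_def)
    then show "m \<in> (\<lambda>i. ?x i 1 + ?x 4 1) ` UNIV \<union> (\<lambda>i. ?x i 1 + ?x 3 1) ` {0, 1, 2, 3} \<union> {?x 2 2}"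
    proof (elim disjE)
      assume "lookup m 4 \<ge> 1"
      then obtain a where a: "m = a + ?x 4 1" "mon_deg m = mon_deg a + 1" by (rule mon_deg_split)
      then have "mon_deg a = 1" using m by simp
      then show ?thesis using mon_deg_eq_1 a by fastforce
    next
      assume l: "lookup m 4 = 0 \<and> lookup m 3 \<ge> 1"
      then obtain a where a: "m = a + ?x 3 1" "mon_deg m = mon_deg a + 1" using mon_deg_split by blast
      then have "mon_deg a = 1" using m by simp
      then obtain i where i: "a = ?x i 1" using mon_deg_eq_1 by blast
      have "i \<noteq> 4" using l a i by (auto simp: lookup_add lookup_single)
      then show ?thesis using not4[of i] a i by blast
    next
      assume "lookup m 2 \<ge> 2"
      then obtain a where a: "m = a + ?x 2 2" "mon_deg m = mon_deg a + 2" by (rule mon_deg_split)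
      then show ?thesis using m by (simp add: mon_deg_eq_0)
    qed
  qed
  show "card ?S3 \<le> 10"
  proof (rule bound[of _ "?x 4 2" "?x 3 1 + ?x 4 1" "?x 2 2 + ?x 4 1"], rule subsetI)
    fix m assume m: "m \<in> ?S3"
    have "lookup m 4 \<ge> 2 \<or> lookup m 4 = 1 \<and> lookup m 3 \<ge> 1 \<or> lookup m 4 = 1 \<and> lookup m 2 \<ge> 2"
      using m by (auto simp: standard_def)
    then show "m \<in> (\<lambda>i. ?x i 1 + ?x 4 2) ` UNIV \<union> (\<lambda>i. ?x i 1 + (?x 3 1 + ?x 4 1)) ` {0, 1, 2, 3} \<union>
        {?x 2 2 + ?x 4 1}"
    proof (elim disjE)
      assume "lookup m 4 \<ge> 2"
      then obtain a where a: "m = a + ?x 4 2" "mon_deg m = mon_deg a + 2" by (rule mon_deg_split)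
      then have "mon_deg a = 1" using m by simp
      then show ?thesis using mon_deg_eq_1 a by fastforce
    next
      assume l: "lookup m 4 = 1 \<and> lookup m 3 \<ge> 1"
      then obtain b where b: "m = b + ?x 4 1" "mon_deg m = mon_deg b + 1"
        using mon_deg_split[of 1 m 4] by auto
      then have "lookup b 3 \<ge> 1" using l by (simp add: lookup_add lookup_single)
      then obtain a where a: "b = a + ?x 3 1" "mon_deg b = mon_deg a + 1" by (rule mon_deg_split)
      then have "mon_deg a = 1" using m b by simp
      then obtain i where i: "a = ?x i 1" using mon_deg_eq_1 by blast
      have "i \<noteq> 4" using l a b i by (auto simp: lookup_add lookup_single)
      then have "i \<in> {0, 1, 2, 3}" by (rule not4)
      moreover have "m = ?x i 1 + (?x 3 1 + ?x 4 1)" using a b i by (simp add: add.assoc)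
      ultimately show ?thesis by blast
    next
      assume l: "lookup m 4 = 1 \<and> lookup m 2 \<ge> 2"
      then obtain b where b: "m = b + ?x 4 1" "mon_deg m = mon_deg b + 1"
        using mon_deg_split[of 1 m 4] by auto
      then have "lookup b 2 \<ge> 2" using l by (simp add: lookup_add lookup_single)
      then obtain a where a: "b = a + ?x 2 2" "mon_deg b = mon_deg a + 2" by (rule mon_deg_split)
      then show ?thesis using m b by (simp add: mon_deg_eq_0)
    qed
  qed
  show "card ?S4 \<le> 5"
  proof -
    have "?S4 \<subseteq> (\<lambda>i. ?x i 1 + ?x 4 3) ` UNIV"
    proof
      fix m assume m: "m \<in> ?S4"
      then have "lookup m 4 \<ge> 3" by (auto simp: standard_def)
      then obtain a where a: "m = a + ?x 4 3" "mon_deg m = mon_deg a + 3" by (rule mon_deg_split)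
      then have "mon_deg a = 1" using m by simp
      then show "m \<in> (\<lambda>i. ?x i 1 + ?x 4 3) ` UNIV" using mon_deg_eq_1 a by fastforce
    qed
    then have "card ?S4 \<le> card ((\<lambda>i. ?x i 1 + ?x 4 3) ` UNIV)" by (intro card_mono) auto
    also have "\<dots> \<le> 5" using card_image_le[of "UNIV :: 5 set" "\<lambda>i. ?x i 1 + ?x 4 3"] by simp
    finally show ?thesis .
  qed
  show "card ?S5 \<le> 1"
  proof -
    have "?S5 \<subseteq> {?x 4 5}"
    proof
      fix m assume m: "m \<in> ?S5"
      then have "lookup m 4 \<ge> 5" by (auto simp: standard_def)
      then obtain a where a: "m = a + ?x 4 5" "mon_deg m = mon_deg a + 5" by (rule mon_deg_split)
      then show "m \<in> {?x 4 5}" using m by (simp add: mon_deg_eq_0)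
    qed
    then have "card ?S5 \<le> card {?x 4 5}" by (intro card_mono) auto
    then show ?thesis by simp
  qed
qed

text \<open>These bounds are in fact equalities: the dimensions of the ideal of a complete intersection of
  five quadrics.\<close>

lemma card_nonstandard:
  "card {m. mon_deg m = 2 \<and> \<not> standard m} \<ge> 5"
  "card {m. mon_deg m = 3 \<and> \<not> standard m} \<ge> 25"
  "card {m. mon_deg m = 4 \<and> \<not> standard m} \<ge> 65"
  "card {m. mon_deg m = 5 \<and> \<not> standard m} \<ge> 125"
proof -
  have "card {m. mon_deg m = d \<and> \<not> standard m} + card {m. mon_deg m = d \<and> standard m} = (d + 4) choose d"
    for d
  proof -
    have "{m :: 5 monom. mon_deg m = d} = {m. mon_deg m = d \<and> \<not> standard m} \<union> {m. mon_deg m = d \<and> standard m}"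
      by auto
    moreover have "card ({m. mon_deg m = d \<and> \<not> standard m} \<union> {m. mon_deg m = d \<and> standard m}) =
        card {m. mon_deg m = d \<and> \<not> standard m} + card {m. mon_deg m = d \<and> standard m}"
      by (rule card_Un_disjoint) (auto intro: finite_subset[OF _ finite_mon_deg[of d]])
    ultimately show ?thesis using card_mon_deg[of d] by metis
  qed
  from this[of 2] this[of 3] this[of 4] this[of 5]
  show "card {m. mon_deg m = 2 \<and> \<not> standard m} \<ge> 5"
  "card {m. mon_deg m = 3 \<and> \<not> standard m} \<ge> 25"
  "card {m. mon_deg m = 4 \<and> \<not> standard m} \<ge> 65"
  "card {m. mon_deg m = 5 \<and> \<not> standard m} \<ge> 125"
    using card_standard by (simp_all add: eval_nat_numeral)
qed

section \<open>A spanning condition that determines the initial ideal\<close>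

text \<open>Modulo the ideal of \<open>g\<close>, every nonstandard monomial \<open>m\<close> of degree at most \<open>6\<close> is a combination of standard
  ones. The witness \<open>q\<close> may have arbitrary terms of degree above \<open>6\<close>, and the combination need not be
  homogeneous, which keeps the condition easy to establish; for forms \<open>g\<close>, passing to the component
  of degree \<open>mon_deg m\<close> repairs both.\<close>

definition spanning :: "(5 \<Rightarrow> (5, 'k::comm_ring_1) mpol) \<Rightarrow> bool" where
  "spanning g \<longleftrightarrow> (\<forall>m. \<not> standard m \<and> mon_deg m \<le> 6 \<longrightarrow>
     (\<exists>q\<in>ideal_of (g ` UNIV). \<forall>n\<in>keys (monomial m - q). mon_deg n \<le> 6 \<longrightarrow> standard n))"

lemma spanning_homogeneous:
  fixes g :: "5 \<Rightarrow> (5, 'k::comm_ring_1) mpol"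
  assumes "spanning g" and g: "\<And>i. homogeneous 2 (g i)"
    and m: "\<not> standard m" "mon_deg m \<le> 6"
  obtains h n where "\<And>i. homogeneous (mon_deg m - 2) (h i)"
    and "(\<Sum>i\<in>UNIV. h i * g i) = monomial m - n"
    and "homogeneous (mon_deg m) n" and "\<And>u. u \<in> keys n \<Longrightarrow> standard u"
proof -
  let ?d = "mon_deg m"
  obtain q where q: "q \<in> ideal_of (g ` UNIV)"
    and std: "\<And>n. n \<in> keys (monomial m - q) \<Longrightarrow> mon_deg n \<le> 6 \<Longrightarrow> standard n"
    using assms(1)[unfolded spanning_def, rule_format, of m] m by auto
  obtain h where h: "\<And>i. homogeneous (?d - 2) (h i)" "?d < 2 \<Longrightarrow> h = (\<lambda>_. 0)"
    "hom_comp ?d q = (\<Sum>i\<in>UNIV. h i * g i)"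
    by (rule hom_comp_ideal_of[OF q g, where d = ?d]) (rule that)
  define n where "n = hom_comp ?d (monomial m - q)"
  have "hom_comp ?d (monomial m :: (5, 'k) mpol) = monomial m"
    by (simp add: hom_comp_homogeneous[OF homogeneous_monomial])
  then have n: "(\<Sum>i\<in>UNIV. h i * g i) = monomial m - n"
    unfolding n_def hom_comp_diff h(3)[symmetric] by simp
  have n_hom: "homogeneous ?d n" unfolding n_def by (rule homogeneous_hom_comp)
  have n_std: "standard u" if "u \<in> keys n" for u
  proof -
    have "mon_deg u = ?d" "u \<in> keys (monomial m - q)"
      using that unfolding n_def by (simp_all add: in_keys_iff lookup_hom_comp split: if_splits)
    then show ?thesis using std[of u] m by simp
  qed
  show ?thesis by (rule that[OF h(1) n n_hom n_std])
qed

lemma spanning_initial: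
  fixes g :: "5 \<Rightarrow> (5, 'k::comm_ring_1) mpol"
  assumes "spanning g" and g: "\<And>i. homogeneous 2 (g i)"
    and m: "\<not> standard m" "mon_deg m \<le> 6"
  shows "\<exists>p\<in>ideal_of (g ` UNIV). is_initial_monom p m"
proof -
  obtain h n where "\<And>i. homogeneous (mon_deg m - 2) (h i)"
    and h: "(\<Sum>i\<in>UNIV. h i * g i) = monomial m - n"
    and n: "homogeneous (mon_deg m) n" "\<And>u. u \<in> keys n \<Longrightarrow> standard u"
    by (rule spanning_homogeneous[OF assms]) (rule that)
  have "monomial m - n \<in> ideal_of (g ` UNIV)"
    unfolding h[symmetric] by (rule ideal_of_imageI)
  moreover have "is_initial_monom (monomial m - n) m"
    unfolding is_initial_monom_def
  proof (intro conjI ballI impI)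
    have "m \<notin> keys n" using n(2) m(1) by blast
    then show "m \<in> keys (monomial m - n)"
      by (simp add: in_keys_iff lookup_minus lookup_monomial)
  next
    fix u assume "u \<in> keys (monomial m - n)" "u \<noteq> m"
    then have "u \<in> keys n" by (auto simp: in_keys_iff lookup_minus lookup_monomial)
    then show "revlex_less u m"
      using n m by (intro revlex_less_standard) (auto simp: homogeneous_def)
  qed
  ultimately show ?thesis by blast
qed

subsection \<open>Independence of the standard monomials\<close>

text \<open>A homogeneous linear system with more unknowns than equations has a nonzero solution.\<close>

lemma nontrivial_relation:
  fixes t :: "'x \<Rightarrow> 'b \<Rightarrow> 'k::field"
  assumes "finite B" "finite X" "card B < card X"
  shows "\<exists>c. (\<exists>x\<in>X. c x \<noteq> 0) \<and> (\<forall>b\<in>B. (\<Sum>x\<in>X. c x * t x b) = 0)"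
  using assms
proof (induction B arbitrary: X t rule: finite_induct)
  case empty
  then have "X \<noteq> {}" by auto
  then show ?case by (intro exI[of _ "\<lambda>_. 1"]) (simp add: ex_in_conv)
next
  case (insert b B)
  show ?case
  proof (cases "\<exists>x\<in>X. t x b \<noteq> 0")
    case False
    have "card B < card X" using insert.prems insert.hyps by simp
    from insert.IH[OF insert.prems(1) this, of t] obtain c
      where "(\<exists>x\<in>X. c x \<noteq> 0) \<and> (\<forall>b\<in>B. (\<Sum>x\<in>X. c x * t x b) = 0)" ..
    then show ?thesis using False by (intro exI[of _ c]) simp
  next
    case True
    then obtain y where y: "y \<in> X" "t y b \<noteq> 0" by blast
    let ?X = "X - {y}"
    let ?t = "\<lambda>x b'. t x b' - t x b / t y b * t y b'"
    have "card B < card ?X" using insert.prems insert.hyps y by simp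
    from insert.IH[OF finite_Diff[OF insert.prems(1)] this, of ?t]
    obtain c where "(\<exists>x\<in>?X. c x \<noteq> 0) \<and> (\<forall>b'\<in>B. (\<Sum>x\<in>?X. c x * ?t x b') = 0)" ..
    then have c: "\<exists>x\<in>?X. c x \<noteq> 0" "\<forall>b'\<in>B. (\<Sum>x\<in>?X. c x * ?t x b') = 0"
      by (rule conjunct1, rule conjunct2)
    define c' where "c' x = (if x = y then - (\<Sum>x\<in>?X. c x * (t x b / t y b)) else c x)" for x
    have split: "(\<Sum>x\<in>X. c' x * t x b') = (\<Sum>x\<in>?X. c x * ?t x b')" for b'
    proof -
      have "(\<Sum>x\<in>X. c' x * t x b') = c' y * t y b' + (\<Sum>x\<in>?X. c' x * t x b')"
        using insert.prems y by (intro sum.remove) auto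
      also have "(\<Sum>x\<in>?X. c' x * t x b') = (\<Sum>x\<in>?X. c x * t x b')"
        by (rule sum.cong) (auto simp: c'_def)
      also have "c' y * t y b' = - (\<Sum>x\<in>?X. c x * (t x b / t y b * t y b'))"
        unfolding c'_def sum_distrib_right[symmetric] mult.assoc[symmetric] by simp
      also have "- (\<Sum>x\<in>?X. c x * (t x b / t y b * t y b')) + (\<Sum>x\<in>?X. c x * t x b')
          = (\<Sum>x\<in>?X. c x * ?t x b')"
        unfolding right_diff_distrib sum_subtractf by (rule uminus_add_conv_diff)
      finally show ?thesis .
    qed
    have "(\<Sum>x\<in>X. c' x * t x b) = 0"
      unfolding split using y by (intro sum.neutral) auto
    moreover have "\<forall>b'\<in>B. (\<Sum>x\<in>X. c' x * t x b') = 0"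
      unfolding split by (rule c(2))
    moreover have "\<exists>x\<in>X. c' x \<noteq> 0"
      using c(1) by (auto simp: c'_def)
    ultimately show ?thesis by (intro exI[of _ c']) simp
  qed
qed

lemma nontrivial_relation_tuples:
  fixes T :: "'x \<Rightarrow> 5 \<Rightarrow> (5, 'k::field) mpol"
  assumes X: "finite X" "5 * card {m :: 5 monom. mon_deg m = e} < card X"
    and T: "\<And>x i. x \<in> X \<Longrightarrow> homogeneous e (T x i)"
  obtains c where "\<exists>x\<in>X. c x \<noteq> 0" and "\<And>i. (\<Sum>x\<in>X. Const (c x) * T x i) = 0"
proof -
  let ?B = "(UNIV :: 5 set) \<times> {m :: 5 monom. mon_deg m = e}"
  have "card ?B < card X" using X by (simp add: card_cartesian_product)
  moreover have "finite ?B" by (rule finite_cartesian_product[OF finite finite_mon_deg])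
  ultimately obtain c where c: "\<exists>x\<in>X. c x \<noteq> 0"
    "\<forall>b\<in>?B. (\<Sum>x\<in>X. c x * (case b of (i, m) \<Rightarrow> lookup (T x i) m)) = 0"
    using nontrivial_relation[of ?B X "\<lambda>x (i, m). lookup (T x i) m"] X by blast
  have "(\<Sum>x\<in>X. Const (c x) * T x i) = 0" for i
  proof (rule poly_mapping_eqI)
    fix m
    have "(\<Sum>x\<in>X. c x * lookup (T x i) m) = 0"
    proof (cases "mon_deg m = e")
      case True
      then show ?thesis using c(2)[rule_format, of "(i, m)"] by simp
    next
      case False
      then have "lookup (T x i) m = 0" if "x \<in> X" for x
        using T[OF that, of i] by (auto simp: homogeneous_def in_keys_iff)
      then show ?thesis by (intro sum.neutral) auto
    qed
    then show "lookup (\<Sum>x\<in>X. Const (c x) * T x i) m = lookup 0 m"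
      by (simp add: lookup_sum lookup_Const_mult)
  qed
  then show ?thesis using that c by blast
qed

text \<open>The Koszul syzygies \<open>n (g\<^sub>j e\<^sub>k - g\<^sub>k e\<^sub>j)\<close> with \<open>j < k\<close> and a monomial \<open>n\<close>, and their index
  set in the degree where the coefficient vectors have degree \<open>e\<close>.\<close>

definition koszul :: "(5 \<Rightarrow> (5, 'k::comm_ring_1) mpol) \<Rightarrow> (5 \<times> 5) \<times> 5 monom \<Rightarrow> 5 \<Rightarrow> (5, 'k) mpol" where
  "koszul g = (\<lambda>((j, k), n) i.
     if i = k then monomial n * g j else if i = j then - (monomial n * g k) else 0)"

definition koszul_index :: "nat \<Rightarrow> ((5 \<times> 5) \<times> 5 monom) set" where
  "koszul_index e = (if e < 2 then {} else {(j, k). j < k} \<times> {n. mon_deg n = e - 2})"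

lemma finite_koszul_index: "finite (koszul_index e)"
  by (simp add: koszul_index_def finite_cartesian_product finite_mon_deg)

lemma card_koszul_index: "e \<ge> 2 \<Longrightarrow> card (koszul_index e) = 10 * ((e + 2) choose (e - 2))"
proof -
  have "{(j, k :: 5). j < k} = {(0,1), (0,2), (0,3), (0,4), (1,2), (1,3), (1,4), (2,3), (2,4), (3,4)}"
    unfolding less_5_iff using exhaust_5 by auto
  then have "card {(j, k :: 5). j < k} = 10" by simp
  moreover assume "e \<ge> 2"
  moreover from this have "e - 2 + 4 = e + 2" by simp
  ultimately show ?thesis
    by (simp add: koszul_index_def card_cartesian_product card_mon_deg)
qed

lemma homogeneous_koszul:
  assumes "\<And>i. homogeneous 2 (g i)" "x \<in> koszul_index e"
  shows "homogeneous e (koszul g x i)"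
proof -
  obtain j k n where x: "x = ((j, k), n)" by (metis surj_pair)
  have e: "e = mon_deg n + 2"
    using assms(2) by (auto simp: koszul_index_def x split: if_splits)
  have "homogeneous e (monomial n * g l)" for l
    unfolding e by (intro homogeneous_mult homogeneous_monomial assms(1))
  then show ?thesis
    by (simp add: x koszul_def homogeneous_uminus)
qed

lemma koszul_syzygy:
  assumes "x \<in> koszul_index e"
  shows "(\<Sum>i\<in>UNIV. koszul g x i * g i) = 0"
proof -
  obtain j k n where x: "x = ((j, k), n)" by (metis surj_pair)
  have "j \<noteq> k" using assms by (auto simp: koszul_index_def x split: if_splits)
  then have "koszul g x i * g i = (if i = k then monomial n * g j * g k else 0)
      + (if i = j then - (monomial n * g k * g j) else 0)" for i
    by (cases "i = k"; cases "i = j") (simp_all add: koszul_def x)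
  then have "(\<Sum>i\<in>UNIV. koszul g x i * g i) = monomial n * g j * g k + - (monomial n * g k * g j)"
    by (simp only: sum.distrib sum.delta finite UNIV_I if_True)
  also have "\<dots> = 0" by (simp only: mult.assoc mult.commute[of "g j" "g k"] add.right_inverse)
  finally show ?thesis .
qed

text \<open>If there are no syzygies of degree \<open>e - 2\<close>, the Koszul syzygies of degree \<open>e\<close> are linearly
  independent: a relation between them is, in every coordinate, a syzygy of degree \<open>e - 2\<close>.\<close>

lemma koszul_independent:
  fixes g :: "5 \<Rightarrow> (5, 'k::field) mpol"
  assumes inj: "\<And>r. e \<ge> 2 \<Longrightarrow> (\<And>i. homogeneous (e - 2) (r i)) \<Longrightarrow>
      (\<Sum>i\<in>UNIV. r i * g i) = 0 \<Longrightarrow> r = (\<lambda>_. 0)"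
    and rel: "\<And>i. (\<Sum>x\<in>koszul_index e. Const (c x) * koszul g x i) = 0"
    and x: "x \<in> koszul_index e"
  shows "c x = 0"
proof -
  have e: "e \<ge> 2" using x by (auto simp: koszul_index_def split: if_splits)
  let ?M = "{n :: 5 monom. mon_deg n = e - 2}"
  obtain j i n where ji: "x = ((j, i), n)" "j < i" "n \<in> ?M"
    using x e by (auto simp: koszul_index_def split: if_splits)
  define a where "a j k = (\<Sum>n\<in>?M. Const (c ((j, k), n)) * monomial n)" for j k
  define r where "r l = (if l < i then a l i else 0) - (if i < l then a i l else 0)" for l
  have inner: "(\<Sum>n\<in>?M. Const (c ((j, k), n)) * koszul g ((j, k), n) i)
      = (if k = i then a j i * g j else 0) - (if j = i then a i k * g k else 0)" if "j < k" for j k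
  proof -
    have "j \<noteq> k" using that by simp
    then consider (1) "k = i" "j \<noteq> i" | (2) "j = i" "k \<noteq> i" | (3) "j \<noteq> i" "k \<noteq> i"
      by metis
    then show ?thesis
    proof cases
      case 1
      then have "koszul g ((j, k), n) i = monomial n * g j" for n
        by (simp add: koszul_def)
      then show ?thesis using 1 by (simp only: a_def sum_distrib_right mult.assoc simp_thms if_True if_False diff_0_right)
    next
      case 2
      then have "koszul g ((j, k), n) i = - (monomial n * g k)" for n
        by (simp add: koszul_def)
      then show ?thesis
        using 2 by (simp only: a_def sum_distrib_right mult.assoc simp_thms if_True if_False diff_0 mult_minus_right sum_negf)
    next
      case 3
      then have "koszul g ((j, k), n) i = 0" for n
        by (simp add: koszul_def)
      then show ?thesis using 3 by (simp only: mult_zero_right sum.neutral_const simp_thms if_False diff_self)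
    qed
  qed
  let ?P = "SIGMA j:UNIV. {k :: 5. j < k}"
  have "koszul_index e = ?P \<times> ?M"
    using e unfolding koszul_index_def by (simp add: Sigma_def) blast
  then have "(\<Sum>x\<in>koszul_index e. Const (c x) * koszul g x i)
      = (\<Sum>jk\<in>?P. \<Sum>n\<in>?M. Const (c (jk, n)) * koszul g (jk, n) i)"
    by (simp only: sum.cartesian_product case_prod_unfold prod.collapse)
  also have "\<dots> = (\<Sum>j\<in>UNIV. \<Sum>k\<in>{k. j < k}. \<Sum>n\<in>?M. Const (c ((j, k), n)) * koszul g ((j, k), n) i)"
    by (subst sum.Sigma) (simp_all add: case_prod_unfold)
  also have "\<dots> = (\<Sum>j\<in>UNIV. \<Sum>k\<in>{k. j < k}.
      (if k = i then a j i * g j else 0) - (if j = i then a i k * g k else 0))"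
    by (intro sum.cong refl inner) simp
  also have "\<dots> = (\<Sum>j\<in>UNIV. (if j < i then a j i * g j else 0)
      - (if j = i then (\<Sum>k\<in>{k. i < k}. a i k * g k) else 0))"
  proof (intro sum.cong refl)
    fix j
    show "(\<Sum>k\<in>{k. j < k}. (if k = i then a j i * g j else 0) - (if j = i then a i k * g k else 0))
        = (if j < i then a j i * g j else 0) - (if j = i then (\<Sum>k\<in>{k. i < k}. a i k * g k) else 0)"
      unfolding sum_subtractf by (cases "j = i") simp_all
  qed
  also have "\<dots> = (\<Sum>j\<in>UNIV. if j < i then a j i * g j else 0) - (\<Sum>k\<in>{k. i < k}. a i k * g k)"
    unfolding sum_subtractf by simp
  also have "(\<Sum>k\<in>{k. i < k}. a i k * g k) = (\<Sum>k\<in>UNIV. if i < k then a i k * g k else 0)"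
    by (simp add: sum.If_cases)
  also have "(\<Sum>j\<in>UNIV. if j < i then a j i * g j else 0) - \<dots> = (\<Sum>l\<in>UNIV. r l * g l)"
    unfolding sum_subtractf[symmetric] r_def left_diff_distrib by (intro sum.cong refl) simp
  finally have "(\<Sum>l\<in>UNIV. r l * g l) = 0" using rel[of i] by simp
  moreover have "homogeneous (e - 2) (r l)" for l
  proof -
    have "homogeneous (e - 2) (a j k)" for j k
    proof -
      have "homogeneous (e - 2) (monomial n :: (5, 'k) mpol)" if "n \<in> ?M" for n
        using homogeneous_monomial[of n] that by simp
      then show ?thesis
        unfolding a_def by (intro homogeneous_sum homogeneous_Const_mult)
    qed
    then show ?thesis by (simp add: r_def homogeneous_diff homogeneous_uminus)
  qed
  ultimately have "r = (\<lambda>_. 0)" by (intro inj[OF e])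
  then have "r j = 0" by simp
  then have "a j i = 0" using \<open>j < i\<close> by (simp add: r_def)
  then have "lookup (a j i) n = 0" by simp
  moreover have "lookup (a j i) n = (\<Sum>u\<in>?M. if u = n then c ((j, i), u) else 0)"
    unfolding a_def by (simp add: lookup_sum lookup_Const_mult lookup_monomial if_distrib cong: if_cong)
  moreover have "finite ?M" by (rule finite_mon_deg)
  ultimately show ?thesis using ji by simp
qed

text \<open>The dimension count: together with preimages of the nonstandard monomials of degree
  \<open>e + 2\<close>, the Koszul syzygies fill the whole space of coefficient vectors of degree \<open>e\<close>.\<close>

lemma standard_combination_koszul:
  fixes g :: "5 \<Rightarrow> (5, 'k::field) mpol"
  assumes sp: "spanning g" and g: "\<And>i. homogeneous 2 (g i)" and "e \<le> 4"
    and card: "5 * card {m :: 5 monom. mon_deg m = e}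
      \<le> card (koszul_index e) + card {m. mon_deg m = e + 2 \<and> \<not> standard m}"
    and inj: "\<And>r. e \<ge> 2 \<Longrightarrow> (\<And>i. homogeneous (e - 2) (r i)) \<Longrightarrow>
      (\<Sum>i\<in>UNIV. r i * g i) = 0 \<Longrightarrow> r = (\<lambda>_. 0)"
    and q: "\<And>i. homogeneous e (q i)"
    and std: "\<And>m. m \<in> keys (\<Sum>i\<in>UNIV. q i * g i) \<Longrightarrow> standard m"
  shows "\<exists>c. \<forall>i. q i = (\<Sum>x\<in>koszul_index e. Const (c x) * koszul g x i)"
proof -
  let ?J = "{m. mon_deg m = e + 2 \<and> \<not> standard m}"
  have "\<forall>m\<in>?J. \<exists>h. (\<forall>i. homogeneous e (h i)) \<and> (\<exists>n. (\<Sum>i\<in>UNIV. h i * g i) = monomial m - n \<and>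
      (\<forall>u\<in>keys n. standard u))"
  proof
    fix m assume m: "m \<in> ?J"
    then have "\<not> standard m" "mon_deg m \<le> 6" using \<open>e \<le> 4\<close> by auto
    then obtain h n where h: "\<And>i. homogeneous (mon_deg m - 2) (h i)"
      "(\<Sum>i\<in>UNIV. h i * g i) = monomial m - n"
      "homogeneous (mon_deg m) n" "\<And>u. u \<in> keys n \<Longrightarrow> standard u"
      by (rule spanning_homogeneous[OF sp g]) (rule that)
    show "\<exists>h. (\<forall>i. homogeneous e (h i)) \<and> (\<exists>n. (\<Sum>i\<in>UNIV. h i * g i) = monomial m - n \<and>
      (\<forall>u\<in>keys n. standard u))"
      by (intro exI[of _ h] exI[of _ n] conjI allI ballI) (use h m in auto)
  qed
  from bchoice[OF this] obtain s where s: "\<And>m i. m \<in> ?J \<Longrightarrow> homogeneous e (s m i)"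
    and s_n: "\<And>m. m \<in> ?J \<Longrightarrow> \<exists>n. (\<Sum>i\<in>UNIV. s m i * g i) = monomial m - n \<and> (\<forall>u\<in>keys n. standard u)"
    by blast
  \<comment> \<open>The Koszul syzygies, the preimages \<open>s m\<close> and \<open>q\<close> are too many vectors to be independent.\<close>
  define X where "X = koszul_index e <+> insert None (Some ` ?J)"
  define T where "T x = (case x of Inl y \<Rightarrow> koszul g y | Inr None \<Rightarrow> q | Inr (Some m) \<Rightarrow> s m)" for x
  have finJ: "finite ?J" by (rule finite_subset[OF _ finite_mon_deg[of "e + 2"]]) auto
  have finX: "finite X" unfolding X_def using finJ finite_koszul_index by simp
  have cardX: "5 * card {m :: 5 monom. mon_deg m = e} < card X"
    unfolding X_def using card finJ
    by (simp add: card_Plus finite_koszul_index card_image)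
  have homT: "homogeneous e (T x i)" if "x \<in> X" for x i
    using that q s homogeneous_koszul[of g, OF g] unfolding X_def T_def by auto
  obtain c where nz: "\<exists>x\<in>X. c x \<noteq> 0" and rel: "\<And>i. (\<Sum>x\<in>X. Const (c x) * T x i) = 0"
    by (rule nontrivial_relation_tuples[OF finX cardX homT]) (assumption, rule that)
  define K where "K i = (\<Sum>y\<in>koszul_index e. Const (c (Inl y)) * koszul g y i)" for i
  define cN where "cN = c (Inr None)"
  define cJ where "cJ m = c (Inr (Some m))" for m
  have rel': "K i + (Const cN * q i + (\<Sum>m\<in>?J. Const (cJ m) * s m i)) = 0" for i
    using rel[of i] finJ unfolding X_def T_def
    by (simp add: sum.Plus finite_koszul_index K_def cN_def cJ_def sum.reindex)
  have K0: "(\<Sum>i\<in>UNIV. K i * g i) = 0"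
  proof -
    have "(\<Sum>i\<in>UNIV. K i * g i)
        = (\<Sum>y\<in>koszul_index e. Const (c (Inl y)) * (\<Sum>i\<in>UNIV. koszul g y i * g i))"
      unfolding K_def sum_distrib_right sum_distrib_left mult.assoc by (rule sum.swap)
    also have "\<dots> = 0" by (intro sum.neutral ballI) (simp add: koszul_syzygy[where e = e])
    finally show ?thesis .
  qed
  have "(\<Sum>i\<in>UNIV. (K i + (Const cN * q i + (\<Sum>m\<in>?J. Const (cJ m) * s m i))) * g i)
      = (\<Sum>i\<in>UNIV. K i * g i) + (Const cN * (\<Sum>i\<in>UNIV. q i * g i)
        + (\<Sum>i\<in>UNIV. \<Sum>m\<in>?J. Const (cJ m) * (s m i * g i)))"
    unfolding distrib_right sum.distrib sum_distrib_left sum_distrib_right mult.assoc ..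
  also have "(\<Sum>i\<in>UNIV. \<Sum>m\<in>?J. Const (cJ m) * (s m i * g i))
      = (\<Sum>m\<in>?J. Const (cJ m) * (\<Sum>i\<in>UNIV. s m i * g i))"
    unfolding sum_distrib_left by (rule sum.swap)
  finally have eq: "Const cN * (\<Sum>i\<in>UNIV. q i * g i) + (\<Sum>m\<in>?J. Const (cJ m) * (\<Sum>i\<in>UNIV. s m i * g i)) = 0"
    unfolding rel' K0 by simp
  have cJ: "cJ m = 0" if m: "m \<in> ?J" for m
  proof -
    have "lookup (\<Sum>i\<in>UNIV. s u i * g i) m = (if u = m then 1 else 0)" if u: "u \<in> ?J" for u
    proof -
      obtain n where n: "(\<Sum>i\<in>UNIV. s u i * g i) = monomial u - n" "\<forall>v\<in>keys n. standard v"
        using s_n[OF u] by (elim exE conjE) (rule that)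
      have "m \<notin> keys n" using n(2) m by blast
      then show ?thesis using n(1) by (simp add: lookup_minus lookup_monomial in_keys_iff)
    qed
    moreover have "lookup (\<Sum>i\<in>UNIV. q i * g i) m = 0"
      using std[of m] m by (auto simp: in_keys_iff)
    ultimately have "lookup (Const cN * (\<Sum>i\<in>UNIV. q i * g i)
        + (\<Sum>m\<in>?J. Const (cJ m) * (\<Sum>i\<in>UNIV. s m i * g i))) m = (\<Sum>u\<in>?J. cJ u * (if u = m then 1 else 0))"
      unfolding lookup_add lookup_sum lookup_Const_mult by simp
    also have "\<dots> = cJ m" using finJ m by (simp add: if_distrib cong: if_cong)
    finally show ?thesis unfolding eq by simp
  qed
  \<comment> \<open>A relation that does not involve \<open>q\<close> would be one between the Koszul syzygies.\<close>
  have rel'': "K i + Const cN * q i = 0" for i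
  proof -
    have "(\<Sum>m\<in>?J. Const (cJ m) * s m i) = 0" by (intro sum.neutral ballI) (simp add: cJ)
    then show ?thesis using rel'[of i] by simp
  qed
  have "cN \<noteq> 0"
  proof
    assume "cN = 0"
    then have K_0: "(\<Sum>y\<in>koszul_index e. Const (c (Inl y)) * koszul g y i) = 0" for i
      using rel''[of i] by (simp add: K_def)
    have "c (Inl y) = 0" if "y \<in> koszul_index e" for y
      using inj K_0 that by (rule koszul_independent[where e = e and g = g and c = "\<lambda>y. c (Inl y)"])
    then have "c x = 0" if "x \<in> X" for x
      using that \<open>cN = 0\<close> cJ unfolding X_def cN_def cJ_def by auto
    then show False using nz by blast
  qed
  show ?thesis
  proof (intro exI[of _ "\<lambda>y. - (c (Inl y) / cN)"] allI)
    fix i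
    have "Const (1 / cN) * (K i + Const cN * q i) = Const (1 / cN) * K i + Const (1 / cN * cN) * q i"
      by (simp only: distrib_left Const_mult mult.assoc)
    then have "Const (1 / cN) * K i + q i = 0"
      unfolding rel'' using \<open>cN \<noteq> 0\<close> by simp
    then have "q i = - (Const (1 / cN) * K i)"
      by (metis add.commute eq_neg_iff_add_eq_0)
    also have "\<dots> = (\<Sum>y\<in>koszul_index e. - (Const (1 / cN) * (Const (c (Inl y)) * koszul g y i)))"
      unfolding K_def sum_distrib_left sum_negf ..
    also have "\<dots> = (\<Sum>y\<in>koszul_index e. Const (- (c (Inl y) / cN)) * koszul g y i)"
    proof (intro sum.cong refl)
      fix y
      have "(Const (- (c (Inl y) / cN)) :: (5, 'k) mpol) = - (Const (1 / cN) * Const (c (Inl y)))"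
        by (simp flip: Const_mult Const_uminus)
      then show "- (Const (1 / cN) * (Const (c (Inl y)) * koszul g y i))
          = Const (- (c (Inl y) / cN)) * koszul g y i"
        by (simp only: mult.assoc mult_minus_left)
    qed
    finally show "q i = (\<Sum>y\<in>koszul_index e. Const (- (c (Inl y) / cN)) * koszul g y i)" .
  qed
qed

text \<open>Degrees \<open>0\<close> and \<open>1\<close> have no Koszul syzygies, hence no syzygies at all; this is the injectivity needed in
  degrees \<open>2\<close> and \<open>3\<close>.\<close>

lemma no_standard_combination:
  fixes g :: "5 \<Rightarrow> (5, 'k::field) mpol"
  assumes sp: "spanning g" and g: "\<And>i. homogeneous 2 (g i)" and e: "e \<le> 3"
    and q: "\<And>i. homogeneous e (q i)"
    and std: "\<And>m. m \<in> keys (\<Sum>i\<in>UNIV. q i * g i) \<Longrightarrow> standard m"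
  shows "(\<Sum>i\<in>UNIV. q i * g i) = 0"
proof -
  have card: "5 * card {m :: 5 monom. mon_deg m = e}
      \<le> card (koszul_index e) + card {m. mon_deg m = e + 2 \<and> \<not> standard m}" if "e \<le> 3" for e
  proof -
    have "e = 0 \<or> e = 1 \<or> e = 2 \<or> e = 3" using that by linarith
    then show ?thesis
      using card_nonstandard card_koszul_index[of 2] card_koszul_index[of 3]
      by (elim disjE) (simp_all add: card_mon_deg eval_nat_numeral)
  qed
  have inj: "r = (\<lambda>_. 0)" if "e < 2" "\<And>i. homogeneous e (r i)" "(\<Sum>i\<in>UNIV. r i * g i) = 0" for e r
  proof -
    have "\<exists>c. \<forall>i. r i = (\<Sum>x\<in>koszul_index e. Const (c x) * koszul g x i)"
      by (rule standard_combination_koszul[OF sp g]) (use that card in auto)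
    then show ?thesis using that(1) by (auto simp: koszul_index_def)
  qed
  have "\<exists>c. \<forall>i. q i = (\<Sum>x\<in>koszul_index e. Const (c x) * koszul g x i)"
    by (rule standard_combination_koszul[OF sp g _ _ _ q std]) (use e card inj[of "e - 2"] in auto)
  then obtain c where "\<And>i. q i = (\<Sum>x\<in>koszul_index e. Const (c x) * koszul g x i)" by blast
  then have "(\<Sum>i\<in>UNIV. q i * g i)
      = (\<Sum>x\<in>koszul_index e. Const (c x) * (\<Sum>i\<in>UNIV. koszul g x i * g i))"
    unfolding sum_distrib_left mult.assoc[symmetric]
    by (subst sum.swap) (simp add: sum_distrib_right)
  also have "\<dots> = 0" by (intro sum.neutral ballI) (simp add: koszul_syzygy[where e = e])
  finally show ?thesis .
qed

lemma initial_monom_nonstandard: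
  fixes g :: "5 \<Rightarrow> (5, 'k::field) mpol"
  assumes sp: "spanning g" and g: "\<And>i. homogeneous 2 (g i)"
    and p: "p \<in> ideal_of (g ` UNIV)" "is_initial_monom p m"
  shows "\<not> standard m"
proof
  assume m: "standard m"
  let ?d = "mon_deg m"
  have d: "?d \<le> 5" using m by (auto simp: standard_def)
  obtain h where h: "\<And>i. homogeneous (?d - 2) (h i)" "?d < 2 \<Longrightarrow> h = (\<lambda>_. 0)"
    "hom_comp ?d p = (\<Sum>i\<in>UNIV. h i * g i)"
    by (rule hom_comp_ideal_of[OF p(1) g, where d = ?d]) (rule that)
  have "standard u" if "u \<in> keys (\<Sum>i\<in>UNIV. h i * g i)" for u
  proof (rule ccontr)
    assume u: "\<not> standard u"
    have "u \<in> keys p" "mon_deg u = ?d"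
      using that unfolding h(3)[symmetric] by (auto simp: in_keys_iff lookup_hom_comp split: if_splits)
    then have "revlex_less u m" using p(2) u m unfolding is_initial_monom_def by metis
    moreover have "revlex_less m u"
      using revlex_less_standard[OF u m] \<open>mon_deg u = ?d\<close> by simp
    ultimately show False using revlex_less_asym by blast
  qed
  then have "(\<Sum>i\<in>UNIV. h i * g i) = 0"
    by (intro no_standard_combination[OF sp g _ h(1)]) (use d in auto)
  then have "lookup (hom_comp ?d p) m = 0" using h(3) by simp
  then show False using p(2) by (simp add: lookup_hom_comp is_initial_monom_def in_keys_iff)
qed

theorem initial_ideal_spanning:
  fixes g :: "5 \<Rightarrow> (5, 'k::field) mpol"
  assumes sp: "spanning g" and g: "\<And>i. homogeneous 2 (g i)"
  shows "initial_ideal (ideal_of (g ` UNIV)) = gin_ideal"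
proof
  show "initial_ideal (ideal_of (g ` UNIV)) \<subseteq> gin_ideal"
  proof -
    have "{monomial m |m. \<exists>p\<in>ideal_of (g ` UNIV). is_initial_monom p m} \<subseteq> gin_ideal"
      using initial_monom_nonstandard[OF sp g] monomial_in_gin_ideal by blast
    then show ?thesis unfolding initial_ideal_def gin_ideal_def by (rule ideal_of_subset)
  qed
  show "gin_ideal \<subseteq> initial_ideal (ideal_of (g ` UNIV))"
    unfolding initial_ideal_def gin_ideal_def
    using spanning_initial[OF sp g] gin_gens_nonstandard by (intro ideal_of_mono) blast
qed

section \<open>Polynomial families and the openness of the spanning condition\<close>

text \<open>Sets closed under sums and scalars: linear subspaces, or empty.\<close>

definition linearly_closed :: "('i, 'k::comm_ring_1) mpol set \<Rightarrow> bool" where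
  "linearly_closed W \<longleftrightarrow> (\<forall>p\<in>W. \<forall>q\<in>W. p + q \<in> W) \<and> (\<forall>c. \<forall>p\<in>W. Const c * p \<in> W)"

lemma linearly_closed_add: "linearly_closed W \<Longrightarrow> p \<in> W \<Longrightarrow> q \<in> W \<Longrightarrow> p + q \<in> W"
  and linearly_closed_scale: "linearly_closed W \<Longrightarrow> p \<in> W \<Longrightarrow> Const c * p \<in> W"
  by (simp_all add: linearly_closed_def)

lemma linearly_closed_0:
  assumes "linearly_closed W" "p \<in> W"
  shows "0 \<in> W"
  using linearly_closed_scale[OF assms, of 0] by simp

lemma linearly_closed_sum:
  assumes "linearly_closed W" "p \<in> W" "finite A" "\<And>x. x \<in> A \<Longrightarrow> h x \<in> W"
  shows "p + sum h A \<in> W"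
  using assms(3,4)
proof (induction A rule: finite_induct)
  case empty
  then show ?case using assms(2) by simp
next
  case (insert x A)
  have "(p + sum h A) + h x \<in> W"
    by (rule linearly_closed_add[OF assms(1)]) (simp_all add: insert)
  then show ?case using insert.hyps by (simp add: ac_simps)
qed

text \<open>The rows \<open>E x\<close> of a square matrix generate all unit vectors. This is stated for the combinations
  with these coefficients of arbitrary polynomials \<open>b y\<close>: a linear subspace that contains the
  combinations contains every \<open>b y\<close>.\<close>

definition solvable :: "'x set \<Rightarrow> ('x \<Rightarrow> 'x \<Rightarrow> 'k::comm_ring_1) \<Rightarrow> bool" where
  "solvable X E \<longleftrightarrow> (\<forall>W (b :: 'x \<Rightarrow> (5, 'k) mpol). linearly_closed W \<longrightarrow>
     (\<forall>x\<in>X. (\<Sum>y\<in>X. Const (E x y) * b y) \<in> W) \<longrightarrow> (\<forall>y\<in>X. b y \<in> W))"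

lemma solvableD:
  fixes b :: "'x \<Rightarrow> (5, 'k::comm_ring_1) mpol"
  assumes "solvable X E" "linearly_closed W" "\<And>x. x \<in> X \<Longrightarrow> (\<Sum>y\<in>X. Const (E x y) * b y) \<in> W" "y \<in> X"
  shows "b y \<in> W"
  using assms by (simp add: solvable_def)

lemma elim_identity: "p * s + - q * r = p * (q * x + s) + - q * (p * x + r)"
  for p :: "'a::comm_ring_1"
proof -
  have "p * (q * x + s) + - q * (p * x + r) = p * (q * x) + p * s - (p * (q * x) + q * r)"
    unfolding distrib_left mult_minus_left mult.left_commute[of q p x] by simp
  then show ?thesis by simp
qed

text \<open>One step of Gaussian elimination with pivot \<open>E x x\<close>.\<close>

lemma solvable_insert:
  fixes E :: "'x \<Rightarrow> 'x \<Rightarrow> 'k::field"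
  assumes X: "finite X" "x \<notin> X" and pivot: "E x x \<noteq> 0"
    and IH: "solvable X (\<lambda>y z. E x x * E y z - E y x * E x z)"
  shows "solvable (insert x X) E"
  unfolding solvable_def
proof (intro allI impI)
  fix W and b :: "'x \<Rightarrow> (5, 'k) mpol"
  assume W: "linearly_closed W"
    and rows: "\<forall>y\<in>insert x X. (\<Sum>z\<in>insert x X. Const (E y z) * b z) \<in> W"
  define rest where "rest y = (\<Sum>z\<in>X. Const (E y z) * b z)" for y
  define row where "row y = Const (E y x) * b x + rest y" for y
  have rowW: "row y \<in> W" if "y \<in> insert x X" for y
    using rows[rule_format, OF that] X by (simp add: row_def rest_def)
  have bX: "b y' \<in> W" if "y' \<in> X" for y'
  proof (rule solvableD[OF IH W _ that])
    fix y assume "y \<in> X"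
    have "Const (E x x * E y z - E y x * E x z) * b z
        = Const (E x x) * (Const (E y z) * b z) + Const (- E y x) * (Const (E x z) * b z)" for z
      unfolding diff_conv_add_uminus Const_add minus_mult_left Const_mult
      by (simp only: distrib_right mult.assoc)
    then have "(\<Sum>z\<in>X. Const (E x x * E y z - E y x * E x z) * b z)
        = Const (E x x) * rest y + Const (- E y x) * rest x"
      by (simp only: sum.distrib sum_distrib_left rest_def)
    also have "\<dots> = Const (E x x) * row y + Const (- E y x) * row x"
      unfolding row_def Const_uminus by (rule elim_identity)
    also have "\<dots> \<in> W"
      using \<open>y \<in> X\<close> by (intro linearly_closed_add[OF W] linearly_closed_scale[OF W] rowW) simp_all
    finally show "(\<Sum>z\<in>X. Const (E x x * E y z - E y x * E x z) * b z) \<in> W" .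
  qed
  have "b x \<in> W"
  proof -
    have "row x + (\<Sum>z\<in>X. Const (- E x z) * b z) \<in> W"
      by (intro linearly_closed_sum[OF W] rowW X linearly_closed_scale[OF W]) (simp_all add: bX)
    also have "row x + (\<Sum>z\<in>X. Const (- E x z) * b z) = Const (E x x) * b x"
    proof -
      have "(\<Sum>z\<in>X. Const (- E x z) * b z) = - rest x"
        unfolding rest_def by (simp add: Const_uminus sum_negf)
      then show ?thesis by (simp add: row_def)
    qed
    finally have "Const (1 / E x x) * (Const (E x x) * b x) \<in> W"
      by (rule linearly_closed_scale[OF W])
    then show ?thesis using pivot by (simp flip: mult.assoc Const_mult)
  qed
  with bX show "\<forall>y\<in>insert x X. b y \<in> W" by simp
qed

text \<open>A ring of scalar functions on a set \<open>D\<close> of parameters, closed under changing values outside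
  \<open>D\<close>: it stands for the polynomial functions on \<open>D\<close> in whatever coordinates are at hand.\<close>

locale function_ring =
  fixes R :: "('a \<Rightarrow> 'k::field) set" and D :: "'a set"
  assumes const [intro]: "(\<lambda>_. c) \<in> R"
    and add [intro]: "u \<in> R \<Longrightarrow> v \<in> R \<Longrightarrow> (\<lambda>a. u a + v a) \<in> R"
    and mult [intro]: "u \<in> R \<Longrightarrow> v \<in> R \<Longrightarrow> (\<lambda>a. u a * v a) \<in> R"
    and cong: "u \<in> R \<Longrightarrow> (\<And>a. a \<in> D \<Longrightarrow> u a = v a) \<Longrightarrow> v \<in> R"
begin

lemma diff: "u \<in> R \<Longrightarrow> v \<in> R \<Longrightarrow> (\<lambda>a. u a - v a) \<in> R"
  using add[of u "\<lambda>a. - 1 * v a"] mult[OF const[of "- 1"], of v] by simp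

lemma sum: "(\<And>x. x \<in> A \<Longrightarrow> u x \<in> R) \<Longrightarrow> (\<lambda>a. \<Sum>x\<in>A. u x a) \<in> R"
  by (induction A rule: infinite_finite_induct) auto

text \<open>Families of polynomials all of whose coefficients, as functions of the parameter, lie in \<open>R\<close>.\<close>

definition family :: "('a \<Rightarrow> ('i, 'k) mpol) \<Rightarrow> bool" where
  "family P \<longleftrightarrow> (\<forall>m. (\<lambda>a. lookup (P a) m) \<in> R)"

lemma family_const: "family (\<lambda>_. p)"
  by (auto simp: family_def)

lemma family_Const: "u \<in> R \<Longrightarrow> family (\<lambda>a. Const (u a) :: ('i, 'k) mpol)"
proof -
  assume u: "u \<in> R"
  have "(\<lambda>a. lookup (Const (u a)) m) = (if m = 0 then u else (\<lambda>_. 0))" for m :: "'i monom"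
    by (auto simp: Const_def lookup_single when_def)
  then show ?thesis using u by (auto simp: family_def)
qed

lemma family_add: "family P \<Longrightarrow> family Q \<Longrightarrow> family (\<lambda>a. P a + Q a)"
  by (auto simp: family_def lookup_add)

lemma family_sum: "(\<And>x. x \<in> A \<Longrightarrow> family (P x)) \<Longrightarrow> family (\<lambda>a. \<Sum>x\<in>A. P x a)"
  by (induction A rule: infinite_finite_induct) (auto intro: family_add family_const)

lemma family_mult:
  fixes P Q :: "'a \<Rightarrow> ('i::finite, 'k) mpol"
  assumes "family P" "family Q"
  shows "family (\<lambda>a. P a * Q a)"
proof -
  have "(\<lambda>a. \<Sum>x | fst x + snd x = m. lookup (P a) (fst x) * lookup (Q a) (snd x)) \<in> R" for m
    using assms by (intro sum mult) (auto simp: family_def)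
  then show ?thesis
    by (simp add: family_def lookup_mult_antidiagonal case_prod_unfold)
qed

lemma family_power:
  fixes P :: "'a \<Rightarrow> ('i::finite, 'k) mpol"
  shows "family P \<Longrightarrow> family (\<lambda>a. P a ^ n)"
  by (induction n) (auto intro: family_mult family_const)

lemma family_prod:
  fixes P :: "'x \<Rightarrow> 'a \<Rightarrow> ('i::finite, 'k) mpol"
  shows "(\<And>x. x \<in> A \<Longrightarrow> family (P x)) \<Longrightarrow> family (\<lambda>a. \<Prod>x\<in>A. P x a)"
  by (induction A rule: infinite_finite_induct) (auto intro: family_mult family_const)

lemma family_lin_change:
  fixes f :: "'a \<Rightarrow> ('n::finite, 'k) mpol"
  assumes A: "\<And>i j. (\<lambda>a. A a $ i $ j) \<in> R" and f: "family f"
    and hom: "\<And>a. a \<in> D \<Longrightarrow> homogeneous d (f a)"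
  shows "family (\<lambda>a. lin_change (A a) (f a))"
proof -
  let ?M = "{m :: 'n monom. mon_deg m = d}"
  define F where "F a = (\<Sum>m\<in>?M. Const (lookup (f a) m) *
    (\<Prod>j\<in>UNIV. (\<Sum>i\<in>UNIV. Const (A a $ i $ j) * Var i) ^ lookup m j))" for a
  have F: "family F"
    unfolding F_def using A f
    by (intro family_sum family_mult family_prod family_power family_Const family_const)
      (auto simp: family_def)
  have eq: "lin_change (A a) (f a) = F a" if "a \<in> D" for a
  proof -
    have "f a = (\<Sum>m\<in>?M. Const (lookup (f a) m) * monomial m)"
      using hom[OF that] by (intro mpol_expand_superset finite_mon_deg) (auto simp: homogeneous_def)
    then have "lin_change (A a) (f a) = lin_change (A a) (\<Sum>m\<in>?M. Const (lookup (f a) m) * monomial m)"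
      by (rule arg_cong)
    also have "\<dots> = F a"
      by (simp only: F_def lin_change_sum lin_change_Const_mult lin_change_monomial lin_change_Var)
    finally show ?thesis .
  qed
  show ?thesis
    unfolding family_def
  proof
    fix m
    show "(\<lambda>a. lookup (lin_change (A a) (f a)) m) \<in> R"
      by (rule cong[of "\<lambda>a. lookup (F a) m"]) (use F eq in \<open>auto simp: family_def\<close>)
  qed
qed

text \<open>Gaussian elimination with parameters: a square matrix over the function ring that is the
  identity at one parameter is solvable wherever a single function, the product of the successive
  pivots, does not vanish.\<close>

lemma generic_elimination:
  fixes E :: "'a \<Rightarrow> 'x \<Rightarrow> 'x \<Rightarrow> 'k"
  assumes "finite X" and "\<And>x y. (\<lambda>a. E a x y) \<in> R"
    and "\<And>x y. x \<in> X \<Longrightarrow> y \<in> X \<Longrightarrow> E a0 x y = (if x = y then 1 else 0)"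
  shows "\<exists>u\<in>R. u a0 \<noteq> 0 \<and> (\<forall>a. u a \<noteq> 0 \<longrightarrow> solvable X (E a))"
  using assms
proof (induction X arbitrary: E rule: finite_induct)
  case empty
  show ?case by (rule bexI[of _ "\<lambda>_. 1"]) (auto simp: solvable_def)
next
  case (insert x X)
  define E' where "E' a y z = E a x x * E a y z - E a y x * E a x z" for a y z
  have "\<exists>u\<in>R. u a0 \<noteq> 0 \<and> (\<forall>a. u a \<noteq> 0 \<longrightarrow> solvable X (E' a))"
  proof (rule insert.IH)
    show "(\<lambda>a. E' a y z) \<in> R" for y z
      unfolding E'_def by (intro diff mult insert.prems(1))
    show "E' a0 y z = (if y = z then 1 else 0)" if "y \<in> X" "z \<in> X" for y z
    proof -
      have "y \<noteq> x" "z \<noteq> x" using that insert.hyps by auto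
      then show ?thesis using that insert.prems(2) by (simp add: E'_def)
    qed
  qed
  then obtain u where u: "u \<in> R" "u a0 \<noteq> 0" "\<forall>a. u a \<noteq> 0 \<longrightarrow> solvable X (E' a)"
    by (elim bexE conjE) (rule that)
  show ?case
  proof (rule bexI[of _ "\<lambda>a. E a x x * u a"], intro conjI allI impI)
    show "(\<lambda>a. E a x x * u a) \<in> R" by (intro mult insert.prems(1) u)
    show "E a0 x x * u a0 \<noteq> 0" using u insert.prems(2)[of x x] by simp
  next
    fix a assume "E a x x * u a \<noteq> 0"
    then have "E a x x \<noteq> 0" "solvable X (E' a)" using u(3) by simp_all
    then show "solvable (insert x X) (E a)"
      unfolding E'_def by (rule solvable_insert[OF insert.hyps])
  qed
qed

text \<open>The representations \<open>q\<close> of the nonstandard monomials at \<open>a0\<close> are deformed by keeping their coefficients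
  \<open>h\<close> on the generators constant; their coordinates at nonstandard monomials form a matrix that is the
  identity at \<open>a0\<close>.\<close>

lemma spanning_open:
  fixes G :: "'a \<Rightarrow> 5 \<Rightarrow> (5, 'k) mpol"
  assumes G: "\<And>i. family (\<lambda>a. G a i)" and sp: "spanning (G a0)"
  obtains u where "u \<in> R" "u a0 \<noteq> 0" "\<And>a. u a \<noteq> 0 \<Longrightarrow> spanning (G a)"
proof -
  define X where "X = {m :: 5 monom. \<not> standard m \<and> mon_deg m \<le> 6}"
  have "\<forall>m\<in>X. \<exists>h. \<forall>n\<in>keys (monomial m - (\<Sum>i\<in>UNIV. h i * G a0 i)). mon_deg n \<le> 6 \<longrightarrow> standard n"
  proof
    fix m assume "m \<in> X"
    then have "\<exists>q\<in>ideal_of (G a0 ` UNIV). \<forall>n\<in>keys (monomial m - q). mon_deg n \<le> 6 \<longrightarrow> standard n"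
      using sp unfolding spanning_def X_def by simp
    then obtain q where q: "q \<in> ideal_of (G a0 ` UNIV)"
      "\<forall>n\<in>keys (monomial m - q). mon_deg n \<le> 6 \<longrightarrow> standard n"
      by (elim bexE) (rule that)
    from q(1) obtain h where "q = (\<Sum>i\<in>UNIV. h i * G a0 i)" unfolding ideal_of_image ..
    with q(2) show "\<exists>h. \<forall>n\<in>keys (monomial m - (\<Sum>i\<in>UNIV. h i * G a0 i)). mon_deg n \<le> 6 \<longrightarrow> standard n"
      by (intro exI[of _ h]) simp
  qed
  from bchoice[OF this] obtain h where
    h: "\<forall>m\<in>X. \<forall>n\<in>keys (monomial m - (\<Sum>i\<in>UNIV. h m i * G a0 i)). mon_deg n \<le> 6 \<longrightarrow> standard n" ..
  define q where "q a m = (\<Sum>i\<in>UNIV. h m i * G a i)" for a m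
  define E where "E a m n = lookup (q a m) n" for a m n
  have finX: "finite X"
    unfolding X_def by (rule finite_subset[OF _ finite_mon_deg_le[of 6]]) auto
  have ER: "(\<lambda>a. E a m n) \<in> R" for m n
  proof -
    have "family (\<lambda>a. q a m)"
      unfolding q_def by (intro family_sum family_mult family_const G)
    then show ?thesis unfolding E_def family_def ..
  qed
  have E0: "E a0 m n = (if m = n then 1 else 0)" if "m \<in> X" "n \<in> X" for m n
  proof -
    have "n \<notin> keys (monomial m - q a0 m)"
      using h[rule_format, OF that(1), of n] that(2) unfolding q_def X_def by auto
    then show ?thesis by (simp add: E_def in_keys_iff lookup_minus lookup_monomial)
  qed
  have "\<exists>u\<in>R. u a0 \<noteq> 0 \<and> (\<forall>a. u a \<noteq> 0 \<longrightarrow> solvable X (E a))"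
    by (rule generic_elimination[OF finX ER]) (rule E0)
  then obtain u
    where u: "u \<in> R" "u a0 \<noteq> 0" "\<forall>a. u a \<noteq> 0 \<longrightarrow> solvable X (E a)"
    by (elim bexE conjE) (rule that)
  have "spanning (G a)" if "u a \<noteq> 0" for a
  proof -
    define W where "W = {p. \<exists>r\<in>ideal_of (G a ` UNIV). \<forall>n\<in>keys (p - r). mon_deg n \<le> 6 \<longrightarrow> standard n}"
    have W: "linearly_closed W"
      unfolding linearly_closed_def
    proof (intro conjI ballI allI)
      fix p p' assume "p \<in> W" "p' \<in> W"
      then obtain r r' where r: "r \<in> ideal_of (G a ` UNIV)" "r' \<in> ideal_of (G a ` UNIV)"
        "\<forall>n\<in>keys (p - r). mon_deg n \<le> 6 \<longrightarrow> standard n" "\<forall>n\<in>keys (p' - r'). mon_deg n \<le> 6 \<longrightarrow> standard n"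
        unfolding W_def mem_Collect_eq by (elim bexE) (rule that)
      have eq: "p + p' - (r + r') = (p - r) + (p' - r')" by (rule add_diff_add)
      have "keys (p + p' - (r + r')) \<subseteq> keys (p - r) \<union> keys (p' - r')"
        unfolding eq by (rule keys_add)
      then have "\<forall>n\<in>keys (p + p' - (r + r')). mon_deg n \<le> 6 \<longrightarrow> standard n"
        using r(3,4) by blast
      then show "p + p' \<in> W" unfolding W_def mem_Collect_eq by (rule bexI[OF _ ideal_of_add[OF r(1,2)]])
    next
      fix c p assume "p \<in> W"
      then obtain r where r: "r \<in> ideal_of (G a ` UNIV)"
        "\<forall>n\<in>keys (p - r). mon_deg n \<le> 6 \<longrightarrow> standard n"
        unfolding W_def mem_Collect_eq by (elim bexE) (rule that)
      have "keys (Const c * p - Const c * r) \<subseteq> keys (p - r)"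
        using keys_Const_mult[of c "p - r"] by (simp add: right_diff_distrib)
      then have "\<forall>n\<in>keys (Const c * p - Const c * r). mon_deg n \<le> 6 \<longrightarrow> standard n"
        using r(2) by blast
      then show "Const c * p \<in> W"
        unfolding W_def mem_Collect_eq by (rule bexI[OF _ ideal_of_mult[OF r(1)]])
    qed
    have "solvable X (E a)" using u(3) that by simp
    have "monomial m' \<in> W" if "m' \<in> X" for m'
    proof (rule solvableD[OF \<open>solvable X (E a)\<close> W _ that])
      fix m assume "m \<in> X"
      let ?p = "\<Sum>n\<in>X. Const (E a m n) * monomial n"
      have "q a m \<in> ideal_of (G a ` UNIV)"
        unfolding q_def by (rule ideal_of_imageI)
      moreover have "standard n" if "n \<in> keys (?p - q a m)" "mon_deg n \<le> 6" for n
      proof (rule ccontr)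
        assume "\<not> standard n"
        then have "n \<in> X" using that by (simp add: X_def)
        then have "lookup ?p n = E a m n"
          using finX by (simp add: lookup_sum lookup_Const_mult lookup_monomial if_distrib cong: if_cong)
        then show False using that(1) by (simp add: in_keys_iff lookup_minus E_def)
      qed
      ultimately show "?p \<in> W" unfolding W_def by (intro CollectI bexI[of _ "q a m"]) simp_all
    qed
    then show ?thesis unfolding spanning_def W_def X_def by simp
  qed
  with u(1,2) show ?thesis by (rule that)
qed

end

text \<open>Polynomial functions in given coordinates \<open>x\<close> on \<open>D\<close>.\<close>

definition polynomial_functions ::
    "('a \<Rightarrow> 'c \<Rightarrow> 'k::comm_ring_1) \<Rightarrow> 'a set \<Rightarrow> ('a \<Rightarrow> 'k) set" where
  "polynomial_functions x D = {u. \<exists>p :: ('c, 'k) mpol. \<forall>a\<in>D. u a = poly_eval (x a) p}"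

lemma function_ring_polynomial_functions:
  "function_ring (polynomial_functions (x :: 'a \<Rightarrow> 'c \<Rightarrow> 'k::field) D) D"
proof
  let ?R = "polynomial_functions x D"
  show "(\<lambda>_. c) \<in> ?R" for c
    unfolding polynomial_functions_def by (auto intro!: exI[of _ "Const c"])
  fix u v :: "'a \<Rightarrow> 'k" assume u: "u \<in> ?R"
  then obtain p where p: "\<And>a. a \<in> D \<Longrightarrow> u a = poly_eval (x a) p"
    unfolding polynomial_functions_def by auto
  show "v \<in> ?R" if "\<And>a. a \<in> D \<Longrightarrow> u a = v a"
    unfolding polynomial_functions_def using p that by force
  assume "v \<in> ?R"
  then obtain q where q: "\<And>a. a \<in> D \<Longrightarrow> v a = poly_eval (x a) q"
    unfolding polynomial_functions_def by auto
  have "\<forall>a\<in>D. u a + v a = poly_eval (x a) (p + q)" "\<forall>a\<in>D. u a * v a = poly_eval (x a) (p * q)"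
    using p q by (simp_all add: poly_eval_add poly_eval_mult)
  then show "(\<lambda>a. u a + v a) \<in> ?R" "(\<lambda>a. u a * v a) \<in> ?R"
    unfolding polynomial_functions_def by blast+
qed

lemma coordinate_polynomial_function: "(\<lambda>a. x a c) \<in> polynomial_functions x D"
  unfolding polynomial_functions_def by (auto intro!: exI[of _ "Var c"])

lemma zariski_open_polynomial_function:
  assumes "u \<in> polynomial_functions x D"
  shows "zariski_open_in x D {a \<in> D. u a \<noteq> 0}"
proof -
  obtain p where "\<And>a. a \<in> D \<Longrightarrow> u a = poly_eval (x a) p"
    using assms unfolding polynomial_functions_def by auto
  then show ?thesis
    unfolding zariski_open_in_def by (intro exI[of _ "{p}"]) auto
qed

text \<open>Polynomial functions of one variable.\<close>

lemma function_ring_poly: "function_ring (range (poly :: 'k::field poly \<Rightarrow> 'k \<Rightarrow> 'k)) UNIV"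
proof
  let ?R = "range (poly :: 'k poly \<Rightarrow> 'k \<Rightarrow> 'k)"
  show "(\<lambda>_. c) \<in> ?R" for c
    by (rule range_eqI[of _ _ "[:c:]"]) auto
  fix u v :: "'k \<Rightarrow> 'k" assume u: "u \<in> ?R"
  then obtain p where p: "u = poly p" by auto
  show "v \<in> ?R" if "\<And>a. a \<in> UNIV \<Longrightarrow> u a = v a"
    using u that by (metis UNIV_I ext)
  assume "v \<in> ?R"
  then obtain q where q: "v = poly q" by auto
  show "(\<lambda>a. u a + v a) \<in> ?R" by (rule range_eqI[of _ _ "p + q"]) (simp add: p q fun_eq_iff)
  show "(\<lambda>a. u a * v a) \<in> ?R" by (rule range_eqI[of _ _ "p * q"]) (simp add: p q fun_eq_iff)
qed

section \<open>The squares of five linear forms\<close>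

text \<open>Congruences modulo an ideal \<open>Q\<close> that contains the squares of five elements with sum \<open>s\<close>. Modulo \<open>Q\<close>, the
  power \<open>s\<^sup>k\<close> is \<open>k!\<close> times the elementary symmetric function of degree \<open>k\<close>.\<close>

locale five_squares =
  fixes Q :: "'a::comm_ring_1 set" and a b c d e s :: 'a
  assumes Q: "\<exists>B. Q = ideal_of B"
    and sq: "a^2 \<in> Q" "b^2 \<in> Q" "c^2 \<in> Q" "d^2 \<in> Q" "e^2 \<in> Q"
    and s: "s = a + b + c + d + e"
begin

lemma Q_add: "x \<in> Q \<Longrightarrow> y \<in> Q \<Longrightarrow> x + y \<in> Q"
  and Q_mult: "x \<in> Q \<Longrightarrow> x * y \<in> Q"
  using Q ideal_of_add ideal_of_mult_right by metis+

lemma squares: "a^2 * p + b^2 * q + c^2 * r + d^2 * t + e^2 * u \<in> Q"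
  by (intro Q_add Q_mult sq)

lemma cong_mult: "x - y \<in> Q \<Longrightarrow> x * z - y * z \<in> Q"
  using Q_mult[of "x - y" z] by (simp add: left_diff_distrib)

lemma cong_trans: "x - y \<in> Q \<Longrightarrow> y - z \<in> Q \<Longrightarrow> x - z \<in> Q"
  using Q_add[of "x - y" "y - z"] by simp

lemma cong_sym: "x - y \<in> Q \<Longrightarrow> y - x \<in> Q"
  using Q_mult[of "x - y" "- 1"] by simp

text \<open>The elementary symmetric functions of the five elements.\<close>

definition "e2 = a*b + a*c + a*d + a*e + b*c + b*d + b*e + c*d + c*e + d*e"
definition "e3 = a*b*c + a*b*d + a*b*e + a*c*d + a*c*e + a*d*e + b*c*d + b*c*e + b*d*e + c*d*e"
definition "e4 = a*b*c*d + a*b*c*e + a*b*d*e + a*c*d*e + b*c*d*e"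
definition "e5 = a*b*c*d*e"

lemma s2: "s^2 - 2 * e2 \<in> Q"
proof -
  have "s^2 - 2 * e2 = a^2 * 1 + b^2 * 1 + c^2 * 1 + d^2 * 1 + e^2 * 1"
    unfolding s e2_def by (simp add: power2_eq_square algebra_simps)
  then show ?thesis using squares by metis
qed

lemma s_e2: "e2 * s - 3 * e3 \<in> Q"
proof -
  have "e2 * s - 3 * e3 = a^2 * (b+c+d+e) + b^2 * (a+c+d+e) + c^2 * (a+b+d+e) + d^2 * (a+b+c+e) + e^2 * (a+b+c+d)"
    unfolding s e2_def e3_def by (simp add: power2_eq_square algebra_simps)
  then show ?thesis using squares by metis
qed

lemma s_e3: "e3 * s - 4 * e4 \<in> Q"
proof -
  have "e3 * s - 4 * e4 = a^2 * (b*c+b*d+b*e+c*d+c*e+d*e) + b^2 * (a*c+a*d+a*e+c*d+c*e+d*e)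
     + c^2 * (a*b+a*d+a*e+b*d+b*e+d*e) + d^2 * (a*b+a*c+a*e+b*c+b*e+c*e) + e^2 * (a*b+a*c+a*d+b*c+b*d+c*d)"
    unfolding s e3_def e4_def by (simp add: power2_eq_square algebra_simps)
  then show ?thesis using squares by metis
qed

lemma s_e4: "e4 * s - 5 * e5 \<in> Q"
proof -
  have "e4 * s - 5 * e5 = a^2 * (b*c*d+b*c*e+b*d*e+c*d*e) + b^2 * (a*c*d+a*c*e+a*d*e+c*d*e)
     + c^2 * (a*b*d+a*b*e+a*d*e+b*d*e) + d^2 * (a*b*c+a*b*e+a*c*e+b*c*e) + e^2 * (a*b*c+a*b*d+a*c*d+b*c*d)"
    unfolding s e4_def e5_def by (simp add: power2_eq_square algebra_simps)
  then show ?thesis using squares by metis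
qed

lemma s3: "s^3 - 6 * e3 \<in> Q"
proof -
  have "s^2 * s - 2 * e2 * s \<in> Q" by (rule cong_mult[OF s2])
  moreover have "e2 * s * 2 - 3 * e3 * 2 \<in> Q" by (rule cong_mult[OF s_e2])
  ultimately show ?thesis
    using cong_trans[of "s^3" "2 * e2 * s" "6 * e3"] by (simp add: power2_eq_square power3_eq_cube algebra_simps)
qed

lemma s4: "s^4 - 24 * e4 \<in> Q"
proof -
  have "s^3 * s - 6 * e3 * s \<in> Q" by (rule cong_mult[OF s3])
  moreover have "e3 * s * 6 - 4 * e4 * 6 \<in> Q" by (rule cong_mult[OF s_e3])
  ultimately show ?thesis
    using cong_trans[of "s^4" "6 * e3 * s" "24 * e4"] by (simp add: eval_nat_numeral algebra_simps)
qed

lemma s5: "s^5 - 120 * e5 \<in> Q"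
proof -
  have "s^4 * s - 24 * e4 * s \<in> Q" by (rule cong_mult[OF s4])
  moreover have "e4 * s * 24 - 5 * e5 * 24 \<in> Q" by (rule cong_mult[OF s_e4])
  ultimately show ?thesis
    using cong_trans[of "s^5" "24 * e4 * s" "120 * e5"] by (simp add: eval_nat_numeral algebra_simps)
qed

text \<open>The strong Lefschetz property, by explicit preimages: products of three of the elements are divisible
  by \<open>s\<close>, then \<open>s\<^sup>2 a b\<close> by \<open>s\<^sup>3\<close> and \<open>s\<^sup>4 a\<close> by \<open>s\<^sup>5\<close>, and \<open>s\<^sup>5 a\<close> vanishes, up to integer factors and
  modulo \<open>Q\<close>.\<close>

lemma cubic: "6 * (a * b * c) - s * (2 * (a*b + a*c + b*c) - (a + b + c) * (d + e) + 2 * (d*e)) \<in> Q"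
proof -
  have "6 * (a * b * c) - s * (2 * (a*b + a*c + b*c) - (a + b + c) * (d + e) + 2 * (d*e)) =
     a^2 * (d+e-2*b-2*c) + b^2 * (d+e-2*a-2*c) + c^2 * (d+e-2*a-2*b) + d^2 * (a+b+c-2*e) + e^2 * (a+b+c-2*d)"
    unfolding s by (simp add: power2_eq_square algebra_simps)
  then show ?thesis using squares by metis
qed

lemma quartic: "s^2 * (12 * (a * b)) - s^3 * (3 * a + 3 * b - c - d - e) \<in> Q"
proof -
  have 1: "s^2 * (12 * (a * b)) - 2 * e2 * (12 * (a * b)) \<in> Q" by (rule cong_mult[OF s2])
  have "2 * e2 * (12 * (a * b)) - 6 * e3 * (3 * a + 3 * b - c - d - e)
    = a^2 * (24 * b * (b+c+d+e) - 18 * (b*c+b*d+b*e+c*d+c*e+d*e))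
      + b^2 * (24 * a * (c+d+e) - 18 * (a*c+a*d+a*e+c*d+c*e+d*e))
      + c^2 * (6 * (a*b+a*d+a*e+b*d+b*e+d*e)) + d^2 * (6 * (a*b+a*c+a*e+b*c+b*e+c*e))
      + e^2 * (6 * (a*b+a*c+a*d+b*c+b*d+c*d))"
    unfolding e2_def e3_def by (simp add: power2_eq_square algebra_simps)
  then have 2: "2 * e2 * (12 * (a * b)) - 6 * e3 * (3 * a + 3 * b - c - d - e) \<in> Q"
    using squares by metis
  have 3: "6 * e3 * (3 * a + 3 * b - c - d - e) - s^3 * (3 * a + 3 * b - c - d - e) \<in> Q"
    by (rule cong_mult[OF cong_sym[OF s3]])
  show ?thesis by (rule cong_trans[OF cong_trans[OF 1 2] 3])
qed

lemma quintic: "s^4 * (5 * a) - s^5 \<in> Q"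
proof -
  have 1: "s^4 * (5 * a) - 24 * e4 * (5 * a) \<in> Q" by (rule cong_mult[OF s4])
  have "24 * e4 * (5 * a) - 120 * e5 = a^2 * (120 * (b*c*d+b*c*e+b*d*e+c*d*e)) + b^2 * 0 + c^2 * 0 + d^2 * 0 + e^2 * 0"
    unfolding e4_def e5_def by (simp add: power2_eq_square algebra_simps)
  then have 2: "24 * e4 * (5 * a) - 120 * e5 \<in> Q" using squares by metis
  show ?thesis by (rule cong_trans[OF cong_trans[OF 1 2] cong_sym[OF s5]])
qed

lemma sextic: "s^5 * a \<in> Q"
proof -
  have 1: "s^5 * a - 120 * e5 * a \<in> Q" by (rule cong_mult[OF s5])
  have "120 * e5 * a - 0 = a^2 * (120 * b * c * d * e) + b^2 * 0 + c^2 * 0 + d^2 * 0 + e^2 * 0"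
    unfolding e5_def by (simp add: power2_eq_square algebra_simps)
  then have 2: "120 * e5 * a - 0 \<in> Q" using squares by metis
  show ?thesis using cong_trans[OF 1 2] by simp
qed

end

text \<open>By symmetry, any three of the five elements can take the first three places.\<close>

lemma five_squares_permuted:
  fixes v :: "5 \<Rightarrow> 'a::comm_ring_1"
  assumes sq: "\<And>i. v i ^ 2 \<in> ideal_of B" and s: "s = (\<Sum>i\<in>UNIV. v i)" and "i \<noteq> j" "i \<noteq> k" "j \<noteq> k"
  obtains l m where "five_squares (ideal_of B) (v i) (v j) (v k) (v l) (v m) s"
proof -
  have "card (UNIV - {i, j, k}) = 2"
    using assms(3-5) by (subst card_Diff_subset) auto
  then obtain l m where lm: "UNIV - {i, j, k} = {l, m}" "l \<noteq> m" by (auto simp: card_2_iff)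
  have "UNIV = {i, j, k} \<union> {l, m}" using lm(1) by blast
  moreover have "l \<notin> {i, j, k}" "m \<notin> {i, j, k}" using lm(1) by blast+
  moreover have "sum v ({i, j, k} \<union> {l, m}) = v i + v j + v k + v l + v m"
    if "l \<notin> {i, j, k}" "m \<notin> {i, j, k}"
    using that assms(3-5) lm(2) by (auto simp: add.assoc)
  ultimately have "s = v i + v j + v k + v l + v m"
    unfolding s by metis
  then have "five_squares (ideal_of B) (v i) (v j) (v k) (v l) (v m) s"
    by unfold_locales (auto intro: sq)
  then show ?thesis by (rule that)
qed

subsection \<open>Homogeneous polynomials as combinations of products of linear forms\<close>

lemma linearly_closed_mod:
  fixes T :: "('i, 'k::comm_ring_1) mpol set"
  assumes "linearly_closed T"
  shows "linearly_closed {p. \<exists>q\<in>T. p - q \<in> ideal_of B}"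
  unfolding linearly_closed_def
proof (intro conjI ballI allI)
  fix p p' assume "p \<in> {p. \<exists>q\<in>T. p - q \<in> ideal_of B}" "p' \<in> {p. \<exists>q\<in>T. p - q \<in> ideal_of B}"
  then obtain q q' where q: "q \<in> T" "p - q \<in> ideal_of B" "q' \<in> T" "p' - q' \<in> ideal_of B" by blast
  have "p + p' - (q + q') \<in> ideal_of B"
    unfolding add_diff_add using q by (intro ideal_of_add)
  then show "p + p' \<in> {p. \<exists>q\<in>T. p - q \<in> ideal_of B}"
    using linearly_closed_add[OF assms q(1,3)] by blast
next
  fix c p assume "p \<in> {p. \<exists>q\<in>T. p - q \<in> ideal_of B}"
  then obtain q where q: "q \<in> T" "p - q \<in> ideal_of B" by blast
  have "Const c * p - Const c * q \<in> ideal_of B"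
    unfolding right_diff_distrib[symmetric] using q by (intro ideal_of_mult)
  then show "Const c * p \<in> {p. \<exists>q\<in>T. p - q \<in> ideal_of B}"
    using linearly_closed_scale[OF assms q(1)] by blast
qed

lemma linearly_closed_image_mult:
  assumes T: "linearly_closed T"
  shows "linearly_closed ((*) r ` T)"
  unfolding linearly_closed_def
proof (intro conjI ballI allI)
  fix p q assume "p \<in> (*) r ` T" "q \<in> (*) r ` T"
  then obtain p' q' where "p = r * p'" "q = r * q'" and pq: "p' \<in> T" "q' \<in> T" by blast
  then have "p + q = r * (p' + q')" by (simp add: distrib_left)
  then show "p + q \<in> (*) r ` T"
    using linearly_closed_add[OF T pq] by blast
next
  fix c p assume "p \<in> (*) r ` T"
  then obtain p' where "p = r * p'" and p': "p' \<in> T" by blast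
  then have "Const c * p = r * (Const c * p')" by (simp add: mult.left_commute)
  then show "Const c * p \<in> (*) r ` T"
    using linearly_closed_scale[OF T p'] by blast
qed

lemma linearly_closed_vimage_mult:
  assumes "linearly_closed W"
  shows "linearly_closed {p. r * p \<in> W}"
  using assms by (simp add: linearly_closed_def distrib_left mult.left_commute[of r])

lemma linearly_closed_homogeneous: "linearly_closed {p. homogeneous d p}"
  by (simp add: linearly_closed_def homogeneous_add homogeneous_Const_mult)

text \<open>Induction on the degree: forms of degree \<open>d + 1\<close> are combinations of products of forms of
  degree \<open>d\<close> with a fixed family of linear forms that generates the variables.\<close>

lemma homogeneous_Suc_closed:
  fixes v :: "'r::finite \<Rightarrow> ('i::finite, 'k::comm_ring_1) mpol"
  assumes v: "\<And>j. Var j = (\<Sum>k\<in>UNIV. Const (c j k) * v k)"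
    and W: "linearly_closed W"
    and step: "\<And>k q. homogeneous d q \<Longrightarrow> v k * q \<in> W"
    and p: "homogeneous (Suc d) p"
  shows "p \<in> W"
proof -
  have zero: "0 \<in> W"
    using linearly_closed_0[OF W step[of 0 undefined]] by simp
  show ?thesis
  proof (induction p rule: mpol_linear_induct)
    case (4 m)
    then have "mon_deg m = Suc d" using p by (simp add: homogeneous_def)
    then have "m \<noteq> 0" by auto
    then obtain i where "lookup m i \<noteq> 0" by (metis lookup_zero poly_mapping_eqI)
    then have "lookup m i \<ge> 1" by simp
    then obtain a where a: "m = a + Poly_Mapping.single i 1" "mon_deg m = mon_deg a + 1"
      by (rule mon_deg_split)
    have "homogeneous d (monomial a :: ('i, 'k) mpol)"
      using homogeneous_monomial[of a] a(2) \<open>mon_deg m = Suc d\<close> by simp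
    then have "0 + (\<Sum>k\<in>UNIV. Const (c i k) * (v k * monomial a)) \<in> W"
      using step zero by (intro linearly_closed_sum[OF W] linearly_closed_scale[OF W]) simp_all
    moreover have "monomial m = (\<Sum>k\<in>UNIV. Const (c i k) * (v k * monomial a))"
      unfolding a(1) monomial_add Var_def[symmetric] v sum_distrib_left
      by (simp add: ac_simps)
    ultimately show ?case by simp
  qed (use zero W linearly_closed_add linearly_closed_scale in blast)+
qed

lemma homogeneous_0_iff: "homogeneous 0 p \<longleftrightarrow> (\<exists>c. p = Const c)"
  for p :: "('i::finite, 'k::comm_ring_1) mpol"
proof
  assume "homogeneous 0 p"
  then have "lookup p m = (if m = 0 then lookup p 0 else 0)" for m
    by (auto simp: homogeneous_def mon_deg_eq_0 in_keys_iff)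
  then have "p = Const (lookup p 0)"
    by (intro poly_mapping_eqI) (metis Const_def lookup_single_eq lookup_single_not_eq)
  then show "\<exists>c. p = Const c" ..
qed (auto simp: homogeneous_Const)

lemma homogeneous_numeral_mult: "homogeneous d p \<Longrightarrow> homogeneous d (numeral n * p)"
  for p :: "('i, 'k::comm_semiring_1) mpol"
  using homogeneous_Const_mult[of d p "numeral n"] by (simp add: Const_numeral)

lemma ideal_of_divide_numeral:
  fixes x y s :: "('i, 'k::field_char_0) mpol"
  assumes "r * (numeral n * x) - s * y \<in> ideal_of B"
  shows "r * x - s * (Const (1 / numeral n) * y) \<in> ideal_of B"
proof -
  have "Const (1 / numeral n) * numeral n = (1 :: ('i, 'k) mpol)"
  proof -
    have "Const (1 / numeral n) * numeral n = (Const (1 / numeral n * numeral n) :: ('i, 'k) mpol)"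
      by (simp only: Const_mult Const_numeral)
    then show ?thesis by simp
  qed
  then have "r * x = Const (1 / numeral n) * (r * (numeral n * x))"
    by (metis mult.assoc mult.commute mult_1)
  then have "r * x - s * (Const (1 / numeral n) * y) = Const (1 / numeral n) * (r * (numeral n * x) - s * y)"
    by (simp add: right_diff_distrib mult.left_commute[of s])
  then show ?thesis using ideal_of_mult[OF assms] by simp
qed

lemma ideal_of_cong_trans: "x - y \<in> ideal_of B \<Longrightarrow> y - z \<in> ideal_of B \<Longrightarrow> x - z \<in> ideal_of B"
  using ideal_of_add[of "x - y" B "y - z"] by simp

lemma ideal_of_cong_mult: "x - y \<in> ideal_of B \<Longrightarrow> r * x - r * y \<in> ideal_of B"
  using ideal_of_mult[of "x - y" B r] by (simp add: right_diff_distrib)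

lemma ex_distinct_5: "\<exists>j k. i \<noteq> j \<and> i \<noteq> k \<and> j \<noteq> (k :: 5)"
proof -
  have "(0 :: 5) \<noteq> 1" "(0 :: 5) \<noteq> 2" "(1 :: 5) \<noteq> 2" by simp_all
  then show ?thesis by metis
qed

text \<open>A basis \<open>v\<close> of the linear forms, with sum \<open>s\<close>, and a set \<open>B\<close> whose ideal contains the squares of the
  basis. The matrix \<open>c\<close> expresses the variables in this basis.\<close>

locale square_forms =
  fixes v :: "5 \<Rightarrow> (5, 'k::field_char_0) mpol" and B c s
  assumes Var_v: "\<And>j. Var j = (\<Sum>k\<in>UNIV. Const (c j k) * v k)"
    and v: "\<And>k. homogeneous 1 (v k)" and sq: "\<And>k. v k ^ 2 \<in> ideal_of B"
    and s: "s = (\<Sum>k\<in>UNIV. v k)"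
begin

text \<open>The polynomials congruent to an element of \<open>T\<close>.\<close>

abbreviation modulo :: "(5, 'k) mpol set \<Rightarrow> (5, 'k) mpol set" where
  "modulo T \<equiv> {p. \<exists>q\<in>T. p - q \<in> ideal_of B}"

lemma closed_degree_1:
  assumes W: "linearly_closed W" and "\<And>i. r * v i \<in> W" and q: "homogeneous 1 q"
  shows "r * q \<in> W"
proof -
  have "q \<in> {q. r * q \<in> W}"
  proof (rule homogeneous_Suc_closed[OF Var_v linearly_closed_vimage_mult[OF W], of 0])
    fix k and q :: "(5, 'k) mpol" assume "homogeneous 0 q"
    then obtain c where "q = Const c" by (auto simp: homogeneous_0_iff)
    then have eq: "r * (v k * q) = Const c * (r * v k)" by (simp add: ac_simps)
    show "v k * q \<in> {q. r * q \<in> W}"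
      unfolding mem_Collect_eq eq by (rule linearly_closed_scale[OF W assms(2)])
  qed (use q in simp)
  then show ?thesis by simp
qed

lemma closed_degree_2:
  assumes W: "linearly_closed W" and "\<And>i j. r * (v i * v j) \<in> W" and q: "homogeneous 2 q"
  shows "r * q \<in> W"
proof -
  have "q \<in> {q. r * q \<in> W}"
  proof (rule homogeneous_Suc_closed[OF Var_v linearly_closed_vimage_mult[OF W], of 1])
    fix k and q :: "(5, 'k) mpol" assume "homogeneous 1 q"
    moreover have "(r * v k) * v i \<in> W" for i
      using assms(2) by (simp add: mult.assoc)
    ultimately have "(r * v k) * q \<in> W"
      using closed_degree_1[OF W] by blast
    then show "v k * q \<in> {q. r * q \<in> W}" by (simp add: mult.assoc)
  qed (use q in \<open>simp add: numeral_2_eq_2\<close>)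
  then show ?thesis by simp
qed

lemma degree_3:
  assumes "homogeneous 3 p"
  shows "\<exists>q. homogeneous 2 q \<and> p - s * q \<in> ideal_of B"
proof -
  let ?W = "modulo ((*) s ` {q. homogeneous 2 q})"
  have W: "linearly_closed ?W"
    by (intro linearly_closed_mod linearly_closed_image_mult linearly_closed_homogeneous)
  have in_Q: "x \<in> ?W" if "x \<in> ideal_of B" for x
  proof -
    have "0 \<in> (*) s ` {q. homogeneous 2 q}"
      by (rule image_eqI[of _ _ 0]) simp_all
    moreover have "x - 0 \<in> ideal_of B" using that by simp
    ultimately show ?thesis by blast
  qed
  have vvv: "v i * (v j * v k) \<in> ?W" for i j k
  proof (cases "i = j \<or> i = k \<or> j = k")
    case True
    then have "v i * (v j * v k) = v j ^ 2 * v k \<or> v i * (v j * v k) = v k ^ 2 * v j \<or>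
        v i * (v j * v k) = v k ^ 2 * v i"
      by (elim disjE) (simp_all add: power2_eq_square ac_simps)
    then have "v i * (v j * v k) \<in> ideal_of B"
      by (elim disjE) (simp_all only: ideal_of_mult_right[OF sq])
    then show ?thesis by (rule in_Q)
  next
    case False
    then obtain l m where "five_squares (ideal_of B) (v i) (v j) (v k) (v l) (v m) s"
      using five_squares_permuted[OF sq s, of i j k] by metis
    from five_squares.cubic[OF this]
    have "1 * (6 * (v i * v j * v k)) - s * (2 * (v i * v j + v i * v k + v j * v k)
        - (v i + v j + v k) * (v l + v m) + 2 * (v l * v m)) \<in> ideal_of B" (is "_ - s * ?y \<in> _")
      by simp
    from ideal_of_divide_numeral[OF this]
    have "v i * (v j * v k) - s * (Const (1 / 6) * ?y) \<in> ideal_of B" by (simp add: mult.assoc)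
    moreover have "homogeneous 2 (Const (1 / 6) * ?y)"
    proof -
      have hom: "homogeneous 2 (p * q)" if "homogeneous 1 p" "homogeneous 1 q" for p q :: "(5, 'k) mpol"
        using homogeneous_mult[OF that] by (simp only: one_add_one)
      show ?thesis
        by (rule homogeneous_Const_mult, rule homogeneous_add, rule homogeneous_diff)
          (intro homogeneous_numeral_mult homogeneous_add hom v)+
    qed
    ultimately show ?thesis by blast
  qed
  have "p \<in> ?W"
  proof (rule homogeneous_Suc_closed[OF Var_v W, of 2])
    fix k and q :: "(5, 'k) mpol" assume "homogeneous 2 q"
    then show "v k * q \<in> ?W" by (rule closed_degree_2[OF W vvv])
  qed (use assms in simp)
  then show ?thesis by blast
qed

lemma degree_2_s2:
  assumes "homogeneous 2 q"
  shows "\<exists>l. homogeneous 1 l \<and> s^2 * q - s^3 * l \<in> ideal_of B"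
proof -
  let ?W = "modulo ((*) (s^3) ` {l. homogeneous 1 l})"
  have W: "linearly_closed ?W"
    by (intro linearly_closed_mod linearly_closed_image_mult linearly_closed_homogeneous)
  have "s^2 * (v i * v j) \<in> ?W" for i j
  proof (cases "i = j")
    case True
    have "s^2 * (v i * v j) - s^3 * 0 \<in> ideal_of B"
      using ideal_of_mult[OF sq] True by (simp add: power2_eq_square)
    moreover have "homogeneous 1 (0 :: (5, 'k) mpol)" by simp
    ultimately show ?thesis by blast
  next
    case False
    obtain k where "k \<notin> {i, j}"
    proof -
      have "card {i, j} < card (UNIV :: 5 set)" using False by simp
      then have "{i, j} \<noteq> UNIV" by (metis less_irrefl)
      then show ?thesis using that by blast
    qed
    then obtain l m where "five_squares (ideal_of B) (v i) (v j) (v k) (v l) (v m) s"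
      using five_squares_permuted[OF sq s, of i j k] False by auto
    from five_squares.quartic[OF this]
    have "s^2 * (v i * v j) - s^3 * (Const (1 / 12) * (3 * v i + 3 * v j - v k - v l - v m)) \<in> ideal_of B"
      by (rule ideal_of_divide_numeral)
    moreover have "homogeneous 1 (Const (1 / 12) * (3 * v i + 3 * v j - v k - v l - v m))"
      by (intro homogeneous_Const_mult homogeneous_add homogeneous_diff homogeneous_numeral_mult v)
    ultimately show ?thesis by blast
  qed
  then have "s^2 * q \<in> ?W" using assms by (rule closed_degree_2[OF W])
  then show ?thesis by blast
qed

lemma degree_1_s4:
  assumes "homogeneous 1 q"
  shows "\<exists>a. s^4 * q - s^5 * Const a \<in> ideal_of B"
proof -
  let ?W = "modulo ((*) (s^5) ` {l. homogeneous 0 l})"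
  have W: "linearly_closed ?W"
    by (intro linearly_closed_mod linearly_closed_image_mult linearly_closed_homogeneous)
  have "s^4 * v i \<in> ?W" for i
  proof -
    obtain j k where "i \<noteq> j" "i \<noteq> k" "j \<noteq> k" using ex_distinct_5 by blast
    then obtain l m where "five_squares (ideal_of B) (v i) (v j) (v k) (v l) (v m) s"
      using five_squares_permuted[OF sq s, of i j k] by metis
    from five_squares.quintic[OF this]
    have "s^4 * (5 * v i) - s^5 * 1 \<in> ideal_of B" by simp
    from ideal_of_divide_numeral[OF this]
    have "s^4 * v i - s^5 * Const (1 / 5) \<in> ideal_of B" by simp
    then show ?thesis using homogeneous_Const by blast
  qed
  then have "s^4 * q \<in> ?W" using assms by (rule closed_degree_1[OF W])
  then show ?thesis by (auto simp: homogeneous_0_iff)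
qed

lemma s5_mult: "s^5 * v i \<in> ideal_of B"
proof -
  obtain j k where "i \<noteq> j" "i \<noteq> k" "j \<noteq> k" using ex_distinct_5 by blast
  then obtain l m where "five_squares (ideal_of B) (v i) (v j) (v k) (v l) (v m) s"
    using five_squares_permuted[OF sq s, of i j k] by metis
  then show ?thesis by (rule five_squares.sextic)
qed

lemma degree_4:
  assumes "homogeneous 4 p"
  shows "\<exists>l. homogeneous 1 l \<and> p - s^3 * l \<in> ideal_of B"
proof -
  let ?W = "modulo ((*) (s^3) ` {l. homogeneous 1 l})"
  have W: "linearly_closed ?W"
    by (intro linearly_closed_mod linearly_closed_image_mult linearly_closed_homogeneous)
  have "p \<in> ?W"
  proof (rule homogeneous_Suc_closed[OF Var_v W, of 3])
    fix k and q :: "(5, 'k) mpol" assume "homogeneous 3 q"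
    then obtain q1 where q1: "homogeneous 2 q1" "q - s * q1 \<in> ideal_of B" using degree_3 by blast
    have "homogeneous 3 (v k * q1)" using homogeneous_mult[OF v q1(1), of k] by (simp add: numeral_3_eq_3)
    then obtain q2 where q2: "homogeneous 2 q2" "v k * q1 - s * q2 \<in> ideal_of B" using degree_3 by blast
    obtain l where l: "homogeneous 1 l" "s^2 * q2 - s^3 * l \<in> ideal_of B"
      using degree_2_s2[OF q2(1)] by blast
    have "v k * q - v k * (s * q1) \<in> ideal_of B" by (rule ideal_of_cong_mult[OF q1(2)])
    moreover have "s * (v k * q1) - s * (s * q2) \<in> ideal_of B" by (rule ideal_of_cong_mult[OF q2(2)])
    ultimately have "v k * q - s^2 * q2 \<in> ideal_of B"
      using ideal_of_cong_trans[of "v k * q" "v k * (s * q1)" B "s^2 * q2"]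
      by (simp add: power2_eq_square mult.left_commute[of s "v k"] mult.assoc)
    then have "v k * q - s^3 * l \<in> ideal_of B" by (rule ideal_of_cong_trans[OF _ l(2)])
    then show "v k * q \<in> ?W" using l(1) by blast
  qed (use assms in simp)
  then show ?thesis by blast
qed

lemma degree_5:
  assumes "homogeneous 5 p"
  shows "\<exists>a. p - s^5 * Const a \<in> ideal_of B"
proof -
  let ?W = "modulo ((*) (s^5) ` {l. homogeneous 0 l})"
  have W: "linearly_closed ?W"
    by (intro linearly_closed_mod linearly_closed_image_mult linearly_closed_homogeneous)
  have "p \<in> ?W"
  proof (rule homogeneous_Suc_closed[OF Var_v W, of 4])
    fix k and q :: "(5, 'k) mpol" assume "homogeneous 4 q"
    then obtain l where l: "homogeneous 1 l" "q - s^3 * l \<in> ideal_of B" using degree_4 by blast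
    have "homogeneous 2 (v k * l)" using homogeneous_mult[OF v l(1), of k] by (simp only: one_add_one)
    then obtain l' where l': "homogeneous 1 l'" "s^2 * (v k * l) - s^3 * l' \<in> ideal_of B"
      using degree_2_s2 by blast
    obtain a where a: "s^4 * l' - s^5 * Const a \<in> ideal_of B" using degree_1_s4[OF l'(1)] by blast
    have "v k * q - v k * (s^3 * l) \<in> ideal_of B" by (rule ideal_of_cong_mult[OF l(2)])
    moreover have "v k * (s^3 * l) = s * (s^2 * (v k * l))"
      by (simp add: power2_eq_square power3_eq_cube ac_simps)
    ultimately have "v k * q - s * (s^2 * (v k * l)) \<in> ideal_of B" by simp
    moreover have "s * (s^2 * (v k * l)) - s^4 * l' \<in> ideal_of B"
      using ideal_of_cong_mult[OF l'(2), of s] by (simp add: eval_nat_numeral mult.assoc)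
    ultimately have "v k * q - s^4 * l' \<in> ideal_of B" by (rule ideal_of_cong_trans)
    then have "v k * q - s^5 * Const a \<in> ideal_of B" by (rule ideal_of_cong_trans[OF _ a])
    then show "v k * q \<in> ?W" using homogeneous_Const by blast
  qed (use assms in simp)
  then show ?thesis by (auto simp: homogeneous_0_iff)
qed

lemma degree_6:
  assumes "homogeneous 6 p"
  shows "p \<in> ideal_of B"
proof (rule homogeneous_Suc_closed[OF Var_v, of "ideal_of B" 5])
  show "linearly_closed (ideal_of B)"
    by (simp add: linearly_closed_def ideal_of_add ideal_of_mult)
  fix k and q :: "(5, 'k) mpol" assume "homogeneous 5 q"
  then obtain a where a: "q - s^5 * Const a \<in> ideal_of B" using degree_5 by blast
  have "v k * q - v k * (s^5 * Const a) \<in> ideal_of B" by (rule ideal_of_cong_mult[OF a])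
  moreover have "v k * (s^5 * Const a) - 0 \<in> ideal_of B"
    using ideal_of_mult_right[OF s5_mult, of k "Const a"] by (simp add: ac_simps)
  ultimately show "v k * q \<in> ideal_of B" using ideal_of_cong_trans by fastforce
qed (use assms in simp)

end

subsection \<open>Coordinates in which the squares of the variables are spanning\<close>

text \<open>Selection by an index of type \<open>5\<close>, used to write down matrices.\<close>

definition tuple5 :: "'a \<Rightarrow> 'a \<Rightarrow> 'a \<Rightarrow> 'a \<Rightarrow> 'a \<Rightarrow> 5 \<Rightarrow> 'a" where
  "tuple5 a b c d e i = (if i = 0 then a else if i = 1 then b else if i = 2 then c else if i = 3 then d else e)"

lemma tuple5_simps [simp]:
  "tuple5 a b c d e 0 = a" "tuple5 a b c d e 1 = b" "tuple5 a b c d e 2 = c"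
  "tuple5 a b c d e 3 = d" "tuple5 a b c d e 4 = e"
  by (simp_all add: tuple5_def)

text \<open>The coordinate change. The conditions on its entries are that the columns, read as linear forms,
  have sum \<open>x\<^sub>5\<close> and that the coefficients of their squares at
  \<open>x\<^sub>1\<^sup>2, x\<^sub>1 x\<^sub>2, x\<^sub>2\<^sup>2, x\<^sub>1 x\<^sub>3, x\<^sub>2 x\<^sub>3\<close> form an invertible matrix. Among the solutions with entries
  \<open>-1, 0, 1\<close> it is one with many zeros.\<close>

definition base_matrix :: "'k::field_char_0^5^5" where
  "base_matrix = (\<chi> i k. tuple5 (tuple5 (-1) (-1) 0 1 1 k) (tuple5 (-1) 0 1 (-1) 1 k)
     (tuple5 (-1) 0 0 1 0 k) (tuple5 1 0 0 0 (-1) k) (tuple5 0 0 0 1 0 k) i)"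

definition base_inverse :: "'k::field_char_0^5^5" where
  "base_inverse = (\<chi> k j. tuple5 (tuple5 0 0 (-1) 0 1 j) (tuple5 (-1) 0 0 (-1) 1 j)
     (tuple5 0 1 0 1 1 j) (tuple5 0 0 0 0 1 j) (tuple5 0 0 (-1) (-1) 1 j) k)"

lemma base_matrix_inverse: "base_matrix ** base_inverse = mat 1"
  by (simp add: vec_eq_iff matrix_matrix_mult_def mat_def base_matrix_def base_inverse_def
      forall_5 sum_5)

lemma invertible_base_matrix: "invertible (base_matrix :: 'k::field_char_0^5^5)"
  unfolding invertible_def
  using base_matrix_inverse matrix_left_right_inverse[of base_matrix base_inverse] by blast

text \<open>The linear form that is substituted for the variable \<open>k\<close>.\<close>

definition base_form :: "5 \<Rightarrow> (5, 'k::field_char_0) mpol" where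
  "base_form k = lin_change base_matrix (Var k)"

lemma base_form:
  "base_form 0 = x\<^sub>4 - x\<^sub>1 - x\<^sub>2 - x\<^sub>3" "base_form 1 = - x\<^sub>1" "base_form 2 = x\<^sub>2"
  "base_form 3 = x\<^sub>1 - x\<^sub>2 + x\<^sub>3 + x\<^sub>5" "base_form 4 = x\<^sub>1 + x\<^sub>2 - x\<^sub>4"
  by (simp_all add: base_form_def lin_change_Var sum_5 base_matrix_def Const_uminus)

abbreviation base_squares :: "(5, 'k::field_char_0) mpol set" where
  "base_squares \<equiv> (\<lambda>k. base_form k ^ 2) ` UNIV"

lemma square_forms_base:
  "square_forms base_form base_squares (\<lambda>j k. base_inverse $ k $ j) (Var 4 :: (5, 'k::field_char_0) mpol)"
proof
  show Var: "Var j = (\<Sum>k\<in>UNIV. Const (base_inverse $ k $ j) * base_form k :: (5, 'k) mpol)" for j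
  proof -
    have "Var j = lin_change base_matrix (lin_change base_inverse (Var j) :: (5, 'k) mpol)"
      by (simp add: lin_change_lin_change base_matrix_inverse lin_change_id)
    then show ?thesis
      by (simp add: lin_change_Var[of base_inverse] lin_change_sum lin_change_Const_mult base_form_def)
  qed
  show "homogeneous 1 (base_form k :: (5, 'k) mpol)" for k
    unfolding base_form_def by (rule homogeneous_lin_change[OF homogeneous_Var])
  show "(base_form k :: (5, 'k) mpol)^2 \<in> ideal_of base_squares" for k
    by (rule ideal_of_base) simp
  show "Var 4 = (\<Sum>k\<in>UNIV. base_form k :: (5, 'k) mpol)"
    by (simp add: sum_5 base_form)
qed

text \<open>In degree \<open>2\<close> the nonstandard monomials are, up to standard ones, combinations of the five
  squares.\<close>

lemma base_degree_2:
  assumes "homogeneous 2 p"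
  shows "\<exists>n. homogeneous 2 n \<and> (\<forall>u\<in>keys n. standard u) \<and> p - n \<in> ideal_of (base_squares :: (5, 'k::field_char_0) mpol set)"
proof -
  define T :: "(5, 'k) mpol set" where "T = {n. homogeneous 2 n \<and> (\<forall>u\<in>keys n. standard u)}"
  define W where "W = {p. \<exists>n\<in>T. p - n \<in> ideal_of base_squares}"
  have T: "linearly_closed T"
    unfolding linearly_closed_def T_def
  proof (intro conjI ballI allI CollectI; clarify)
    fix p q :: "(5, 'k) mpol" and u
    assume "\<forall>u\<in>keys p. standard u" "\<forall>u\<in>keys q. standard u" "u \<in> keys (p + q)"
    then show "standard u" using keys_add[of p q] by blast
  next
    fix c and p :: "(5, 'k) mpol" and u
    assume "\<forall>u\<in>keys p. standard u" "u \<in> keys (Const c * p)"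
    then show "standard u" using keys_Const_mult[of c p] by blast
  qed (simp_all add: homogeneous_add homogeneous_Const_mult)
  have W: "linearly_closed W" unfolding W_def by (rule linearly_closed_mod[OF T])
  have add: "p + q \<in> W" if "p \<in> W" "q \<in> W" for p q
    using linearly_closed_add[OF W that] .
  have neg: "- p \<in> W" if "p \<in> W" for p
    using linearly_closed_scale[OF W that, of "- 1"] by (simp add: Const_uminus)
  have diff: "p - q \<in> W" if "p \<in> W" "q \<in> W" for p q
    using add[OF that(1) neg[OF that(2)]] by simp
  have half: "p \<in> W" if "p + p \<in> W" for p
  proof -
    have "Const (1 / 2) * (p + p) = Const (1 / 2 + 1 / 2) * p"
      by (simp only: Const_add distrib_left distrib_right)
    also have "(1 / 2 + 1 / 2 :: 'k) = 1" by simp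
    finally have "Const (1 / 2) * (p + p) = p" by simp
    then show ?thesis using linearly_closed_scale[OF W that, of "1 / 2"] by metis
  qed
  have sq: "base_form k ^ 2 \<in> W" for k
  proof -
    have "base_form k ^ 2 - 0 \<in> ideal_of base_squares" by (simp add: ideal_of_base)
    moreover have "(0 :: (5, 'k) mpol) \<in> T" by (simp add: T_def)
    ultimately show ?thesis unfolding W_def by blast
  qed
  have std: "monomial m \<in> W" if "standard m" "mon_deg m = 2" for m
  proof -
    have "(monomial m :: (5, 'k) mpol) \<in> T"
      using that homogeneous_monomial[of m] by (simp add: T_def)
    moreover have "(monomial m :: (5, 'k) mpol) - monomial m \<in> ideal_of base_squares" by simp
    ultimately show ?thesis unfolding W_def by blast
  qed
  have std_Var: "Var i * Var j \<in> W"
    if "standard (Poly_Mapping.single i 1 + Poly_Mapping.single j 1)" for i j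
    using std[OF that] by (simp add: mon_deg_add monomial_add Var_def)
  have s: "x\<^sub>1 * x\<^sub>4 \<in> W" "x\<^sub>2 * x\<^sub>4 \<in> W" "x\<^sub>3 * x\<^sub>4 \<in> W" "x\<^sub>4 * x\<^sub>4 \<in> W" "x\<^sub>3 * x\<^sub>3 \<in> W"
    "x\<^sub>1 * x\<^sub>5 \<in> W" "x\<^sub>2 * x\<^sub>5 \<in> W" "x\<^sub>3 * x\<^sub>5 \<in> W" "x\<^sub>5 * x\<^sub>5 \<in> W"
    by (rule std_Var, simp add: standard_def mon_deg_add lookup_add lookup_single)+
  have x11: "x\<^sub>1 * x\<^sub>1 \<in> W"
    using sq[of 1] by (simp add: base_form power2_eq_square)
  have x22: "x\<^sub>2 * x\<^sub>2 \<in> W"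
    using sq[of 2] by (simp add: base_form power2_eq_square)
  have x12: "x\<^sub>1 * x\<^sub>2 \<in> W"
  proof (rule half)
    have "x\<^sub>1 * x\<^sub>2 + x\<^sub>1 * x\<^sub>2 = base_form 4 ^ 2 - x\<^sub>1 * x\<^sub>1 - x\<^sub>2 * x\<^sub>2 - x\<^sub>4 * x\<^sub>4 + (x\<^sub>1 * x\<^sub>4 + x\<^sub>1 * x\<^sub>4)
      + (x\<^sub>2 * x\<^sub>4 + x\<^sub>2 * x\<^sub>4 :: (5, 'k) mpol)"
      unfolding base_form power2_eq_square by (simp add: algebra_simps)
    also have "\<dots> \<in> W" by (intro add diff sq s x11 x22)
    finally show "x\<^sub>1 * x\<^sub>2 + x\<^sub>1 * x\<^sub>2 \<in> W" .
  qed
  have x13: "x\<^sub>1 * x\<^sub>3 \<in> W"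
  proof (rule half, rule half)
    have "x\<^sub>1 * x\<^sub>3 + x\<^sub>1 * x\<^sub>3 + (x\<^sub>1 * x\<^sub>3 + x\<^sub>1 * x\<^sub>3) = base_form 0 ^ 2 + base_form 3 ^ 2
      - (x\<^sub>1 * x\<^sub>1 + x\<^sub>1 * x\<^sub>1) - (x\<^sub>2 * x\<^sub>2 + x\<^sub>2 * x\<^sub>2) - (x\<^sub>3 * x\<^sub>3 + x\<^sub>3 * x\<^sub>3) - x\<^sub>4 * x\<^sub>4 - x\<^sub>5 * x\<^sub>5
      + (x\<^sub>1 * x\<^sub>4 + x\<^sub>1 * x\<^sub>4) + (x\<^sub>2 * x\<^sub>4 + x\<^sub>2 * x\<^sub>4) + (x\<^sub>3 * x\<^sub>4 + x\<^sub>3 * x\<^sub>4)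
      - (x\<^sub>1 * x\<^sub>5 + x\<^sub>1 * x\<^sub>5) + (x\<^sub>2 * x\<^sub>5 + x\<^sub>2 * x\<^sub>5) - (x\<^sub>3 * x\<^sub>5 + x\<^sub>3 * x\<^sub>5 :: (5, 'k) mpol)"
      unfolding base_form power2_eq_square by (simp add: algebra_simps)
    also have "\<dots> \<in> W" by (intro add diff sq s x11 x22)
    finally show "x\<^sub>1 * x\<^sub>3 + x\<^sub>1 * x\<^sub>3 + (x\<^sub>1 * x\<^sub>3 + x\<^sub>1 * x\<^sub>3) \<in> W" .
  qed
  have x23: "x\<^sub>2 * x\<^sub>3 \<in> W"
  proof (rule half, rule half)
    have "x\<^sub>2 * x\<^sub>3 + x\<^sub>2 * x\<^sub>3 + (x\<^sub>2 * x\<^sub>3 + x\<^sub>2 * x\<^sub>3) = base_form 0 ^ 2 - base_form 3 ^ 2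
      - x\<^sub>4 * x\<^sub>4 + x\<^sub>5 * x\<^sub>5 - (x\<^sub>1 * x\<^sub>2 + x\<^sub>1 * x\<^sub>2) - (x\<^sub>1 * x\<^sub>2 + x\<^sub>1 * x\<^sub>2)
      + (x\<^sub>1 * x\<^sub>4 + x\<^sub>1 * x\<^sub>4) + (x\<^sub>2 * x\<^sub>4 + x\<^sub>2 * x\<^sub>4) + (x\<^sub>3 * x\<^sub>4 + x\<^sub>3 * x\<^sub>4)
      + (x\<^sub>1 * x\<^sub>5 + x\<^sub>1 * x\<^sub>5) - (x\<^sub>2 * x\<^sub>5 + x\<^sub>2 * x\<^sub>5) + (x\<^sub>3 * x\<^sub>5 + x\<^sub>3 * x\<^sub>5 :: (5, 'k) mpol)"
      unfolding base_form power2_eq_square by (simp add: algebra_simps)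
    also have "\<dots> \<in> W" by (intro add diff sq s x12)
    finally show "x\<^sub>2 * x\<^sub>3 + x\<^sub>2 * x\<^sub>3 + (x\<^sub>2 * x\<^sub>3 + x\<^sub>2 * x\<^sub>3) \<in> W" .
  qed
  have mono: "monomial m \<in> W" if m: "mon_deg m = 2" for m
  proof (cases "standard m")
    case False
    then obtain g a where g: "g \<in> gin_gens" "m = a + g" using nonstandard_divisible by blast
    have "\<not> standard g" using gin_gens_nonstandard g(1) by blast
    then have "mon_deg g \<ge> 2" by (rule nonstandardD(1))
    then have "mon_deg a = 0" "mon_deg g = 2" using m g(2) by (simp_all add: mon_deg_add)
    then have "m = g" using g(2) by (simp add: mon_deg_eq_0)
    let ?x = Poly_Mapping.single
    have "mon_deg g = 2 \<longrightarrow> g = ?x 0 2 \<or> g = ?x 0 1 + ?x 1 1 \<or> g = ?x 1 2 \<or>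
        g = ?x 0 1 + ?x 2 1 \<or> g = ?x 1 1 + ?x 2 1"
      using g(1) unfolding gin_gens_def Let_def
      by (elim insertE emptyE; simp only: mon_deg_add mon_deg_single simp_thms; simp)
    then show ?thesis
      using \<open>mon_deg g = 2\<close> x11 x12 x22 x13 x23 unfolding \<open>m = g\<close>
      by (auto simp: monomial_add Var_def[symmetric] Var_power[symmetric] power2_eq_square
          simp del: single_numeral single_one)
  qed (rule std[OF _ m])
  have "p \<in> W"
  proof (induction p rule: mpol_linear_induct)
    case 1
    then show ?case using linearly_closed_0[OF W x11] .
  next
    case (4 m)
    then show ?case using assms mono by (simp add: homogeneous_def)
  qed (auto intro: add linearly_closed_scale[OF W])
  then show ?thesis unfolding W_def T_def by blast
qed

lemma spanning_base: "spanning (\<lambda>k. base_form k ^ 2 :: (5, 'k::field_char_0) mpol)"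
  unfolding spanning_def
proof (intro allI impI, elim conjE)
  fix m :: "5 monom" assume m: "\<not> standard m" "mon_deg m \<le> 6"
  interpret square_forms "base_form :: 5 \<Rightarrow> (5, 'k) mpol" base_squares "\<lambda>j k. base_inverse $ k $ j" "Var 4"
    by (rule square_forms_base)
  let ?m = "monomial m :: (5, 'k) mpol"
  have hom: "homogeneous (mon_deg m) ?m" by (rule homogeneous_monomial)
  have keys_V: "u \<in> keys (Var 4 ^ k * n) \<Longrightarrow> \<exists>w\<in>keys n. u = Poly_Mapping.single 4 k + w"
    for u k and n :: "(5, 'k) mpol"
    using keys_mult[of "Var 4 ^ k" n] by (auto simp: Var_power)
  have "\<exists>n. (\<forall>u\<in>keys n. standard u) \<and> ?m - n \<in> ideal_of base_squares"
  proof -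
    have "mon_deg m = 2 \<or> mon_deg m = 3 \<or> mon_deg m = 4 \<or> mon_deg m = 5 \<or> mon_deg m = 6"
      using m nonstandardD(1)[OF m(1)] by linarith
    then show ?thesis
    proof (elim disjE)
      assume "mon_deg m = 2"
      then show ?thesis using base_degree_2[of ?m] hom by auto
    next
      assume "mon_deg m = 3"
      then obtain q where q: "homogeneous 2 q" "?m - Var 4 * q \<in> ideal_of base_squares"
        using degree_3[of ?m] hom by auto
      obtain n where n: "homogeneous 2 n" "\<forall>u\<in>keys n. standard u" "q - n \<in> ideal_of base_squares"
        using base_degree_2[OF q(1)] by blast
      have "?m - Var 4 * n \<in> ideal_of base_squares"
        by (rule ideal_of_cong_trans[OF q(2) ideal_of_cong_mult[OF n(3)]])
      moreover have "standard u" if u: "u \<in> keys (Var 4 * n)" for u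
      proof -
        have "u \<in> keys (Var 4 ^ 1 * n)" using u by simp
        from keys_V[OF this] obtain w where w: "w \<in> keys n" "u = Poly_Mapping.single 4 1 + w" by blast
        then have "standard w" "mon_deg w = 2" using n by (auto simp: homogeneous_def)
        then show ?thesis unfolding w(2) by (auto simp: standard_def mon_deg_add lookup_add lookup_single)
      qed
      ultimately show ?thesis by blast
    next
      assume "mon_deg m = 4"
      then obtain l where l: "homogeneous 1 l" "?m - Var 4 ^ 3 * l \<in> ideal_of base_squares"
        using degree_4[of ?m] hom by auto
      have "standard u" if u: "u \<in> keys (Var 4 ^ 3 * l)" for u
      proof -
        obtain w where w: "w \<in> keys l" "u = Poly_Mapping.single 4 3 + w"
          using keys_V[OF u] by blast
        then have "mon_deg w = 1" using l by (auto simp: homogeneous_def)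
        then show ?thesis unfolding w(2) by (simp add: standard_def mon_deg_add lookup_add)
      qed
      then show ?thesis using l by blast
    next
      assume "mon_deg m = 5"
      then obtain a where a: "?m - Var 4 ^ 5 * Const a \<in> ideal_of base_squares"
        using degree_5[of ?m] hom by auto
      have "standard u" if u: "u \<in> keys (Var 4 ^ 5 * Const a :: (5, 'k) mpol)" for u
      proof -
        obtain w where w: "w \<in> keys (Const a :: (5, 'k) mpol)" "u = Poly_Mapping.single 4 5 + w"
          using keys_V[OF u] by blast
        then have "w = 0" by (auto simp: Const_def split: if_splits)
        then show ?thesis unfolding w(2) by (simp add: standard_def mon_deg_add lookup_add)
      qed
      then show ?thesis using a by blast
    next
      assume "mon_deg m = 6"
      then show ?thesis using degree_6[of ?m] hom by (intro exI[of _ 0]) simp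
    qed
  qed
  then obtain n where n: "\<forall>u\<in>keys n. standard u" "?m - n \<in> ideal_of base_squares" by blast
  show "\<exists>q\<in>ideal_of base_squares. \<forall>n\<in>keys (?m - q). mon_deg n \<le> 6 \<longrightarrow> standard n"
    by (rule bexI[OF _ n(2)]) (use n(1) in simp)
qed

section \<open>Triangular regular sequences\<close>

subsection \<open>Exchanging elements of a regular sequence\<close>

text \<open>Multiplication by \<open>a\<close> is injective modulo the ideal of \<open>B\<close>. The quotient may be zero.\<close>

definition nonzerodivisor_mod :: "'a::comm_ring_1 set \<Rightarrow> 'a \<Rightarrow> bool" where
  "nonzerodivisor_mod B a \<longleftrightarrow> (\<forall>g. a * g \<in> ideal_of B \<longrightarrow> g \<in> ideal_of B)"

lemma ideal_of_insertI: "x - c * a \<in> ideal_of B \<Longrightarrow> x \<in> ideal_of (insert a B)"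
proof -
  assume "x - c * a \<in> ideal_of B"
  then have "x - c * a \<in> ideal_of (insert a B)"
    using ideal_of_mono[of B "insert a B"] by blast
  moreover have "c * a \<in> ideal_of (insert a B)"
    by (intro ideal_of_mult ideal_of_base) simp
  ultimately show ?thesis using ideal_of_add[of "x - c * a" "insert a B" "c * a"] by simp
qed

lemma nonzerodivisor_exchange:
  assumes a: "nonzerodivisor_mod B a" and b: "nonzerodivisor_mod (insert a B) b"
  shows "nonzerodivisor_mod (insert b B) a"
  unfolding nonzerodivisor_mod_def
proof (intro allI impI)
  fix g assume "a * g \<in> ideal_of (insert b B)"
  then obtain h where h: "a * g - h * b \<in> ideal_of B" by (rule ideal_of_insertE)
  then have "b * h - g * a \<in> ideal_of B"
    using ideal_of_mult[OF h, of "- 1"] by (simp add: ac_simps)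
  then have "b * h \<in> ideal_of (insert a B)" by (rule ideal_of_insertI)
  then have "h \<in> ideal_of (insert a B)" using b unfolding nonzerodivisor_mod_def by blast
  then obtain h' where h': "h - h' * a \<in> ideal_of B" by (rule ideal_of_insertE)
  have "a * (g - h' * b) = (a * g - h * b) + b * (h - h' * a)"
    by (simp add: algebra_simps)
  also have "\<dots> \<in> ideal_of B" by (intro ideal_of_add ideal_of_mult h h')
  finally have "g - h' * b \<in> ideal_of B" using a unfolding nonzerodivisor_mod_def by blast
  then show "g \<in> ideal_of (insert b B)" by (rule ideal_of_insertI)
qed

text \<open>In a regular sequence every member is a nonzerodivisor modulo all the others: by the exchange
  lemma it can be moved past its successors one at a time.\<close>

lemma regular_sequence_nonzerodivisor:
  fixes f :: "'r::{finite,linorder} \<Rightarrow> 'a::comm_ring_1"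
  assumes "regular_sequence f"
  shows "nonzerodivisor_mod (f ` (UNIV - {i})) (f i)"
proof -
  have reg: "nonzerodivisor_mod (f ` {..<j}) (f j)" for j
    using assms unfolding regular_sequence_def nonzerodivisor_mod_def by blast
  have "(\<forall>x\<in>T. i < x) \<longrightarrow> (\<forall>x\<in>T. \<forall>y. i < y \<and> y < x \<longrightarrow> y \<in> T) \<longrightarrow>
      nonzerodivisor_mod (f ` ({..<i} \<union> T)) (f i)" if "finite T" for T
    using that
  proof (induction T rule: finite_linorder_max_induct)
    case empty
    then show ?case using reg by simp
  next
    case (insert b A)
    show ?case
    proof (intro impI)
      assume gt: "\<forall>x\<in>insert b A. i < x"
        and down: "\<forall>x\<in>insert b A. \<forall>y. i < y \<and> y < x \<longrightarrow> y \<in> insert b A"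
      have "\<forall>x\<in>A. \<forall>y. i < y \<and> y < x \<longrightarrow> y \<in> A"
      proof (intro ballI allI impI)
        fix x y assume "x \<in> A" "i < y \<and> y < x"
        then have "y \<in> insert b A" "y < b" using down insert.hyps(2) by (auto dest: order.strict_trans)
        then show "y \<in> A" by auto
      qed
      then have IH: "nonzerodivisor_mod (f ` ({..<i} \<union> A)) (f i)" using insert.IH gt by blast
      have "insert i ({..<i} \<union> A) = {..<b}"
      proof (intro equalityI subsetI)
        fix y assume "y \<in> insert i ({..<i} \<union> A)"
        then show "y \<in> {..<b}" using gt insert.hyps(2) by (auto dest: order.strict_trans)
      next
        fix y assume "y \<in> {..<b}"
        then show "y \<in> insert i ({..<i} \<union> A)"
          using down by (cases "i < y") auto
      qed
      then have "insert (f i) (f ` ({..<i} \<union> A)) = f ` {..<b}" by (metis image_insert)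
      then have "nonzerodivisor_mod (insert (f i) (f ` ({..<i} \<union> A))) (f b)" using reg by simp
      then have "nonzerodivisor_mod (insert (f b) (f ` ({..<i} \<union> A))) (f i)"
        by (rule nonzerodivisor_exchange[OF IH])
      then show "nonzerodivisor_mod (f ` ({..<i} \<union> insert b A)) (f i)" by simp
    qed
  qed
  from this[of "{i<..}"] have "nonzerodivisor_mod (f ` ({..<i} \<union> {i<..})) (f i)" by simp
  moreover have "{..<i} \<union> {i<..} = UNIV - {i}" by auto
  ultimately show ?thesis by simp
qed

lemma nonzerodivisor_power:
  assumes "nonzerodivisor_mod B a" "a ^ n \<in> ideal_of B"
  shows "1 \<in> ideal_of B"
  using assms(2)
proof (induction n)
  case (Suc n)
  then show ?case using assms(1) by (simp add: nonzerodivisor_mod_def)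
qed simp

subsection \<open>Diagonal coefficients\<close>

text \<open>The radical of the ideal generated by \<open>B\<close>.\<close>

definition radical_of :: "'a::comm_ring_1 set \<Rightarrow> 'a set" where
  "radical_of B = {p. \<exists>n. p ^ n \<in> ideal_of B}"

lemma radical_of_add:
  assumes "p \<in> radical_of B" "q \<in> radical_of B"
  shows "p + q \<in> radical_of B"
proof -
  obtain n m where nm: "p ^ n \<in> ideal_of B" "q ^ m \<in> ideal_of B"
    using assms unfolding radical_of_def by blast
  have "(p + q) ^ (n + m) = (\<Sum>k\<le>n + m. of_nat (n + m choose k) * p ^ k * q ^ (n + m - k))"
    by (rule binomial_ring)
  also have "\<dots> \<in> ideal_of B"
  proof (rule ideal_of_sum)
    fix k assume "k \<in> {..n + m}"
    show "of_nat (n + m choose k) * p ^ k * q ^ (n + m - k) \<in> ideal_of B"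
    proof (cases "n \<le> k")
      case True
      then have "p ^ k = p ^ n * p ^ (k - n)" by (simp flip: power_add)
      then have "p ^ k \<in> ideal_of B" using ideal_of_mult_right[OF nm(1)] by simp
      then show ?thesis by (intro ideal_of_mult_right[OF ideal_of_mult])
    next
      case False
      then have "n + m - k = m + (n - k)" by simp
      then have "q ^ (n + m - k) = q ^ m * q ^ (n - k)" by (simp only: power_add)
      then have "q ^ (n + m - k) \<in> ideal_of B" using ideal_of_mult_right[OF nm(2)] by simp
      then show ?thesis by (rule ideal_of_mult)
    qed
  qed
  finally show ?thesis unfolding radical_of_def by blast
qed

lemma radical_of_mult: "p \<in> radical_of B \<Longrightarrow> q * p \<in> radical_of B"
  unfolding radical_of_def by (auto simp: power_mult_distrib intro: ideal_of_mult)

lemma radical_of_base: "p \<in> B \<Longrightarrow> p \<in> radical_of B"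
  unfolding radical_of_def using ideal_of_base by (auto intro!: exI[of _ 1])

lemma radical_of_square: "p ^ 2 \<in> radical_of B \<Longrightarrow> p \<in> radical_of B"
  unfolding radical_of_def by (auto simp flip: power_mult)

lemma zero_in_radical: "0 \<in> radical_of B"
  unfolding radical_of_def by (auto intro!: exI[of _ 1])

lemma quadric_without_square:
  fixes p :: "('i::{finite,linorder}, 'k::comm_ring_1) mpol"
  assumes p: "homogeneous 2 p" "p \<in> polys_in {i..}" and "lookup p (Poly_Mapping.single i 2) = 0"
    and rad: "\<And>k. i < k \<Longrightarrow> Var k \<in> radical_of B"
  shows "p \<in> radical_of B"
proof (induction p rule: mpol_linear_induct)
  case (4 m)
  have m: "mon_deg m = 2" "keys m \<subseteq> {i..}" "m \<noteq> Poly_Mapping.single i 2"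
    using 4 p assms(3) by (auto simp: homogeneous_def polys_in_def in_keys_iff)
  have "\<exists>k>i. lookup m k \<noteq> 0"
  proof (rule ccontr)
    assume no: "\<not> (\<exists>k>i. lookup m k \<noteq> 0)"
    have zero: "lookup m k = 0" if "k \<noteq> i" for k
    proof (rule ccontr)
      assume nz: "lookup m k \<noteq> 0"
      then have "k \<in> keys m" by (simp add: in_keys_iff)
      then have "i \<le> k" using m(2) by blast
      then have "i < k" using that by simp
      then show False using no nz by blast
    qed
    have "mon_deg m = (\<Sum>k\<in>UNIV. if k = i then lookup m i else 0)"
      unfolding mon_deg_UNIV by (intro sum.cong refl) (simp add: zero)
    then have "lookup m i = 2" using m(1) by simp
    then have "m = Poly_Mapping.single i 2"
      using zero by (intro poly_mapping_eqI) (auto simp: lookup_single when_def)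
    then show False using m(3) by simp
  qed
  then obtain k where k: "i < k" "lookup m k \<ge> 1" by (auto simp: Suc_le_eq)
  obtain a where "m = a + Poly_Mapping.single k 1" using mon_deg_split[OF k(2)] by blast
  then have "monomial m = monomial a * (Var k :: ('i, 'k) mpol)" by (simp add: monomial_add Var_def)
  then show ?case using radical_of_mult[OF rad[OF k(1)]] by simp
qed (use zero_in_radical radical_of_add radical_of_mult in blast)+

text \<open>For the last \<open>j\<close> with vanishing diagonal coefficient, the later members of the sequence make the
  variables after \<open>j\<close> nilpotent, starting from the last one; hence \<open>f j\<close> is nilpotent modulo them,
  while it is a nonzerodivisor modulo the other members.\<close>

lemma regular_triangular_diagonal:
  fixes f :: "'i::{finite,linorder} \<Rightarrow> ('i, 'k::field) mpol"
  assumes hom: "\<And>i. homogeneous 2 (f i)" and reg: "regular_sequence f"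
    and tri: "\<And>i. f i \<in> polys_in {i..}"
  shows "lookup (f i) (Poly_Mapping.single i 2) \<noteq> 0"
proof
  assume "lookup (f i) (Poly_Mapping.single i 2) = 0"
  let ?Z = "{i. lookup (f i) (Poly_Mapping.single i 2) = 0}"
  define j where "j = Max ?Z"
  have j: "j \<in> ?Z" unfolding j_def by (rule Max_in) (use \<open>_ = 0\<close> in auto)
  have diag: "lookup (f k) (Poly_Mapping.single k 2) \<noteq> 0" if "j < k" for k
    using Max_ge[of ?Z k] that unfolding j_def by (auto simp: not_le[symmetric])
  let ?B = "f ` {j<..}"
  have Var: "j < k \<Longrightarrow> Var k \<in> radical_of ?B" for k
  proof (induction "card {k<..}" arbitrary: k rule: less_induct)
    case less
    define a where "a = lookup (f k) (Poly_Mapping.single k 2)"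
    have a: "a \<noteq> 0" unfolding a_def by (rule diag[OF less.prems])
    have rest: "f k - Const a * Var k ^ 2 \<in> radical_of ?B"
    proof (rule quadric_without_square)
      show "homogeneous 2 (f k - Const a * Var k ^ 2)"
        using homogeneous_power[OF homogeneous_Var, of 2 k]
        by (intro homogeneous_diff hom homogeneous_Const_mult) simp
      show "f k - Const a * Var k ^ 2 \<in> polys_in {k..}"
      proof -
        have "keys m \<subseteq> {k..}" if "m \<in> keys (f k - Const a * Var k ^ 2)" for m
        proof (cases "m \<in> keys (f k)")
          case True
          then show ?thesis using tri[of k] by (simp add: polys_in_def)
        next
          case False
          then have "m = Poly_Mapping.single k 2"
            using that by (auto simp: in_keys_iff lookup_minus Var_power lookup_Const_mult
                lookup_monomial simp del: single_numeral split: if_splits)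
          then show ?thesis by (simp del: single_numeral)
        qed
        then show ?thesis by (simp add: polys_in_def)
      qed
      show "lookup (f k - Const a * Var k ^ 2) (Poly_Mapping.single k 2) = 0"
        by (simp add: lookup_minus Var_power lookup_Const_mult lookup_monomial a_def
            del: single_numeral)
      show "Var l \<in> radical_of ?B" if "k < l" for l
      proof (rule less.hyps)
        have "{l<..} \<subset> {k<..}" using that by (auto dest: order.strict_trans)
        then show "card {l<..} < card {k<..}" by (intro psubset_card_mono) auto
        show "j < l" using that less.prems by simp
      qed
    qed
    have fk: "f k \<in> radical_of ?B" using less.prems by (intro radical_of_base) simp
    have "Var k ^ 2 = Const (1 / a) * f k + Const (- 1 / a) * (f k - Const a * Var k ^ 2)"
    proof -
      have c: "Const (- 1 / a) = - (Const (1 / a) :: ('i, 'k) mpol)"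
        by (simp flip: Const_uminus)
      have "Const (1 / a) * (Const a * Var k ^ 2) = Const (1 / a * a) * (Var k ^ 2 :: ('i, 'k) mpol)"
        by (simp only: Const_mult mult.assoc)
      then have "Const (1 / a) * (Const a * Var k ^ 2) = (Var k ^ 2 :: ('i, 'k) mpol)" using a by simp
      then show ?thesis unfolding c by (simp add: right_diff_distrib)
    qed
    also have "\<dots> \<in> radical_of ?B" by (intro radical_of_add radical_of_mult fk rest)
    finally show ?case by (rule radical_of_square)
  qed
  have "f j \<in> radical_of ?B"
    using quadric_without_square[OF hom tri _ Var] j by blast
  then obtain n where "f j ^ n \<in> ideal_of ?B" unfolding radical_of_def by blast
  moreover have "ideal_of ?B \<subseteq> ideal_of (f ` (UNIV - {j}))"
    by (intro ideal_of_mono image_mono) auto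
  ultimately have "f j ^ n \<in> ideal_of (f ` (UNIV - {j}))" by blast
  then have "1 \<in> ideal_of (f ` (UNIV - {j}))"
    by (rule nonzerodivisor_power[OF regular_sequence_nonzerodivisor[OF reg]])
  moreover have "ideal_of (f ` (UNIV - {j})) \<subseteq> ideal_of (f ` UNIV)"
    by (intro ideal_of_mono image_mono) auto
  ultimately have one: "1 \<in> ideal_of (f ` UNIV)" by blast
  have "x \<in> ideal_of (f ` UNIV)" for x using ideal_of_mult[OF one, of x] by simp
  then have "ideal_of (f ` UNIV) = UNIV" by blast
  then show False using reg unfolding regular_sequence_def by blast
qed

subsection \<open>Degeneration to the squares of the variables\<close>

lemma Const_power: "Const (a ^ n) = Const a ^ n"
  by (induction n) (simp_all add: Const_mult)

lemma Const_prod: "Const (prod h A) = (\<Prod>x\<in>A. Const (h x))"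
  by (induction A rule: infinite_finite_induct) (simp_all add: Const_mult)

text \<open>Weights that increase strictly with the index. Among the quadratic monomials in the variables from
  \<open>i\<close> on, the square of the variable \<open>i\<close> is then the only one of least weight.\<close>

definition weight :: "'i::{finite,linorder} \<Rightarrow> nat" where
  "weight i = card {..<i}"

lemma weight_mono: "i \<le> j \<Longrightarrow> weight i \<le> weight j"
  unfolding weight_def by (intro card_mono) auto

lemma weight_strict_mono: "i < j \<Longrightarrow> weight i < weight j"
  unfolding weight_def by (intro psubset_card_mono) auto

definition mon_weight :: "'i::{finite,linorder} monom \<Rightarrow> nat" where
  "mon_weight m = (\<Sum>j\<in>UNIV. weight j * lookup m j)"

text \<open>The coordinate change that multiplies each variable by the power of \<open>t\<close> given by its weight.\<close>

definition diag_matrix :: "'k::comm_ring_1 \<Rightarrow> (('k, 'i::{finite,linorder}) vec, 'i) vec" where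
  "diag_matrix t = (\<chi> i j. if i = j then t ^ weight i else 0)"

lemma lin_change_diag_Var: "lin_change (diag_matrix t) (Var j) = Const (t ^ weight j) * Var j"
  for t :: "'k::comm_ring_1"
proof -
  have "lin_change (diag_matrix t) (Var j) = (\<Sum>i\<in>UNIV. if i = j then Const (t ^ weight j) * Var j else 0)"
    unfolding lin_change_Var by (intro sum.cong) (auto simp: diag_matrix_def)
  then show ?thesis by simp
qed

lemma lin_change_diag_monomial:
  "lin_change (diag_matrix t) (monomial m) = Const (t ^ mon_weight m) * monomial m"
  for t :: "'k::comm_ring_1"
proof -
  have "lin_change (diag_matrix t) (monomial m)
      = (\<Prod>j\<in>UNIV. Const ((t ^ weight j) ^ lookup m j)) * (\<Prod>j\<in>UNIV. Var j ^ lookup m j)"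
    unfolding lin_change_monomial lin_change_diag_Var power_mult_distrib Const_power[symmetric]
    by (rule prod.distrib)
  also have "(\<Prod>j\<in>UNIV. Const ((t ^ weight j) ^ lookup m j)) = Const (t ^ mon_weight m)"
    unfolding Const_prod[symmetric] mon_weight_def by (simp add: power_sum power_mult)
  finally show ?thesis by (simp add: monomial_prod_Var[symmetric])
qed

lemma mon_weight_single: "mon_weight (Poly_Mapping.single i k) = weight i * k"
proof -
  have "mon_weight (Poly_Mapping.single i k) = (\<Sum>j\<in>UNIV. if j = i then weight i * k else 0)"
    unfolding mon_weight_def by (intro sum.cong) (auto simp: lookup_single)
  then show ?thesis by simp
qed

lemma mon_weight_triangular:
  fixes m :: "'i::{finite,linorder} monom"
  assumes "mon_deg m = 2" "keys m \<subseteq> {i..}"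
  shows "mon_weight m \<ge> 2 * weight i"
    and "m \<noteq> Poly_Mapping.single i 2 \<Longrightarrow> mon_weight m > 2 * weight i"
proof -
  have le: "weight i * lookup m j \<le> weight j * lookup m j" for j
  proof (cases "j \<in> keys m")
    case True
    then show ?thesis using assms(2) by (intro mult_right_mono weight_mono) auto
  qed (simp add: in_keys_iff)
  have eq: "2 * weight i = (\<Sum>j\<in>UNIV. weight i * lookup m j)"
    using assms(1) by (simp add: mon_deg_UNIV sum_distrib_left[symmetric])
  show "mon_weight m \<ge> 2 * weight i"
    unfolding eq mon_weight_def by (intro sum_mono le)
  assume ne: "m \<noteq> Poly_Mapping.single i 2"
  have "\<exists>k\<in>keys m. k \<noteq> i"
  proof (rule ccontr)
    assume "\<not> (\<exists>k\<in>keys m. k \<noteq> i)"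
    then have zero: "lookup m k = 0" if "k \<noteq> i" for k
      using that by (auto simp: in_keys_iff)
    have "mon_deg m = (\<Sum>k\<in>UNIV. if k = i then lookup m i else 0)"
      unfolding mon_deg_UNIV by (intro sum.cong refl) (simp add: zero)
    then have "lookup m i = 2" using assms(1) by simp
    then have "m = Poly_Mapping.single i 2"
      using zero by (intro poly_mapping_eqI) (auto simp: lookup_single when_def)
    then show False using ne by simp
  qed
  then obtain k where k: "k \<in> keys m" "i < k" using assms(2) by force
  have "weight i * lookup m k < weight k * lookup m k"
    using weight_strict_mono[OF k(2)] k(1) by (simp add: in_keys_iff)
  then show "mon_weight m > 2 * weight i"
    unfolding eq mon_weight_def by (intro sum_strict_mono_ex1 ballI le bexI[of _ k]) simp_all
qed

text \<open>For triangular quadrics \<open>f\<close> with nonzero diagonal coefficients: at \<open>t \<noteq> 0\<close>, the image of \<open>f\<close> under the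
  diagonal coordinate change, up to nonzero scalars, and at \<open>t = 0\<close> the squares of the variables. The
  subtraction of exponents does not truncate on the monomials of \<open>f i\<close>.\<close>

definition degeneration :: "('i::{finite,linorder} \<Rightarrow> ('i, 'k::field) mpol) \<Rightarrow> 'k \<Rightarrow> 'i \<Rightarrow> ('i, 'k) mpol" where
  "degeneration f t i = (\<Sum>m\<in>keys (f i). Const (lookup (f i) m / lookup (f i) (Poly_Mapping.single i 2)
     * t ^ (mon_weight m - 2 * weight i)) * monomial m)"

lemma homogeneous_degeneration:
  assumes "homogeneous d (f i)"
  shows "homogeneous d (degeneration f t i)"
proof -
  have "homogeneous d (monomial m)" if "m \<in> keys (f i)" for m
    using assms that homogeneous_monomial[of m] by (auto simp: homogeneous_def)
  then show ?thesis
    unfolding degeneration_def by (intro homogeneous_sum homogeneous_Const_mult)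
qed

context
  fixes f :: "'i::{finite,linorder} \<Rightarrow> ('i, 'k::field) mpol"
  assumes hom: "\<And>i. homogeneous 2 (f i)" and tri: "\<And>i. f i \<in> polys_in {i..}"
    and diag: "\<And>i. lookup (f i) (Poly_Mapping.single i 2) \<noteq> 0"
begin

lemma degeneration_0: "degeneration f 0 i = Var i ^ 2"
proof -
  let ?s = "Poly_Mapping.single i 2"
  have "degeneration f 0 i = (\<Sum>m\<in>keys (f i). if m = ?s then monomial ?s else 0)"
    unfolding degeneration_def
  proof (intro sum.cong refl)
    fix m assume m: "m \<in> keys (f i)"
    then have *: "mon_deg m = 2" "keys m \<subseteq> {i..}"
      using hom[of i] tri[of i] by (auto simp: homogeneous_def polys_in_def)
    show "Const (lookup (f i) m / lookup (f i) ?s * 0 ^ (mon_weight m - 2 * weight i)) * monomial m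
        = (if m = ?s then monomial ?s else 0)"
    proof (cases "m = ?s")
      case True
      then have "mon_weight m - 2 * weight i = 0" by (simp add: mon_weight_single del: single_numeral)
      then show ?thesis using True diag[of i] by (simp del: single_numeral)
    next
      case False
      then have "mon_weight m - 2 * weight i > 0" using mon_weight_triangular(2)[OF *] by simp
      then have "(0 :: 'k) ^ (mon_weight m - 2 * weight i) = 0" by (rule zero_power)
      then show ?thesis using False by (simp only: mult_zero_right mult_zero_left Const_0 if_False)
    qed
  qed
  also have "\<dots> = monomial ?s" using diag[of i] by (simp add: in_keys_iff del: single_numeral)
  finally show ?thesis by (simp only: Var_power)
qed

lemma lin_change_diag_degeneration:
  assumes "t \<noteq> 0"
  shows "lin_change (diag_matrix t) (f i)
    = Const (lookup (f i) (Poly_Mapping.single i 2) * t ^ (2 * weight i)) * degeneration f t i"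
proof -
  let ?a = "lookup (f i) (Poly_Mapping.single i 2)"
  have "lin_change (diag_matrix t) (f i)
      = lin_change (diag_matrix t) (\<Sum>m\<in>keys (f i). Const (lookup (f i) m) * monomial m)"
    by (rule arg_cong[OF mpol_expand])
  also have "\<dots> = (\<Sum>m\<in>keys (f i). Const (lookup (f i) m) * (Const (t ^ mon_weight m) * monomial m))"
    by (simp only: lin_change_sum lin_change_Const_mult lin_change_diag_monomial)
  also have "\<dots> = (\<Sum>m\<in>keys (f i). Const (?a * t ^ (2 * weight i)) *
      (Const (lookup (f i) m / ?a * t ^ (mon_weight m - 2 * weight i)) * monomial m))"
  proof (intro sum.cong refl)
    fix m assume "m \<in> keys (f i)"
    then have "mon_deg m = 2" "keys m \<subseteq> {i..}"
      using hom[of i] tri[of i] by (auto simp: homogeneous_def polys_in_def)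
    then have "mon_weight m = 2 * weight i + (mon_weight m - 2 * weight i)"
      using mon_weight_triangular(1)[of m i] by simp
    then have "t ^ mon_weight m = t ^ (2 * weight i) * t ^ (mon_weight m - 2 * weight i)"
      by (metis power_add)
    then have "lookup (f i) m * t ^ mon_weight m
        = ?a * t ^ (2 * weight i) * (lookup (f i) m / ?a * t ^ (mon_weight m - 2 * weight i))"
      using diag[of i] by (simp del: single_numeral)
    then show "Const (lookup (f i) m) * (Const (t ^ mon_weight m) * monomial m) = Const (?a * t ^ (2 * weight i)) *
      (Const (lookup (f i) m / ?a * t ^ (mon_weight m - 2 * weight i)) * monomial m)"
      by (simp only: mult.assoc[symmetric] Const_mult[symmetric])
  qed
  finally show ?thesis unfolding degeneration_def sum_distrib_left .
qed

end

lemma invertible_diag_matrix: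
  assumes "t \<noteq> (0 :: 'k::field)"
  shows "invertible (diag_matrix t :: (('k, 'i::{finite,linorder}) vec, 'i) vec)"
proof -
  have mult: "diag_matrix s ** diag_matrix r = (mat 1 :: (('k, 'i) vec, 'i) vec)" if "s * r = 1" for s r :: 'k
  proof -
    have "(\<Sum>k\<in>UNIV. (if i = k then s ^ weight i else 0) * (if k = j then r ^ weight k else 0))
        = (if i = j then 1 else 0)" for i j :: 'i
    proof -
      have "(\<Sum>k\<in>UNIV. (if i = k then s ^ weight i else 0) * (if k = j then r ^ weight k else 0))
          = (\<Sum>k\<in>UNIV. if k = i then (if i = j then (s * r) ^ weight i else 0) else 0)"
        by (intro sum.cong refl) (auto simp: power_mult_distrib)
      then show ?thesis using that by simp
    qed
    then show ?thesis
      by (simp add: matrix_matrix_mult_def diag_matrix_def mat_def vec_eq_iff)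
  qed
  show ?thesis
    unfolding invertible_def using mult[of t "1 / t"] mult[of "1 / t" t] assms by auto
qed

section \<open>The generic initial ideal\<close>

lemma is_gin_if_spanning:
  fixes f :: "5 \<Rightarrow> (5, 'k::field) mpol"
  assumes hom: "\<And>i. homogeneous 2 (f i)" and A: "invertible A"
    and sp: "spanning (\<lambda>i. lin_change A (f i))"
  shows "is_gin (ideal_of (f ` UNIV)) gin_ideal"
proof -
  let ?x = "\<lambda>(A :: 'k^5^5) (i, j). A $ i $ j"
  let ?D = "{A :: 'k^5^5. invertible A}"
  interpret function_ring "polynomial_functions ?x ?D" ?D
    by (rule function_ring_polynomial_functions)
  have coord: "(\<lambda>A. A $ i $ j) \<in> polynomial_functions ?x ?D" for i j
    using coordinate_polynomial_function[of ?x "(i, j)" ?D] by simp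
  have fam: "family (\<lambda>A. lin_change A (f i))" for i
    by (rule family_lin_change[where d = 2, OF coord family_const]) (rule hom)
  obtain u where u: "u \<in> polynomial_functions ?x ?D" "u A \<noteq> 0"
    "\<And>B. u B \<noteq> 0 \<Longrightarrow> spanning (\<lambda>i. lin_change B (f i))"
    by (rule spanning_open[where G = "\<lambda>B i. lin_change B (f i)", OF fam sp]) (rule that)
  show ?thesis
    unfolding is_gin_def
  proof (intro exI[of _ "{B \<in> ?D. u B \<noteq> 0}"] conjI ballI)
    show "{B \<in> ?D. u B \<noteq> 0} \<noteq> {}" using u(2) A by blast
    show "zariski_open_in ?x ?D {B \<in> ?D. u B \<noteq> 0}"
      by (rule zariski_open_polynomial_function[OF u(1)])
    fix B assume "B \<in> {B \<in> ?D. u B \<noteq> 0}"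
    then have B: "invertible B" "spanning (\<lambda>i. lin_change B (f i))" using u(3) by simp_all
    show "initial_ideal (lin_change B ` ideal_of (f ` UNIV)) = gin_ideal"
      unfolding lin_change_ideal_of[OF B(1)]
      by (rule initial_ideal_spanning[OF B(2) homogeneous_lin_change[OF hom]])
  qed
qed

lemma lin_change_base_square: "lin_change base_matrix (Var i ^ 2) = base_form i ^ 2"
  by (simp add: lin_change_power base_form_def)

lemma homogeneous_Var_square: "homogeneous 2 (Var i ^ 2 :: ('i::finite, 'k::comm_semiring_1) mpol)"
  using homogeneous_power[OF homogeneous_Var, of 2 i] by simp

text \<open>The open set of sequences is given by a fixed coordinate change, the one for the squares of the
  variables.\<close>

lemma generic_gin:
  "for_generic_forms 2 (\<lambda>f :: 5 \<Rightarrow> (5, 'k::field_char_0) mpol. is_gin (ideal_of (f ` UNIV)) gin_ideal)"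
proof -
  let ?x = "\<lambda>(f :: 5 \<Rightarrow> (5, 'k) mpol) (r, m). lookup (f r) m"
  let ?D = "{f :: 5 \<Rightarrow> (5, 'k) mpol. \<forall>r. homogeneous 2 (f r)}"
  interpret function_ring "polynomial_functions ?x ?D" ?D
    by (rule function_ring_polynomial_functions)
  have coord: "(\<lambda>f. lookup (f r) m) \<in> polynomial_functions ?x ?D" for r m
    using coordinate_polynomial_function[of ?x "(r, m)" ?D] by simp
  have fam: "family (\<lambda>f. lin_change base_matrix (f i))" for i
    by (rule family_lin_change[where d = 2]) (auto simp: family_def coord)
  have sp: "spanning (\<lambda>i. lin_change base_matrix (Var i ^ 2 :: (5, 'k) mpol))"
    unfolding lin_change_base_square by (rule spanning_base)
  obtain u where u: "u \<in> polynomial_functions ?x ?D" "u (\<lambda>i. Var i ^ 2) \<noteq> 0"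
    "\<And>f. u f \<noteq> 0 \<Longrightarrow> spanning (\<lambda>i. lin_change base_matrix (f i))"
    by (rule spanning_open[where G = "\<lambda>f i. lin_change base_matrix (f i)" and ?a0.0 = "\<lambda>i. Var i ^ 2",
        OF fam sp]) (rule that)
  show ?thesis
    unfolding for_generic_forms_def
  proof (intro exI[of _ "{f \<in> ?D. u f \<noteq> 0}"] conjI ballI)
    have "(\<lambda>i. Var i ^ 2) \<in> {f \<in> ?D. u f \<noteq> 0}" using u(2) by (simp add: homogeneous_Var_square)
    then show "{f \<in> ?D. u f \<noteq> 0} \<noteq> {}" by (metis empty_iff)
    show "zariski_open_in ?x ?D {f \<in> ?D. u f \<noteq> 0}"
      by (rule zariski_open_polynomial_function[OF u(1)])
    fix f assume "f \<in> {f \<in> ?D. u f \<noteq> 0}"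
    then have f: "\<And>i. homogeneous 2 (f i)" "spanning (\<lambda>i. lin_change base_matrix (f i))" using u(3) by simp_all
    show "is_gin (ideal_of (f ` UNIV)) gin_ideal"
      by (rule is_gin_if_spanning[OF f(1) invertible_base_matrix f(2)])
  qed
qed

lemma spanning_scale:
  fixes g :: "5 \<Rightarrow> (5, 'k::field) mpol"
  assumes "spanning (\<lambda>i. Const (c i) * g i)"
  shows "spanning g"
proof -
  have "ideal_of ((\<lambda>i. Const (c i) * g i) ` UNIV) \<subseteq> ideal_of (g ` UNIV)"
    by (rule ideal_of_subset) (auto intro: ideal_of_mult ideal_of_base)
  then show ?thesis using assms unfolding spanning_def by blast
qed

lemma triangular_gin:
  fixes f :: "5 \<Rightarrow> (5, 'k::field_char_0) mpol"
  assumes hom: "\<And>i. homogeneous 2 (f i)" and reg: "regular_sequence f"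
    and tri: "\<And>i. f i \<in> polys_in {i..}"
  shows "is_gin (ideal_of (f ` UNIV)) gin_ideal"
proof -
  have diag: "lookup (f i) (Poly_Mapping.single i 2) \<noteq> 0" for i
    by (rule regular_triangular_diagonal[OF hom reg tri])
  let ?F = "degeneration f"
  let ?R = "range (poly :: 'k poly \<Rightarrow> 'k \<Rightarrow> 'k)"
  interpret function_ring ?R UNIV by (rule function_ring_poly)
  have t_pow: "(\<lambda>t. t ^ n) \<in> ?R" for n
    by (rule range_eqI[of _ _ "monom 1 n"]) (simp add: fun_eq_iff poly_monom)
  have fam_F: "family (\<lambda>t. ?F t i)" for i
    unfolding degeneration_def
    by (intro family_sum family_mult family_Const family_const mult const t_pow)
  have fam: "family (\<lambda>t. lin_change base_matrix (?F t i))" for i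
    by (rule family_lin_change[where d = 2, OF const fam_F]) (rule homogeneous_degeneration[OF hom])
  have sp: "spanning (\<lambda>i. lin_change base_matrix (?F 0 i))"
    unfolding degeneration_0[OF hom tri diag] lin_change_base_square by (rule spanning_base)
  obtain u where u: "u \<in> ?R" "u 0 \<noteq> 0" "\<And>t. u t \<noteq> 0 \<Longrightarrow> spanning (\<lambda>i. lin_change base_matrix (?F t i))"
    by (rule spanning_open[where G = "\<lambda>t i. lin_change base_matrix (?F t i)", OF fam sp]) (rule that)
  \<comment> \<open>A nonzero polynomial has a nonzero value away from \<open>0\<close>, as the field is infinite.\<close>
  obtain p where p: "u = poly p" using u(1) by blast
  have "p \<noteq> 0" using u(2) p by auto
  then have "finite (insert 0 {t. poly p t = 0})" using poly_roots_finite by blast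
  then obtain t where t: "t \<noteq> 0" "u t \<noteq> 0"
    using ex_new_if_finite[OF infinite_UNIV_char_0] p by blast
  define c where "c i = inverse (lookup (f i) (Poly_Mapping.single i 2) * t ^ (2 * weight i))" for i
  have F: "?F t i = Const (c i) * lin_change (diag_matrix t) (f i)" for i
  proof -
    let ?b = "lookup (f i) (Poly_Mapping.single i 2) * t ^ (2 * weight i)"
    have "?b \<noteq> 0" using diag[of i] t(1) by simp
    then have "c i * ?b = 1" unfolding c_def by (rule left_inverse)
    then have "Const (c i) * (Const ?b * ?F t i) = ?F t i"
      by (metis Const_1 Const_mult mult.assoc mult_1)
    then show ?thesis
      unfolding lin_change_diag_degeneration[OF hom tri diag t(1)] ..
  qed
  have "spanning (\<lambda>i. Const (c i) * lin_change (base_matrix ** diag_matrix t) (f i))"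
    using u(3)[OF t(2)] unfolding F lin_change_Const_mult lin_change_lin_change .
  then have "spanning (\<lambda>i. lin_change (base_matrix ** diag_matrix t) (f i))"
    by (rule spanning_scale)
  moreover have "invertible (base_matrix ** diag_matrix t)"
    by (rule invertible_mult[OF invertible_base_matrix invertible_diag_matrix[OF t(1)]])
  ultimately show ?thesis by (intro is_gin_if_spanning[OF hom])
qed

theorem proposition2p5p2:
  shows "let J :: (5, 'k::{alg_closed_field, field_char_0}) mpol set = ideal_of
      {x\<^sub>1^2, x\<^sub>1 * x\<^sub>2, x\<^sub>2^2, x\<^sub>1 * x\<^sub>3, x\<^sub>2 * x\<^sub>3, x\<^sub>3^3, x\<^sub>3^2 * x\<^sub>4,
       x\<^sub>1 * x\<^sub>4^2, x\<^sub>2 * x\<^sub>4^2, x\<^sub>3 * x\<^sub>4^2, x\<^sub>4^3,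
       x\<^sub>3^2 * x\<^sub>5^2, x\<^sub>1 * x\<^sub>4 * x\<^sub>5^2, x\<^sub>2 * x\<^sub>4 * x\<^sub>5^2, x\<^sub>3 * x\<^sub>4 * x\<^sub>5^2, x\<^sub>4^2 * x\<^sub>5^2,
       x\<^sub>5^4 * x\<^sub>1, x\<^sub>5^4 * x\<^sub>2, x\<^sub>5^4 * x\<^sub>3, x\<^sub>5^4 * x\<^sub>4, x\<^sub>5^6}
    in
      for_generic_forms 2 (\<lambda>f :: 5 \<Rightarrow> (5, 'k) mpol. is_gin (ideal_of (f ` UNIV)) J) \<and>
      (\<forall>f :: 5 \<Rightarrow> (5, 'k) mpol.
         (\<forall>i. homogeneous 2 (f i)) \<and> regular_sequence f \<and> (\<forall>i. f i \<in> polys_in {i..}) \<longrightarrow>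
         is_gin (ideal_of (f ` UNIV)) J)"
  unfolding Let_def gin_ideal_eq[symmetric]
  using generic_gin triangular_gin by blast

end
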